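(* Every conformal diffeomorphism of $\mathbb{H}^2\times\mathbb{R}$, of $\mathbb{S}^2\times\mathbb{R}$, and of $Sol$ onto itself is an isometry.
   Context: $\mathbb{H}^2\times\mathbb{R}$ and $\mathbb{S}^2\times\mathbb{R}$ carry the product metrics (curvature $-1$, resp. $+1$, on the first factor); $Sol$ is $\mathbb{R}^3$ with metric $e^{2z}dx^2+e^{-2z}dy^2+dz^2$. A diffeomorphism $\phi$ of a Riemannian manifold $(M,g)$ is conformal if $\phi^*g=f\,g$ for some positive smooth function $f$. *)

theory Defs
  imports "HOL-Analysis.Analysis"
begin

fun Ck_on :: "nat \<Rightarrow> 'a::euclidean_space set \<Rightarrow> ('a \<Rightarrow> 'b::real_normed_vector) \<Rightarrow> bool" where
  "Ck_on 0 U f = continuous_on U f"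
| "Ck_on (Suc n) U f =
     (continuous_on U f \<and> (\<forall>x\<in>U. f differentiable (at x)) \<and>
      (\<forall>b\<in>Basis. Ck_on n U (\<lambda>x. frechet_derivative f (at x) b)))"

definition smooth_on :: "'a::euclidean_space set \<Rightarrow> ('a \<Rightarrow> 'b::real_normed_vector) \<Rightarrow> bool" where
  "smooth_on U f \<longleftrightarrow> open U \<and> (\<forall>k. Ck_on k U f)"

definition smooth_map_on :: "'a::euclidean_space set \<Rightarrow> ('a \<Rightarrow> 'b::real_normed_vector) \<Rightarrow> bool" where
  "smooth_map_on M \<phi> \<longleftrightarrow>
     (\<forall>p\<in>M. \<exists>W F. open W \<and> p \<in> W \<and> smooth_on W F \<and> (\<forall>q\<in>W \<inter> M. F q = \<phi> q))"

definition diffeo_on :: "'a::euclidean_space set \<Rightarrow> ('a \<Rightarrow> 'a) \<Rightarrow> bool" where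
  "diffeo_on M \<phi> \<longleftrightarrow> bij_betw \<phi> M M \<and> smooth_map_on M \<phi> \<and> smooth_map_on M (inv_into M \<phi>)"

definition mdiff :: "'a::euclidean_space set \<Rightarrow> ('a \<Rightarrow> 'a) \<Rightarrow> 'a \<Rightarrow> 'a \<Rightarrow> 'a" where
  "mdiff M \<phi> p = frechet_derivative \<phi> (at p within M)"

text \<open>A Riemannian manifold presented as (M, T, g): M a subset of a Euclidean space,
T p the tangent space at p, g p the metric at p (a bilinear form on T p).\<close>
definition conformal_diffeo ::
  "'a::euclidean_space set \<Rightarrow> ('a \<Rightarrow> 'a set) \<Rightarrow> ('a \<Rightarrow> 'a \<Rightarrow> 'a \<Rightarrow> real) \<Rightarrow> ('a \<Rightarrow> 'a) \<Rightarrow> bool" where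
  "conformal_diffeo M T g \<phi> \<longleftrightarrow> diffeo_on M \<phi> \<and>
     (\<exists>f::'a \<Rightarrow> real. smooth_map_on M f \<and> (\<forall>p\<in>M. f p > 0) \<and>
        (\<forall>p\<in>M. \<forall>u\<in>T p. \<forall>v\<in>T p.
            g (\<phi> p) (mdiff M \<phi> p u) (mdiff M \<phi> p v) = f p * g p u v))"

definition isometry_of ::
  "'a::euclidean_space set \<Rightarrow> ('a \<Rightarrow> 'a set) \<Rightarrow> ('a \<Rightarrow> 'a \<Rightarrow> 'a \<Rightarrow> real) \<Rightarrow> ('a \<Rightarrow> 'a) \<Rightarrow> bool" where
  "isometry_of M T g \<phi> \<longleftrightarrow> diffeo_on M \<phi> \<and>
     (\<forall>p\<in>M. \<forall>u\<in>T p. \<forall>v\<in>T p. g (\<phi> p) (mdiff M \<phi> p u) (mdiff M \<phi> p v) = g p u v)"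

text \<open>H^2 x R: upper half-plane model {(x,y) | y > 0} with metric (dx^2+dy^2)/y^2
(curvature -1), times R.\<close>
definition H2R :: "(real \<times> real \<times> real) set" where
  "H2R = {(x, y, z). y > 0}"

definition H2R_T :: "real \<times> real \<times> real \<Rightarrow> (real \<times> real \<times> real) set" where
  "H2R_T p = UNIV"

definition H2R_g :: "real \<times> real \<times> real \<Rightarrow> real \<times> real \<times> real \<Rightarrow> real \<times> real \<times> real \<Rightarrow> real" where
  "H2R_g p u v = (case p of (x, y, z) \<Rightarrow> case u of (u1, u2, u3) \<Rightarrow> case v of (v1, v2, v3) \<Rightarrow>
      (u1 * v1 + u2 * v2) / y\<^sup>2 + u3 * v3)"

text \<open>S^2 x R: unit sphere in R^3 times R, embedded in R^3 x R with the induced metric.\<close>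
definition S2R :: "((real \<times> real \<times> real) \<times> real) set" where
  "S2R = {(q, t). norm q = 1}"

definition S2R_T :: "(real \<times> real \<times> real) \<times> real \<Rightarrow> ((real \<times> real \<times> real) \<times> real) set" where
  "S2R_T p = {(w, s). w \<bullet> fst p = 0}"

definition S2R_g :: "(real \<times> real \<times> real) \<times> real \<Rightarrow> (real \<times> real \<times> real) \<times> real \<Rightarrow> (real \<times> real \<times> real) \<times> real \<Rightarrow> real" where
  "S2R_g p u v = u \<bullet> v"

definition Sol :: "(real \<times> real \<times> real) set" where
  "Sol = UNIV"

definition Sol_T :: "real \<times> real \<times> real \<Rightarrow> (real \<times> real \<times> real) set" where
  "Sol_T p = UNIV"

definition Sol_g :: "real \<times> real \<times> real \<Rightarrow> real \<times> real \<times> real \<Rightarrow> real \<times> real \<times> real \<Rightarrow> real" where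
  "Sol_g p u v = (case p of (x, y, z) \<Rightarrow> case u of (u1, u2, u3) \<Rightarrow> case v of (v1, v2, v3) \<Rightarrow>
      exp (2 * z) * u1 * v1 + exp (- 2 * z) * u2 * v2 + u3 * v3)"

end

theory Submission
  imports Defs
begin

text \<open>Write the conformal factor as \<open>f = v\<^sup>-\<^sup>2\<close>. Source and target are the same homogeneous space, with
constant scalar curvature \<open>s\<close>, so conformal invariance yields the Yamabe equation
\<open>\<Delta>v = (s/4)(1/v - v) + (3/2)|\<nabla>v|\<^sup>2/v\<close>.

For \<open>H\<^sup>2 \<times> \<real>\<close> and Sol we have \<open>s = -2\<close>. There is a proper function \<open>F\<close> such that \<open>ln F\<close> has bounded first
and second frame derivatives, so \<open>v + \<epsilon> ln F\<close> attains its minimum, and there the equation forces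
\<open>v \<ge> 1 - O(\<epsilon>)\<close>. Hence every conformal self-map is contracting (\<open>f \<le> 1\<close>); applying this to the inverse as well
gives \<open>f = 1\<close>.

\<open>S\<^sup>2 \<times> \<real>\<close> is conformal to \<open>\<real>\<^sup>3\<close> without the origin. As in Liouville's theorem the Hessian of the flat \<open>v\<close>
is a constant multiple \<open>\<rho>\<close> of the identity, and the Yamabe equation with \<open>s = 0\<close> becomes
\<open>2\<rho>v = |\<rho>x + c|\<^sup>2\<close>. Since \<open>v\<close> has no zero off the origin, it is constant or a multiple of \<open>|x|\<^sup>2\<close>, and
the map is a linear homothety, possibly composed with the inversion.\<close>

subsection \<open>Calculus of smooth maps\<close>

text \<open>The sign of s decides the method. Near a minimum of v the Laplacian is almost
  nonnegative and the gradient almost zero; for s < 0 the zeroth-order term is (v - 1/v)/2, which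
  can be almost nonnegative only if v is almost at least 1. For s = 2 that sign is reversed and the
  same reasoning gives no lower bound, and S^2 moreover has no global frame; passing to punctured
  flat space removes both obstacles. General Riemannian geometry is avoided by orthonormal frames
  with constant connection coefficients: left-invariant frames for H^2 x R and Sol, which are Lie
  groups with left-invariant metrics, and constant frames in the flat case. Source computations
  become iterated directional derivatives, and the target enters only through the algebraic
  curvature of a bilinear map. The differential of a conformal map is a multiple of an orthogonal
  matrix, so summing the curvature over all pairs of frame directions gives f^2 times a constant,
  whatever the map is. What remains is a scalar equation that no longer mentions the map.\<close>

lemma Ck_on_SucD: "Ck_on (Suc k) U f \<Longrightarrow> Ck_on k U f"
  by (induction k arbitrary: f) auto

lemma Ck_on_continuous: "Ck_on k U f \<Longrightarrow> continuous_on U f"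
  by (cases k) auto

lemma Ck_on_subset: "Ck_on k U f \<Longrightarrow> V \<subseteq> U \<Longrightarrow> Ck_on k V f"
  by (induction k arbitrary: f) (auto intro: continuous_on_subset)

lemma Ck_on_cong:
  assumes "open U" "\<And>x. x \<in> U \<Longrightarrow> f x = g x" "Ck_on k U f"
  shows "Ck_on k U g"
  using assms(2,3)
proof (induction k arbitrary: f g)
  case 0
  then show ?case by (simp cong: continuous_on_cong)
next
  case (Suc k)
  have d: "g differentiable (at x)" "frechet_derivative f (at x) = frechet_derivative g (at x)" if "x \<in> U" for x
  proof -
    have "f differentiable (at x)" using Suc.prems that by auto
    then have "(f has_derivative frechet_derivative f (at x)) (at x)"
      by (simp add: frechet_derivative_works)
    then have "(g has_derivative frechet_derivative f (at x)) (at x)"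
      using has_derivative_transform_within_open[OF _ assms(1) that, of f _ UNIV g] Suc.prems by auto
    then show "g differentiable (at x)" "frechet_derivative f (at x) = frechet_derivative g (at x)"
      using frechet_derivative_at by (auto simp: differentiable_def)
  qed
  have "continuous_on U g" using Suc.prems by (simp cong: continuous_on_cong)
  moreover have "Ck_on k U (\<lambda>x. frechet_derivative g (at x) b)" if "b \<in> Basis" for b
    by (rule Suc.IH[of "\<lambda>x. frechet_derivative f (at x) b"]) (use d Suc.prems that in auto)
  ultimately show ?case using d by simp
qed

text \<open>\<open>frechet_derivative\<close> is a choice operator; uniqueness of derivatives at
  points of an open set lets an explicit formula \<open>f'\<close> take its place.\<close>

lemma Ck_on_SucI:
  assumes "open U" "\<And>x. x \<in> U \<Longrightarrow> (f has_derivative f' x) (at x)"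
    and "\<And>b. b \<in> Basis \<Longrightarrow> Ck_on k U (\<lambda>x. f' x b)"
  shows "Ck_on (Suc k) U f"
proof -
  have "continuous_on U f"
    using has_derivative_continuous[OF assms(2)] by (simp add: continuous_at_imp_continuous_on)
  moreover have "Ck_on k U (\<lambda>x. frechet_derivative f (at x) b)" if "b \<in> Basis" for b
    by (rule Ck_on_cong[OF assms(1) _ assms(3)[OF that]])
       (simp add: frechet_derivative_at[OF assms(2), symmetric])
  ultimately show ?thesis using assms(2) by (auto simp: differentiable_def)
qed

lemma Ck_on_Suc_has_derivative:
  "Ck_on (Suc k) U f \<Longrightarrow> x \<in> U \<Longrightarrow> (f has_derivative frechet_derivative f (at x)) (at x)"
  by (simp add: frechet_derivative_works)

lemma Ck_on_local:
  assumes "\<And>p. p \<in> U \<Longrightarrow> \<exists>W. open W \<and> p \<in> W \<and> Ck_on k W f"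
  shows "Ck_on k U f"
  using assms
proof (induction k arbitrary: f)
  case 0
  have "isCont f p" if "p \<in> U" for p
    using 0[OF that] by (auto simp: continuous_on_eq_continuous_at)
  then show ?case by (simp add: continuous_at_imp_continuous_on)
next
  case (Suc k)
  have "isCont f p" "f differentiable (at p)" if "p \<in> U" for p
    using Suc.prems[OF that] by (auto simp: continuous_on_eq_continuous_at)
  moreover have "Ck_on k U (\<lambda>x. frechet_derivative f (at x) b)" if "b \<in> Basis" for b
    by (rule Suc.IH) (use Suc.prems that in \<open>simp, blast\<close>)
  ultimately show ?case by (simp add: continuous_at_imp_continuous_on)
qed

lemma Ck_on_const: "open U \<Longrightarrow> Ck_on k U (\<lambda>x. c)"
  by (induction k arbitrary: c) auto

lemma Ck_on_bounded_linear:
  assumes "bounded_linear f" "open U"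
  shows "Ck_on k U f"
proof (cases k)
  case 0
  then show ?thesis using assms by (simp add: linear_continuous_on)
next
  case (Suc n)
  show ?thesis unfolding Suc
    by (rule Ck_on_SucI[OF assms(2) bounded_linear_imp_has_derivative[OF assms(1)]])
       (rule Ck_on_const[OF assms(2)])
qed

lemma Ck_on_add:
  assumes "open U" "Ck_on k U f" "Ck_on k U g"
  shows "Ck_on k U (\<lambda>x. f x + g x)"
  using assms(2,3)
proof (induction k arbitrary: f g)
  case 0
  then show ?case by (auto intro: continuous_on_add)
next
  case (Suc k)
  show ?case
  proof (rule Ck_on_SucI[OF assms(1)])
    fix x assume "x \<in> U"
    then show "((\<lambda>x. f x + g x) has_derivative
        (\<lambda>h. frechet_derivative f (at x) h + frechet_derivative g (at x) h)) (at x)"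
      using Suc.prems by (intro has_derivative_add Ck_on_Suc_has_derivative)
  next
    fix b :: 'a assume "b \<in> Basis"
    then show "Ck_on k U (\<lambda>x. frechet_derivative f (at x) b + frechet_derivative g (at x) b)"
      using Suc.prems by (intro Suc.IH) auto
  qed
qed

lemma Ck_on_sum:
  assumes "open U" "\<And>i. i \<in> I \<Longrightarrow> Ck_on k U (f i)"
  shows "Ck_on k U (\<lambda>x. \<Sum>i\<in>I. f i x)"
  using assms(2)
  by (induction I rule: infinite_finite_induct)
     (auto intro!: Ck_on_const Ck_on_add assms(1))

lemma (in bounded_bilinear) Ck_on:
  assumes "open (U :: 'd::euclidean_space set)" "Ck_on k U f" "Ck_on k U g"
  shows "Ck_on k U (\<lambda>x. prod (f x) (g x))"
  using assms(2,3)
proof (induction k arbitrary: f g)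
  case 0
  then show ?case by (auto intro: continuous_on)
next
  case (Suc k)
  show ?case
  proof (rule Ck_on_SucI[OF assms(1)])
    fix x assume "x \<in> U"
    then show "((\<lambda>x. prod (f x) (g x)) has_derivative
        (\<lambda>h. prod (f x) (frechet_derivative g (at x) h) + prod (frechet_derivative f (at x) h) (g x))) (at x)"
      using Suc.prems by (intro FDERIV Ck_on_Suc_has_derivative)
  next
    fix b :: 'd assume "b \<in> Basis"
    then show "Ck_on k U (\<lambda>x. prod (f x) (frechet_derivative g (at x) b)
        + prod (frechet_derivative f (at x) b) (g x))"
      using Suc.prems by (intro Suc.IH Ck_on_add[OF assms(1)] Ck_on_SucD[OF Suc.prems(1)]
          Ck_on_SucD[OF Suc.prems(2)]) auto
  qed
qed

lemma linear_Basis_expand: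
  fixes L :: "'a::euclidean_space \<Rightarrow> 'b::real_vector"
  assumes "linear L"
  shows "L v = (\<Sum>b\<in>Basis. (v \<bullet> b) *\<^sub>R L b)"
proof -
  have "L v = L (\<Sum>b\<in>Basis. (v \<bullet> b) *\<^sub>R b)" by (simp add: euclidean_representation)
  also have "\<dots> = (\<Sum>b\<in>Basis. (v \<bullet> b) *\<^sub>R L b)"
    using assms by (simp add: linear_sum linear_scale)
  finally show ?thesis .
qed

lemma Ck_on_compose:
  fixes f :: "'b::euclidean_space \<Rightarrow> 'c::real_normed_vector" and g :: "'a::euclidean_space \<Rightarrow> 'b"
  assumes "open U" "open V" "\<And>x. x \<in> U \<Longrightarrow> g x \<in> V" "Ck_on k U g" "Ck_on k V f"
  shows "Ck_on k U (\<lambda>x. f (g x))"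
  using assms(4,5)
proof (induction k arbitrary: f)
  case 0
  then show ?case using assms(3) by (auto intro: continuous_on_compose2)
next
  case (Suc k)
  let ?f = "\<lambda>x. frechet_derivative f (at x)" and ?g = "\<lambda>x. frechet_derivative g (at x)"
  show ?case
  proof (rule Ck_on_SucI[OF assms(1)])
    fix x assume x: "x \<in> U"
    have f: "(f has_derivative ?f (g x)) (at (g x))"
      using Ck_on_Suc_has_derivative[OF Suc.prems(2) assms(3)[OF x]] .
    have "((\<lambda>x. f (g x)) has_derivative (\<lambda>h. ?f (g x) (?g x h))) (at x)"
      using has_derivative_compose[OF Ck_on_Suc_has_derivative[OF Suc.prems(1) x] f] .
    \<comment> \<open>The chain-rule derivative depends on \<open>x\<close> through both its base
      point and its argument. Expanding the argument over \<open>Basis\<close> splits it into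
      products of a function of \<open>x\<close> with a partial derivative of \<open>f\<close> at
      \<open>g x\<close>, and the induction hypothesis covers the latter.\<close>
    then show "((\<lambda>x. f (g x)) has_derivative (\<lambda>h. \<Sum>b\<in>Basis. (?g x h \<bullet> b) *\<^sub>R ?f (g x) b)) (at x)"
      by (rule has_derivative_eq_rhs) (rule ext, rule linear_Basis_expand[OF has_derivative_linear[OF f]])
  next
    fix b :: 'a assume b: "b \<in> Basis"
    have "Ck_on k U (\<lambda>x. ?f (g x) c)" if "c \<in> Basis" for c
      using Suc.prems that by (intro Suc.IH Ck_on_SucD[OF Suc.prems(1)]) auto
    moreover have "Ck_on k U (\<lambda>x. ?g x b \<bullet> c)" for c
      using Suc.prems b by (intro bounded_bilinear.Ck_on[OF bounded_bilinear_inner] assms(1) Ck_on_const) auto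
    ultimately show "Ck_on k U (\<lambda>x. \<Sum>c\<in>Basis. (?g x b \<bullet> c) *\<^sub>R ?f (g x) c)"
      by (intro Ck_on_sum bounded_bilinear.Ck_on[OF bounded_bilinear_scaleR] assms(1)) auto
  qed
qed

lemma smooth_on_open: "smooth_on U f \<Longrightarrow> open U"
  by (simp add: smooth_on_def)

lemma smooth_on_has_derivative:
  "smooth_on U f \<Longrightarrow> x \<in> U \<Longrightarrow> (f has_derivative frechet_derivative f (at x)) (at x)"
  using Ck_on_Suc_has_derivative unfolding smooth_on_def by blast

lemma smooth_on_continuous: "smooth_on U f \<Longrightarrow> continuous_on U f"
  using Ck_on_continuous unfolding smooth_on_def by blast

lemma smooth_on_cong: "smooth_on U f \<Longrightarrow> (\<And>x. x \<in> U \<Longrightarrow> f x = g x) \<Longrightarrow> smooth_on U g"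
  using Ck_on_cong unfolding smooth_on_def by blast

lemma smooth_on_subset: "smooth_on U f \<Longrightarrow> open V \<Longrightarrow> V \<subseteq> U \<Longrightarrow> smooth_on V f"
  using Ck_on_subset unfolding smooth_on_def by blast

lemma smooth_on_local:
  assumes "\<And>p. p \<in> U \<Longrightarrow> \<exists>W. p \<in> W \<and> smooth_on W f" "open U"
  shows "smooth_on U f"
  unfolding smooth_on_def
proof (intro conjI allI)
  fix k show "Ck_on k U f"
    by (rule Ck_on_local) (use assms in \<open>auto simp: smooth_on_def\<close>)
qed (fact assms)

lemma smooth_on_const: "open U \<Longrightarrow> smooth_on U (\<lambda>x. c)"
  by (simp add: smooth_on_def Ck_on_const)

lemma smooth_on_bounded_linear: "bounded_linear f \<Longrightarrow> open U \<Longrightarrow> smooth_on U f"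
  by (simp add: smooth_on_def Ck_on_bounded_linear)

lemma smooth_on_add: "smooth_on U f \<Longrightarrow> smooth_on U g \<Longrightarrow> smooth_on U (\<lambda>x. f x + g x)"
  by (simp add: smooth_on_def Ck_on_add)

lemma smooth_on_sum: "open U \<Longrightarrow> (\<And>i. i \<in> I \<Longrightarrow> smooth_on U (f i)) \<Longrightarrow> smooth_on U (\<lambda>x. \<Sum>i\<in>I. f i x)"
  by (simp add: smooth_on_def Ck_on_sum)

lemma (in bounded_bilinear) smooth_on:
  "smooth_on U f \<Longrightarrow> smooth_on U g \<Longrightarrow> smooth_on U (\<lambda>x. prod (f x) (g x))"
  by (simp add: smooth_on_def Ck_on)

lemmas smooth_on_mult = bounded_bilinear.smooth_on[OF bounded_bilinear_mult]
lemmas smooth_on_scaleR = bounded_bilinear.smooth_on[OF bounded_bilinear_scaleR]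
lemmas smooth_on_inner = bounded_bilinear.smooth_on[OF bounded_bilinear_inner]

lemma smooth_on_compose:
  fixes f :: "'b::euclidean_space \<Rightarrow> 'c::real_normed_vector" and g :: "'a::euclidean_space \<Rightarrow> 'b"
  shows "smooth_on V f \<Longrightarrow> smooth_on U g \<Longrightarrow> (\<And>x. x \<in> U \<Longrightarrow> g x \<in> V) \<Longrightarrow> smooth_on U (\<lambda>x. f (g x))"
  unfolding smooth_on_def by (blast intro: Ck_on_compose)

lemma smooth_on_bounded_linear_compose:
  fixes g :: "'a::euclidean_space \<Rightarrow> 'b::euclidean_space"
  assumes "bounded_linear f" "smooth_on U g"
  shows "smooth_on U (\<lambda>x. f (g x))"
  by (rule smooth_on_compose[OF smooth_on_bounded_linear[OF assms(1) open_UNIV] assms(2)]) simp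

lemma smooth_on_minus: "smooth_on U f \<Longrightarrow> smooth_on U (\<lambda>x. - f x)"
  using smooth_on_scaleR[OF smooth_on_const[of U "-1"]] smooth_on_open by fastforce

lemma smooth_on_diff: "smooth_on U f \<Longrightarrow> smooth_on U g \<Longrightarrow> smooth_on U (\<lambda>x. f x - g x)"
  using smooth_on_add[OF _ smooth_on_minus] by fastforce

lemma smooth_on_Pair:
  fixes f :: "'a::euclidean_space \<Rightarrow> 'b::euclidean_space" and g :: "'a \<Rightarrow> 'c::euclidean_space"
  assumes "smooth_on U f" "smooth_on U g"
  shows "smooth_on U (\<lambda>x. (f x, g x))"
proof -
  have "smooth_on U (\<lambda>x. (f x, 0) + (0, g x))"
    using assms
    by (intro smooth_on_add smooth_on_bounded_linear_compose[of "\<lambda>x. (x, 0)"]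
        smooth_on_bounded_linear_compose[of "\<lambda>x. (0, x)"])
       (auto intro!: bounded_linear_Pair bounded_linear_ident bounded_linear_zero)
  then show ?thesis by simp
qed

text \<open>Bootstrapping for functions that solve a differential equation: if the derivative is as
  regular as \<open>f\<close> itself, each order of differentiability yields the next.\<close>

lemma smooth_on_iter:
  fixes f :: "'a::euclidean_space \<Rightarrow> 'b::real_normed_vector"
  assumes "open U" "\<And>x. x \<in> U \<Longrightarrow> (f has_derivative f' x) (at x)"
    and "\<And>b k. b \<in> Basis \<Longrightarrow> Ck_on k U f \<Longrightarrow> Ck_on k U (\<lambda>x. f' x b)"
  shows "smooth_on U f"
proof -
  have "continuous_on U f"
    using has_derivative_continuous[OF assms(2)] by (simp add: continuous_at_imp_continuous_on)
  then have "Ck_on k U f" for k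
  proof (induction k)
    case (Suc k)
    show ?case
      by (rule Ck_on_SucI[OF assms(1,2)]) (use assms(3) Suc in blast)+
  qed simp
  then show ?thesis using assms(1) by (simp add: smooth_on_def)
qed

section \<open>Smoothness of elementary functions\<close>

lemma smooth_on_exp: "smooth_on UNIV (exp :: real \<Rightarrow> real)"
proof (rule smooth_on_iter[where f'="\<lambda>x h. h * exp x"])
  fix b k assume "Ck_on k UNIV (exp :: real \<Rightarrow> real)"
  then show "Ck_on k UNIV (\<lambda>x::real. b * exp x)"
    by (intro bounded_bilinear.Ck_on[OF bounded_bilinear_mult] Ck_on_const) auto
qed (auto intro!: derivative_eq_intros)

lemma smooth_on_inverse: "smooth_on {0<..} (inverse :: real \<Rightarrow> real)"
proof (rule smooth_on_iter[where f'="\<lambda>x h. - h * (inverse x * inverse x)"])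
  fix b k assume "Ck_on k {0<..} (inverse :: real \<Rightarrow> real)"
  then show "Ck_on k {0<..} (\<lambda>x::real. - b * (inverse x * inverse x))"
    by (intro bounded_bilinear.Ck_on[OF bounded_bilinear_mult] Ck_on_const) auto
qed (auto intro!: derivative_eq_intros)

lemma smooth_on_inverse_sqrt: "smooth_on {0<..} (\<lambda>x::real. inverse (sqrt x))"
proof (rule smooth_on_iter[where f'="\<lambda>x h. - h / 2 * (inverse (sqrt x) * (inverse (sqrt x) * inverse (sqrt x)))"])
  fix b k assume "Ck_on k {0<..} (\<lambda>x::real. inverse (sqrt x))"
  then show "Ck_on k {0<..} (\<lambda>x::real. - b / 2 * (inverse (sqrt x) * (inverse (sqrt x) * inverse (sqrt x))))"
    by (intro bounded_bilinear.Ck_on[OF bounded_bilinear_mult] Ck_on_const) auto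
qed (auto intro!: derivative_eq_intros simp: field_simps power2_eq_square)

lemma smooth_on_ln: "smooth_on {0<..} (ln :: real \<Rightarrow> real)"
proof -
  have "Ck_on k {0<..} (ln :: real \<Rightarrow> real)" for k
  proof (cases k)
    case 0
    then show ?thesis by (auto intro!: continuous_intros)
  next
    case (Suc n)
    show ?thesis unfolding Suc
    proof (rule Ck_on_SucI[where f'="\<lambda>x h. h * inverse x"])
      fix b :: real
      show "Ck_on n {0<..} (\<lambda>x. b * inverse x)"
        using smooth_on_mult[OF smooth_on_const smooth_on_inverse, of b] by (auto simp: smooth_on_def)
    qed (auto intro!: derivative_eq_intros)
  qed
  then show ?thesis by (simp add: smooth_on_def)
qed

lemma smooth_on_frechet_derivative:
  fixes f :: "'a::euclidean_space \<Rightarrow> 'b::real_normed_vector" and E :: "'a \<Rightarrow> 'a"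
  assumes "smooth_on U f" "smooth_on U E"
  shows "smooth_on U (\<lambda>x. frechet_derivative f (at x) (E x))"
proof (rule smooth_on_cong)
  have U: "open U" using assms(1) by (rule smooth_on_open)
  have "Ck_on k U (\<lambda>x. frechet_derivative f (at x) b)" if "b \<in> Basis" for b k
  proof -
    have "Ck_on (Suc k) U f" using assms(1) unfolding smooth_on_def by blast
    then show ?thesis using that by simp
  qed
  then have "smooth_on U (\<lambda>x. frechet_derivative f (at x) b)" if "b \<in> Basis" for b
    using that U by (simp add: smooth_on_def)
  then show "smooth_on U (\<lambda>x. \<Sum>b\<in>Basis. (E x \<bullet> b) *\<^sub>R frechet_derivative f (at x) b)"
    by (intro smooth_on_sum U smooth_on_scaleR smooth_on_inner assms smooth_on_const)
  show "(\<Sum>b\<in>Basis. (E x \<bullet> b) *\<^sub>R frechet_derivative f (at x) b) = frechet_derivative f (at x) (E x)"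
    if "x \<in> U" for x
    by (rule linear_Basis_expand[OF has_derivative_linear[OF smooth_on_has_derivative[OF assms(1) that]], symmetric])
qed

section \<open>Symmetry of second derivatives\<close>

lemma frechet_derivative_inner_left:
  assumes "(f has_derivative frechet_derivative f (at p)) (at p)"
  shows "frechet_derivative (\<lambda>x. f x \<bullet> c) (at p) h = frechet_derivative f (at p) h \<bullet> c"
  using frechet_derivative_at[OF has_derivative_inner_left[OF assms, of c]] by metis

lemma smooth_on_DERIV_line:
  fixes g :: "'a::euclidean_space \<Rightarrow> real"
  assumes "smooth_on U g" "y + s *\<^sub>R a \<in> U"
  shows "((\<lambda>s. g (y + s *\<^sub>R a)) has_real_derivative frechet_derivative g (at (y + s *\<^sub>R a)) a) (at s)"
proof -
  let ?D = "frechet_derivative g (at (y + s *\<^sub>R a))"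
  have g: "(g has_derivative ?D) (at (y + s *\<^sub>R a))"
    using smooth_on_has_derivative[OF assms] .
  have "((\<lambda>s. g (y + s *\<^sub>R a)) has_derivative (\<lambda>h. ?D (h *\<^sub>R a))) (at s)"
    by (rule has_derivative_compose[where f = "\<lambda>s. y + s *\<^sub>R a" and f' = "\<lambda>h. h *\<^sub>R a"
          and g = g and g' = ?D, OF _ g]) (auto intro!: derivative_eq_intros)
  moreover have "?D (h *\<^sub>R a) = ?D a * h" for h
    using linear_scale[OF has_derivative_linear[OF g]] by simp
  ultimately show ?thesis by (simp add: has_field_derivative_def mult.commute[of _ "?D a"])
qed

text \<open>Both orders of differentiation are limits of one second difference, which is symmetric
  in \<open>a\<close> and \<open>b\<close>.\<close>

lemma second_derivative_commute_real:
  fixes f :: "'a::euclidean_space \<Rightarrow> real"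
  assumes f: "smooth_on U f" and p: "p \<in> U"
  shows "frechet_derivative (\<lambda>x. frechet_derivative f (at x) b) (at p) a
       = frechet_derivative (\<lambda>x. frechet_derivative f (at x) a) (at p) b"
proof -
  define D where "D g a x = frechet_derivative g (at x) a" for g :: "'a \<Rightarrow> real" and a x
  have U: "open U" using f by (rule smooth_on_open)
  have sm: "smooth_on U (D g a)" if "smooth_on U g" for g a
    unfolding D_def by (intro smooth_on_frechet_derivative that smooth_on_const U)
  have line: "((\<lambda>s. g (y + s *\<^sub>R a)) has_real_derivative D g a (y + s *\<^sub>R a)) (at s)"
    if "smooth_on U g" "y + s *\<^sub>R a \<in> U" for g y s a
    unfolding D_def by (rule smooth_on_DERIV_line[OF that])
  obtain r where r: "r > 0" "ball p r \<subseteq> U" using U p by (rule openE)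
  \<comment> \<open>Mean value theorem twice: along \<open>a\<close> for the increment in direction
    \<open>b\<close>, then along \<open>b\<close>.\<close>
  have quot: "\<exists>x\<in>ball p d. f (p + h *\<^sub>R a + h *\<^sub>R b) - f (p + h *\<^sub>R a) - f (p + h *\<^sub>R b) + f p
       = h * h * D (D f a) b x"
    if h: "0 < h" and d: "h * norm a + h * norm b < d" "d \<le> r" for h a b d
  proof -
    have inb: "p + s *\<^sub>R a + t *\<^sub>R b \<in> ball p d" if "0 \<le> s" "s \<le> h" "0 \<le> t" "t \<le> h" for s t
    proof -
      have "norm (s *\<^sub>R a + t *\<^sub>R b) \<le> s * norm a + t * norm b"
        using that norm_triangle_ineq[of "s *\<^sub>R a" "t *\<^sub>R b"] by simp
      also have "\<dots> \<le> h * norm a + h * norm b"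
        using that by (intro add_mono mult_right_mono) auto
      finally have "norm (s *\<^sub>R a + t *\<^sub>R b) < d" using d by simp
      moreover have "dist p (p + s *\<^sub>R a + t *\<^sub>R b) = norm (s *\<^sub>R a + t *\<^sub>R b)"
        by (metis add.assoc add_diff_cancel_left' dist_commute dist_norm)
      ultimately show ?thesis by simp
    qed
    have inU: "p + s *\<^sub>R a + t *\<^sub>R b \<in> U" if "0 \<le> s" "s \<le> h" "0 \<le> t" "t \<le> h" for s t
      using inb[OF that] d(2) r(2) by (auto simp: subset_iff)
    define k where "k s = f (p + h *\<^sub>R b + s *\<^sub>R a) - f (p + s *\<^sub>R a)" for s
    have "(k has_real_derivative (D f a (p + h *\<^sub>R b + s *\<^sub>R a) - D f a (p + s *\<^sub>R a))) (at s)"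
      if "0 \<le> s" "s \<le> h" for s
      unfolding k_def
      by (intro DERIV_diff line f) (use inU[of s h] inU[of s 0] that h in \<open>auto simp: algebra_simps\<close>)
    from MVT2[OF h this] obtain s where s: "0 < s" "s < h"
      "k h - k 0 = (h - 0) * (D f a (p + h *\<^sub>R b + s *\<^sub>R a) - D f a (p + s *\<^sub>R a))" by blast
    have "((\<lambda>t. D f a (p + s *\<^sub>R a + t *\<^sub>R b)) has_real_derivative D (D f a) b (p + s *\<^sub>R a + t *\<^sub>R b)) (at t)"
      if "0 \<le> t" "t \<le> h" for t
      by (intro line sm f) (use inU[of s t] that s in auto)
    from MVT2[OF h this] obtain t where t: "0 < t" "t < h"
      "D f a (p + s *\<^sub>R a + h *\<^sub>R b) - D f a (p + s *\<^sub>R a + 0 *\<^sub>R b) = (h - 0) * D (D f a) b (p + s *\<^sub>R a + t *\<^sub>R b)"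
      by blast
    have "k h - k 0 = h * (h * D (D f a) b (p + s *\<^sub>R a + t *\<^sub>R b))"
      using s(3) t(3) by (simp add: algebra_simps)
    then show ?thesis
      using inb[of s t] s t by (intro bexI[of _ "p + s *\<^sub>R a + t *\<^sub>R b"]) (auto simp: k_def algebra_simps)
  qed
  have "D (D f b) a p = D (D f a) b p"
  proof (rule ccontr)
    assume ne: "D (D f b) a p \<noteq> D (D f a) b p"
    define e where "e = \<bar>D (D f b) a p - D (D f a) b p\<bar> / 2"
    have e: "e > 0" using ne by (simp add: e_def)
    have c: "isCont (D (D f c) d) p" for c d
      using smooth_on_continuous[OF sm[OF sm[OF f]]] U p by (simp add: continuous_on_eq_continuous_at)
    obtain d1 where d1: "d1 > 0" "\<And>x. dist x p < d1 \<Longrightarrow> \<bar>D (D f b) a x - D (D f b) a p\<bar> < e"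
      using c[of b a] e unfolding continuous_at_eps_delta dist_real_def by blast
    obtain d2 where d2: "d2 > 0" "\<And>x. dist x p < d2 \<Longrightarrow> \<bar>D (D f a) b x - D (D f a) b p\<bar> < e"
      using c[of a b] e unfolding continuous_at_eps_delta dist_real_def by blast
    define d where "d = min r (min d1 d2)"
    \<comment> \<open>The \<open>+ 1\<close> keeps \<open>n\<close> positive when \<open>a\<close>
      and \<open>b\<close> both vanish; \<open>h * n = d / 2\<close> then keeps the whole
      parallelogram inside the ball.\<close>
    define n where "n = norm a + norm b + 1"
    define h where "h = d / (2 * n)"
    have d: "d > 0" using r d1 d2 by (simp add: d_def)
    have n: "n > 0" by (simp add: n_def add_nonneg_pos)
    have h: "h > 0" using d n by (simp add: h_def)
    have "h * n = d / 2" using n by (simp add: h_def)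
    then have "h * norm a + h * norm b < d" using h d unfolding n_def ring_distribs by linarith
    then have hd: "h * norm a + h * norm b < d" "h * norm b + h * norm a < d" by simp_all
    have "d \<le> r" by (simp add: d_def)
    obtain x where x: "x \<in> ball p d" "f (p + h *\<^sub>R a + h *\<^sub>R b) - f (p + h *\<^sub>R a) - f (p + h *\<^sub>R b) + f p
       = h * h * D (D f a) b x" using quot[OF h hd(1) \<open>d \<le> r\<close>] by blast
    obtain y where y: "y \<in> ball p d" "f (p + h *\<^sub>R b + h *\<^sub>R a) - f (p + h *\<^sub>R b) - f (p + h *\<^sub>R a) + f p
       = h * h * D (D f b) a y" using quot[OF h hd(2) \<open>d \<le> r\<close>] by blast
    have "h * h * D (D f a) b x = h * h * D (D f b) a y"
      unfolding x(2)[symmetric] y(2)[symmetric] by (simp add: algebra_simps)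
    then have "D (D f a) b x = D (D f b) a y" using h by simp
    moreover have "\<bar>D (D f a) b x - D (D f a) b p\<bar> < e" "\<bar>D (D f b) a y - D (D f b) a p\<bar> < e"
      using x(1) y(1) d1(2) d2(2) by (auto simp: d_def dist_commute)
    ultimately show False unfolding e_def by (smt (verit) field_sum_of_halves)
  qed
  then show ?thesis by (simp add: D_def[abs_def])
qed

lemma second_derivative_commute:
  fixes f :: "'a::euclidean_space \<Rightarrow> 'b::euclidean_space"
  assumes f: "smooth_on U f" and p: "p \<in> U"
  shows "frechet_derivative (\<lambda>x. frechet_derivative f (at x) b) (at p) a
       = frechet_derivative (\<lambda>x. frechet_derivative f (at x) a) (at p) b"
proof (rule euclidean_eqI)
  fix c :: 'b
  have U: "open U" using f by (rule smooth_on_open)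
  have sm: "smooth_on U (\<lambda>x. f x \<bullet> c)" by (intro smooth_on_inner f smooth_on_const U)
  have *: "frechet_derivative (\<lambda>x. frechet_derivative f (at x) b) (at p) a \<bullet> c
      = frechet_derivative (\<lambda>x. frechet_derivative (\<lambda>x. f x \<bullet> c) (at x) b) (at p) a" for a b
  proof -
    have sb: "smooth_on U (\<lambda>x. frechet_derivative f (at x) b)"
      by (intro smooth_on_frechet_derivative f smooth_on_const U)
    have "frechet_derivative (\<lambda>x. frechet_derivative f (at x) b) (at p) a \<bullet> c
      = frechet_derivative (\<lambda>x. frechet_derivative f (at x) b \<bullet> c) (at p) a"
      by (rule frechet_derivative_inner_left[OF smooth_on_has_derivative[OF sb p], symmetric])
    also have "frechet_derivative (\<lambda>x. frechet_derivative f (at x) b \<bullet> c) (at p)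
       = frechet_derivative (\<lambda>x. frechet_derivative (\<lambda>x. f x \<bullet> c) (at x) b) (at p)"
    proof (rule frechet_derivative_transform_within_open[OF _ U p])
      show "(\<lambda>x. frechet_derivative f (at x) b \<bullet> c) differentiable at p"
        using has_derivative_inner_left[OF smooth_on_has_derivative[OF sb p]] by (auto simp: differentiable_def)
      show "frechet_derivative f (at x) b \<bullet> c = frechet_derivative (\<lambda>x. f x \<bullet> c) (at x) b" if "x \<in> U" for x
        by (rule frechet_derivative_inner_left[OF smooth_on_has_derivative[OF f that], symmetric])
    qed
    finally show ?thesis .
  qed
  show "frechet_derivative (\<lambda>x. frechet_derivative f (at x) b) (at p) a \<bullet> c
      = frechet_derivative (\<lambda>x. frechet_derivative f (at x) a) (at p) b \<bullet> c"
    unfolding * by (rule second_derivative_commute_real[OF sm p])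
qed

subsection \<open>Derivatives along vector fields\<close>

text \<open>In an iterate \<open>dd E (dd E F)\<close> the outer derivative also hits the field, so
  this is E(E F) and not the second derivative on the pair (E, E);
  \<open>dd_frechet_derivative\<close> gives the difference.\<close>

definition dd :: "('a \<Rightarrow> 'a) \<Rightarrow> ('a::euclidean_space \<Rightarrow> 'b::real_normed_vector) \<Rightarrow> 'a \<Rightarrow> 'b" where
  "dd E F p = frechet_derivative F (at p) (E p)"

lemma dd_eqI: "(F has_derivative F') (at p) \<Longrightarrow> dd E F p = F' (E p)"
  unfolding dd_def by (metis frechet_derivative_at)

lemma smooth_on_dd: "smooth_on U F \<Longrightarrow> smooth_on U E \<Longrightarrow> smooth_on U (dd E F)"
  unfolding dd_def[abs_def] by (rule smooth_on_frechet_derivative)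

lemma dd_cong:
  assumes "smooth_on U F" "p \<in> U" "\<And>x. x \<in> U \<Longrightarrow> F x = G x"
  shows "dd E F p = dd E G p"
proof -
  have "F differentiable (at p)"
    using smooth_on_has_derivative[OF assms(1,2)] unfolding differentiable_def by blast
  from frechet_derivative_transform_within_open[OF this smooth_on_open[OF assms(1)] assms(2,3)]
  show ?thesis by (simp add: dd_def)
qed

lemma dd_const [simp]: "dd E (\<lambda>x. c) p = 0"
  by (simp add: dd_def)

lemma dd_add:
  assumes "smooth_on U F" "smooth_on U G" "p \<in> U"
  shows "dd E (\<lambda>x. F x + G x) p = dd E F p + dd E G p"
  using dd_eqI[OF has_derivative_add[OF smooth_on_has_derivative[OF assms(1,3)]
      smooth_on_has_derivative[OF assms(2,3)]], of E]
  by (simp add: dd_def)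

lemma (in bounded_bilinear) dd:
  assumes "smooth_on U F" "smooth_on U G" "p \<in> U"
  shows "dd E (\<lambda>x. prod (F x) (G x)) p = prod (dd E F p) (G p) + prod (F p) (dd E G p)"
  using dd_eqI[OF FDERIV[OF smooth_on_has_derivative[OF assms(1,3)] smooth_on_has_derivative[OF assms(2,3)]], of E]
  by (simp add: dd_def add.commute)

lemmas dd_mult = bounded_bilinear.dd[OF bounded_bilinear_mult]
lemmas dd_inner = bounded_bilinear.dd[OF bounded_bilinear_inner]
lemmas dd_scaleR = bounded_bilinear.dd[OF bounded_bilinear_scaleR]

lemma dd_sum:
  assumes "open U" "\<And>i. i \<in> I \<Longrightarrow> smooth_on U (F i)" "p \<in> U"
  shows "dd E (\<lambda>x. \<Sum>i\<in>I. F i x) p = (\<Sum>i\<in>I. dd E (F i) p)"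
  using assms(2)
  by (induction I rule: infinite_finite_induct)
     (auto simp: dd_add[OF _ smooth_on_sum[OF assms(1)] assms(3)])

text \<open>Product rule for DF(X): the first summand freezes the field at \<open>X p\<close>, the
  second differentiates the field.\<close>

lemma dd_frechet_derivative:
  fixes F :: "'a::euclidean_space \<Rightarrow> 'b::euclidean_space"
  assumes F: "smooth_on U F" and X: "smooth_on U X" and p: "p \<in> U"
  shows "dd E (dd X F) p = dd E (dd (\<lambda>_. X p) F) p + frechet_derivative F (at p) (dd E X p)"
proof -
  have U: "open U" using F by (rule smooth_on_open)
  have b: "smooth_on U (dd (\<lambda>_. b) F)" for b by (intro smooth_on_dd F smooth_on_const U)
  have ex: "dd Y F x = (\<Sum>b\<in>Basis. (Y x \<bullet> b) *\<^sub>R dd (\<lambda>_. b) F x)" if "x \<in> U" for x Y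
    unfolding dd_def
    by (rule linear_Basis_expand[OF has_derivative_linear[OF smooth_on_has_derivative[OF F that]]])
  \<comment> \<open>Proved for every field \<open>Y\<close>, then used for \<open>X\<close> and for
    the constant field \<open>X p\<close>. Both have the same value at \<open>p\<close>, so their
    terms with second derivatives of \<open>F\<close> coincide.\<close>
  have eq: "dd E (dd Y F) p = (\<Sum>b\<in>Basis. (dd E Y p \<bullet> b) *\<^sub>R dd (\<lambda>_. b) F p + (Y p \<bullet> b) *\<^sub>R dd E (dd (\<lambda>_. b) F) p)"
    if Y: "smooth_on U Y" for Y
  proof -
    have i: "smooth_on U (\<lambda>x. Y x \<bullet> b)" for b by (intro smooth_on_inner Y smooth_on_const U)
    have "dd E (dd Y F) p = dd E (\<lambda>x. \<Sum>b\<in>Basis. (Y x \<bullet> b) *\<^sub>R dd (\<lambda>_. b) F x) p"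
      by (rule dd_cong[OF smooth_on_dd[OF F Y] p ex])
    also have "\<dots> = (\<Sum>b\<in>Basis. dd E (\<lambda>x. (Y x \<bullet> b) *\<^sub>R dd (\<lambda>_. b) F x) p)"
      by (intro dd_sum[OF U _ p] smooth_on_scaleR i b)
    also have "\<dots> = (\<Sum>b\<in>Basis. (dd E Y p \<bullet> b) *\<^sub>R dd (\<lambda>_. b) F p + (Y p \<bullet> b) *\<^sub>R dd E (dd (\<lambda>_. b) F) p)"
      by (intro sum.cong refl) (simp add: dd_scaleR[OF i b p] dd_inner[OF Y smooth_on_const[OF U] p])
    finally show ?thesis .
  qed
  have "(\<Sum>b\<in>Basis. (dd E X p \<bullet> b) *\<^sub>R dd (\<lambda>_. b) F p) = frechet_derivative F (at p) (dd E X p)"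
    unfolding dd_def
    by (rule linear_Basis_expand[OF has_derivative_linear[OF smooth_on_has_derivative[OF F p]], symmetric])
  then show ?thesis
    using eq[OF X] eq[OF smooth_on_const[OF U], of "X p"] by (simp add: sum.distrib add.commute)
qed

text \<open>With the fields frozen at \<open>p\<close> the second derivatives commute, so only the
  Lie bracket of the fields survives.\<close>

lemma dd_commute:
  fixes F :: "'a::euclidean_space \<Rightarrow> 'b::euclidean_space"
  assumes F: "smooth_on U F" and X: "smooth_on U X" "smooth_on U Y" and p: "p \<in> U"
  shows "dd X (dd Y F) p - dd Y (dd X F) p = frechet_derivative F (at p) (dd X Y p - dd Y X p)"
proof -
  have "dd X (dd (\<lambda>_. Y p) F) p = dd Y (dd (\<lambda>_. X p) F) p"
    unfolding dd_def by (rule second_derivative_commute[OF F p])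
  then show ?thesis
    unfolding dd_frechet_derivative[OF F X(1) p] dd_frechet_derivative[OF F X(2) p]
    using linear_diff[OF has_derivative_linear[OF smooth_on_has_derivative[OF F p]]] by simp
qed

lemma dd_Pair:
  assumes "smooth_on U F" "smooth_on U G" "p \<in> U"
  shows "dd E (\<lambda>x. (F x, G x)) p = (dd E F p, dd E G p)"
  using dd_eqI[OF has_derivative_Pair[OF smooth_on_has_derivative[OF assms(1,3)]
      smooth_on_has_derivative[OF assms(2,3)]], of E]
  by (simp add: dd_def)

lemma smooth_on_exp_compose: "smooth_on U F \<Longrightarrow> smooth_on U (\<lambda>x. exp (F x :: real))"
  by (rule smooth_on_compose[OF smooth_on_exp]) auto

lemma dd_exp:
  fixes F :: "'a::euclidean_space \<Rightarrow> real"
  assumes "smooth_on U F" "p \<in> U"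
  shows "dd E (\<lambda>x. exp (F x)) p = exp (F p) * dd E F p"
proof -
  have "((\<lambda>x. exp (F x)) has_derivative (\<lambda>h. exp (F p) * frechet_derivative F (at p) h)) (at p)"
    using smooth_on_has_derivative[OF assms] by (auto intro!: derivative_eq_intros)
  from dd_eqI[OF this, of E] show ?thesis by (simp add: dd_def)
qed

lemma smooth_on_inverse_compose:
  "smooth_on U F \<Longrightarrow> (\<And>x. x \<in> U \<Longrightarrow> F x > 0) \<Longrightarrow> smooth_on U (\<lambda>x. inverse (F x :: real))"
  by (rule smooth_on_compose[OF smooth_on_inverse]) auto

lemma smooth_on_divide:
  "smooth_on U F \<Longrightarrow> smooth_on U G \<Longrightarrow> (\<And>x. x \<in> U \<Longrightarrow> G x > 0) \<Longrightarrow> smooth_on U (\<lambda>x. F x / G x :: real)"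
  unfolding divide_inverse by (intro smooth_on_mult smooth_on_inverse_compose)

lemma dd_divide:
  fixes F :: "'a::euclidean_space \<Rightarrow> real"
  assumes "smooth_on U F" "smooth_on U G" "p \<in> U" "G p > 0"
  shows "dd E (\<lambda>x. F x / G x) p = dd E F p / G p - F p * dd E G p / (G p)\<^sup>2"
proof -
  have "((\<lambda>x. F x / G x) has_derivative (\<lambda>h. frechet_derivative F (at p) h / G p
      - F p * frechet_derivative G (at p) h / (G p)\<^sup>2)) (at p)"
    using smooth_on_has_derivative[OF assms(1,3)] smooth_on_has_derivative[OF assms(2,3)] assms(4)
    by (auto intro!: derivative_eq_intros simp: field_simps power2_eq_square)
  from dd_eqI[OF this, of E] show ?thesis by (simp add: dd_def)
qed

lemma dd_fst_comp:
  fixes \<phi> :: "'a::euclidean_space \<Rightarrow> 'b::real_normed_vector \<times> 'c::real_normed_vector"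
  assumes "smooth_on U \<phi>" "p \<in> U"
  shows "dd E (\<lambda>x. fst (\<phi> x)) p = fst (dd E \<phi> p)" "dd E (\<lambda>x. snd (\<phi> x)) p = snd (dd E \<phi> p)"
  using dd_eqI[OF has_derivative_fst[OF smooth_on_has_derivative[OF assms]], of E]
    dd_eqI[OF has_derivative_snd[OF smooth_on_has_derivative[OF assms]], of E]
  by (simp_all add: dd_def)

lemma smooth_on_fst_comp:
  fixes \<phi> :: "'a::euclidean_space \<Rightarrow> 'b::euclidean_space \<times> 'c::euclidean_space"
  assumes "smooth_on U \<phi>"
  shows "smooth_on U (\<lambda>x. fst (\<phi> x))" "smooth_on U (\<lambda>x. snd (\<phi> x))"
  by (rule smooth_on_bounded_linear_compose[OF bounded_linear_fst assms])
     (rule smooth_on_bounded_linear_compose[OF bounded_linear_snd assms])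

lemma dd_bracket:
  fixes V :: "'a::euclidean_space \<Rightarrow> 'b::euclidean_space"
  assumes V: "smooth_on U V" and E: "\<And>i. smooth_on U (E i)" and p: "p \<in> U"
    and br: "dd (E i) (E j) p - dd (E j) (E i) p = (\<Sum>k\<in>I. c k *\<^sub>R E k p)"
  shows "dd (E i) (dd (E j) V) p - dd (E j) (dd (E i) V) p = (\<Sum>k\<in>I. c k *\<^sub>R dd (E k) V p)"
  unfolding dd_commute[OF V E E p] br
  using has_derivative_linear[OF smooth_on_has_derivative[OF V p]]
  by (simp add: linear_sum linear_scale dd_def)

subsection \<open>Conformal maps in orthonormal frames\<close>

definition rsqrt :: "('a \<Rightarrow> real) \<Rightarrow> 'a \<Rightarrow> real" where
  "rsqrt f p = inverse (sqrt (f p))"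

text \<open>\<open>E\<close> is an orthonormal frame of the source with constant connection coefficients
\<open>om i j k = \<langle>\<nabla>\<^bsub>E i\<^esub> E j, E k\<rangle>\<close>, \<open>W\<close> is the Levi-Civita connection of the target on constant-coefficient fields of
an orthonormal frame there, and \<open>A i\<close> is the image of \<open>E i\<close> under the differential of the map, in components
with respect to that frame.\<close>
locale conformal_frame =
  fixes M :: "'a::euclidean_space set" and E :: "'n::finite \<Rightarrow> 'a \<Rightarrow> 'a"
    and om :: "'n \<Rightarrow> 'n \<Rightarrow> 'n \<Rightarrow> real" and W :: "'b::euclidean_space \<Rightarrow> 'b \<Rightarrow> 'b"
    and A :: "'n \<Rightarrow> 'a \<Rightarrow> 'b" and f :: "'a \<Rightarrow> real"
  assumes open_M: "open M"
    and smooth_E: "smooth_on M (E i)"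
    and bracket: "p \<in> M \<Longrightarrow> dd (E i) (E j) p - dd (E j) (E i) p = (\<Sum>k\<in>UNIV. (om i j k - om j i k) *\<^sub>R E k p)"
    and om_skew: "om i j k = - om i k j"
    and bilinear_W: "bounded_bilinear W"
    and W_skew: "W x y \<bullet> z = - (y \<bullet> W x z)"
    and smooth_A: "smooth_on M (A i)"
    and conf: "p \<in> M \<Longrightarrow> A i p \<bullet> A j p = (if i = j then f p else 0)"
    and f_pos: "p \<in> M \<Longrightarrow> f p > 0"
    and card_n: "CARD('n) = DIM('b)"
    and torsion: "p \<in> M \<Longrightarrow> dd (E i) (A j) p + W (A i p) (A j p) - (dd (E j) (A i) p + W (A j p) (A i p))
        = (\<Sum>k\<in>UNIV. (om i j k - om j i k) *\<^sub>R A k p)"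
begin

text \<open>The target's Levi-Civita connection pulled back along the map, acting on vector fields
  along the map written in components of the target frame.\<close>

definition nab :: "'n \<Rightarrow> ('a \<Rightarrow> 'b) \<Rightarrow> 'a \<Rightarrow> 'b" where
  "nab i V p = dd (E i) V p + W (A i p) (V p)"

text \<open>Curvature tensor on constant-coefficient fields; as the connection is torsion-free,
  \<open>W x y - W y x\<close> is the Lie bracket of the fields.\<close>

definition R :: "'b \<Rightarrow> 'b \<Rightarrow> 'b \<Rightarrow> 'b" where
  "R x y v = W x (W y v) - W y (W x v) - W (W x y - W y x) v"

text \<open>The Koszul formula for the metric f times the source metric, in the frame
  \<open>E\<close>, which is orthonormal only for the source metric.\<close>

definition G :: "'n \<Rightarrow> 'n \<Rightarrow> 'n \<Rightarrow> 'a \<Rightarrow> real" where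
  "G i j k p = f p * om i j k + ((if j = k then dd (E i) f p else 0)
     + (if i = k then dd (E j) f p else 0) - (if i = j then dd (E k) f p else 0)) / 2"

lemma smooth_f: "smooth_on M f"
  by (rule smooth_on_cong[OF smooth_on_inner[OF smooth_A[of undefined] smooth_A[of undefined]]]) (simp add: conf)

lemma smooth_W: "smooth_on M U \<Longrightarrow> smooth_on M V \<Longrightarrow> smooth_on M (\<lambda>x. W (U x) (V x))"
  by (rule bounded_bilinear.smooth_on[OF bilinear_W])

lemma smooth_nab: "smooth_on M V \<Longrightarrow> smooth_on M (nab i V)"
  unfolding nab_def[abs_def] by (intro smooth_on_add smooth_on_dd smooth_W smooth_A smooth_E)

lemma dd_inner_nab:
  assumes "smooth_on M U" "smooth_on M V" "p \<in> M"
  shows "dd (E i) (\<lambda>x. U x \<bullet> V x) p = nab i U p \<bullet> V p + U p \<bullet> nab i V p"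
  unfolding dd_inner[OF assms] nab_def using W_skew[of "A i p" "U p" "V p"]
  by (simp add: inner_add_left inner_add_right)

text \<open>Koszul's argument: symmetry in the first two indices (no torsion) and the known
  symmetrization in the last two (metric compatibility) determine a three-index array.\<close>

lemma nab_A_inner:
  assumes p: "p \<in> M"
  shows "nab i (A j) p \<bullet> A k p = G i j k p"
proof -
  \<comment> \<open>Subtracting the source connection makes the array symmetric in \<open>i\<close>
    and \<open>j\<close>; by \<open>om_skew\<close> it leaves the symmetrization in \<open>j\<close>
    and \<open>k\<close> unaffected.\<close>
  define B where "B i j k = nab i (A j) p \<bullet> A k p - f p * om i j k" for i j k
  have sym: "B i j k = B j i k" for i j k
  proof -
    have "nab i (A j) p \<bullet> A k p - nab j (A i) p \<bullet> A k p = (\<Sum>m\<in>UNIV. (om i j m - om j i m) *\<^sub>R A m p) \<bullet> A k p"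
      using torsion[OF p, of i j] by (simp add: nab_def flip: inner_diff_left)
    also have "\<dots> = (om i j k - om j i k) * f p"
      by (simp add: inner_sum_left conf[OF p] if_distrib cong: if_cong)
    finally show ?thesis by (simp add: B_def algebra_simps)
  qed
  have met: "B i j k + B i k j = (if j = k then dd (E i) f p else 0)" for i j k
  proof -
    have "nab i (A j) p \<bullet> A k p + A j p \<bullet> nab i (A k) p = dd (E i) (\<lambda>x. A j x \<bullet> A k x) p"
      by (rule dd_inner_nab[OF smooth_A smooth_A p, symmetric])
    also have "\<dots> = dd (E i) (\<lambda>x. if j = k then f x else 0) p"
      by (rule dd_cong[OF smooth_on_inner[OF smooth_A smooth_A] p conf])
    also have "\<dots> = (if j = k then dd (E i) f p else 0)" by simp
    finally show ?thesis
      using om_skew[of i j k] by (simp add: B_def inner_commute[of "A j p"] algebra_simps)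
  qed
  have "2 * B i j k = (if j = k then dd (E i) f p else 0)
     + (if i = k then dd (E j) f p else 0) - (if i = j then dd (E k) f p else 0)"
    using met[of i j k] met[of j k i] met[of k i j] sym[of i j k] sym[of j k i] sym[of k i j]
    by (auto split: if_splits)
  then show ?thesis unfolding B_def G_def by argo
qed

text \<open>Parseval: the vectors \<open>A m p\<close> are orthogonal, of squared length
  \<open>f p > 0\<close>, and as many as the dimension, hence they span.\<close>

lemma inner_expand:
  assumes p: "p \<in> M"
  shows "x \<bullet> y = (\<Sum>m\<in>UNIV. (x \<bullet> A m p) * (y \<bullet> A m p)) / f p"
proof -
  have f: "f p > 0" by (rule f_pos[OF p])
  have inj: "inj (\<lambda>m. A m p)"
  proof (rule injI)
    fix i j assume "A i p = A j p"
    then show "i = j" using conf[OF p, of i j] conf[OF p, of i i] f by (auto split: if_splits)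
  qed
  let ?S = "range (\<lambda>m. A m p)"
  have "independent ?S"
  proof (rule pairwise_orthogonal_independent)
    show "pairwise orthogonal ?S" by (auto simp: pairwise_def orthogonal_def conf[OF p])
    show "0 \<notin> ?S"
    proof
      assume "0 \<in> ?S"
      then obtain m where "A m p = 0" by (metis imageE)
      then show False using conf[OF p, of m m] f by simp
    qed
  qed
  moreover have "card ?S = DIM('b)" using card_image[OF inj] card_n by simp
  ultimately have "span ?S = UNIV"
    by (metis card_eq_dim dim_UNIV finite_imageI finite subset_UNIV span_eq_dim span_UNIV
        card_ge_dim_independent top.extremum_uniqueI)
  then have "x \<in> span ?S" by simp
  then show ?thesis
  proof (induction x rule: span_induct)
    case base
    show ?case using f
      by (auto simp: subspace_def inner_add_left algebra_simps sum.distrib add_divide_distrib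
          simp flip: sum_distrib_left times_divide_eq_right)
  next
    case (step x)
    then obtain i where "x = A i p" by blast
    then show ?case using f by (simp add: conf[OF p] inner_commute if_distrib[of "\<lambda>c. c * _"] cong: if_cong)
  qed
qed

text \<open>Ricci identity for the connection along the map: the source bracket gives the
  first-order terms and the target contributes its curvature.\<close>

lemma nab_commute:
  assumes V: "smooth_on M V" and p: "p \<in> M"
  shows "nab i (nab j V) p - nab j (nab i V) p
       = (\<Sum>k\<in>UNIV. (om i j k - om j i k) *\<^sub>R nab k V p) + R (A i p) (A j p) (V p)"
proof -
  interpret W: bounded_bilinear W by (rule bilinear_W)
  have eq: "nab i (nab j V) p = dd (E i) (dd (E j) V) p + W (dd (E i) (A j) p) (V p) + W (A j p) (dd (E i) V p)
      + W (A i p) (dd (E j) V p) + W (A i p) (W (A j p) (V p))" for i j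
  proof -
    have "dd (E i) (nab j V) p = dd (E i) (dd (E j) V) p + dd (E i) (\<lambda>x. W (A j x) (V x)) p"
      unfolding nab_def[abs_def] by (intro dd_add[OF _ _ p] smooth_on_dd V smooth_E smooth_W smooth_A)
    then show ?thesis
      using W.dd[OF smooth_A V p] by (simp add: nab_def W.add_right)
  qed
  have D: "dd (E i) (dd (E j) V) p - dd (E j) (dd (E i) V) p = (\<Sum>k\<in>UNIV. (om i j k - om j i k) *\<^sub>R dd (E k) V p)"
    unfolding dd_commute[OF V smooth_E smooth_E p] bracket[OF p]
    using has_derivative_linear[OF smooth_on_has_derivative[OF V p]]
    by (simp add: linear_sum linear_scale dd_def)
  \<comment> \<open>The torsion equation trades derivatives of the differential for the target
    bracket, which supplies the last term of \<open>R\<close>.\<close>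
  have WD: "W (dd (E i) (A j) p) (V p) - W (dd (E j) (A i) p) (V p)
      = (\<Sum>k\<in>UNIV. (om i j k - om j i k) *\<^sub>R W (A k p) (V p)) - W (W (A i p) (A j p) - W (A j p) (A i p)) (V p)"
  proof -
    have "dd (E i) (A j) p - dd (E j) (A i) p
      = (\<Sum>k\<in>UNIV. (om i j k - om j i k) *\<^sub>R A k p) - (W (A i p) (A j p) - W (A j p) (A i p))"
      using torsion[OF p, of i j] by (simp add: algebra_simps)
    then have "W (dd (E i) (A j) p - dd (E j) (A i) p) (V p)
      = W ((\<Sum>k\<in>UNIV. (om i j k - om j i k) *\<^sub>R A k p) - (W (A i p) (A j p) - W (A j p) (A i p))) (V p)" by simp
    then show ?thesis by (simp only: W.diff_left W.sum_left W.scaleR_left)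
  qed
  have "nab i (nab j V) p - nab j (nab i V) p = (dd (E i) (dd (E j) V) p - dd (E j) (dd (E i) V) p)
      + (W (dd (E i) (A j) p) (V p) - W (dd (E j) (A i) p) (V p))
      + (W (A i p) (W (A j p) (V p)) - W (A j p) (W (A i p) (V p)))"
    unfolding eq[of i j] eq[of j i] by simp
  then show ?thesis
    unfolding D WD by (simp add: R_def nab_def scaleR_add_right sum.distrib)
qed

lemma smooth_q: "smooth_on M (dd (E i) f)"
  by (intro smooth_on_dd smooth_f smooth_E)

lemma dd_G:
  assumes p: "p \<in> M"
  shows "dd (E l) (G i j k) p = dd (E l) f p * om i j k + ((if j = k then dd (E l) (dd (E i) f) p else 0)
     + (if i = k then dd (E l) (dd (E j) f) p else 0) - (if i = j then dd (E l) (dd (E k) f) p else 0)) / 2"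
proof -
  have "((\<lambda>x. G i j k x) has_derivative (\<lambda>h. frechet_derivative f (at p) h * om i j k
     + ((if j = k then frechet_derivative (dd (E i) f) (at p) h else 0)
     + (if i = k then frechet_derivative (dd (E j) f) (at p) h else 0)
     - (if i = j then frechet_derivative (dd (E k) f) (at p) h else 0)) / 2)) (at p)"
    unfolding G_def
    using smooth_on_has_derivative[OF smooth_f p] smooth_on_has_derivative[OF smooth_q p]
    by (cases "j = k"; cases "i = k"; cases "i = j") (auto intro!: derivative_eq_intros simp: algebra_simps)
  from dd_eqI[OF this, of "E l"] show ?thesis by (simp add: dd_def)
qed

text \<open>The conformal change formula for the Riemann tensor, with all connection terms evaluated.\<close>
lemma curvature_identity:
  assumes p: "p \<in> M"
  shows "dd (E i) (G j k l) p - dd (E j) (G i k l) p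
     - (\<Sum>m\<in>UNIV. G j k m p * G i l m p - G i k m p * G j l m p) / f p
     - (\<Sum>m\<in>UNIV. (om i j m - om j i m) * G m k l p)
     = R (A i p) (A j p) (A k p) \<bullet> A l p"
proof -
  \<comment> \<open>Metric compatibility produces a product of two first covariant derivatives;
    expanding it in the basis \<open>A m p\<close> turns it into products of entries of
    \<open>G\<close>.\<close>
  have 1: "dd (E i) (G j k l) p = nab i (nab j (A k)) p \<bullet> A l p + (\<Sum>m\<in>UNIV. G j k m p * G i l m p) / f p"
    for i j
  proof -
    have "dd (E i) (G j k l) p = dd (E i) (\<lambda>x. nab j (A k) x \<bullet> A l x) p"
      by (rule dd_cong[OF smooth_on_inner[OF smooth_nab[OF smooth_A] smooth_A] p, symmetric])
         (rule nab_A_inner)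
    also have "\<dots> = nab i (nab j (A k)) p \<bullet> A l p + nab j (A k) p \<bullet> nab i (A l) p"
      by (rule dd_inner_nab[OF smooth_nab[OF smooth_A] smooth_A p])
    also have "nab j (A k) p \<bullet> nab i (A l) p = (\<Sum>m\<in>UNIV. G j k m p * G i l m p) / f p"
      unfolding inner_expand[OF p, of "nab j (A k) p"] nab_A_inner[OF p] ..
    finally show ?thesis .
  qed
  have "nab i (nab j (A k)) p \<bullet> A l p - nab j (nab i (A k)) p \<bullet> A l p
    = (\<Sum>m\<in>UNIV. (om i j m - om j i m) * G m k l p) + R (A i p) (A j p) (A k p) \<bullet> A l p"
    using nab_commute[OF smooth_A p, of i j k]
    by (simp add: inner_add_left inner_sum_left nab_A_inner[OF p] flip: inner_diff_left)
  then show ?thesis unfolding 1 by (simp add: sum_subtractf diff_divide_distrib)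
qed

abbreviation v :: "'a \<Rightarrow> real" where "v \<equiv> rsqrt f"

lemma smooth_v: "smooth_on M v"
  unfolding rsqrt_def[abs_def] by (rule smooth_on_compose[OF smooth_on_inverse_sqrt smooth_f]) (simp add: f_pos)

lemma v_pos: "p \<in> M \<Longrightarrow> v p > 0"
  by (simp add: rsqrt_def f_pos)

lemma f_v: "p \<in> M \<Longrightarrow> f p * (v p * v p) = 1"
  using f_pos[of p] by (simp add: rsqrt_def flip: inverse_mult_distrib)

lemma dd_f:
  assumes p: "p \<in> M"
  shows "dd (E i) f p = - 2 * dd (E i) v p / v p ^ 3"
proof -
  have "dd (E i) f p * (v p * v p) + f p * (dd (E i) v p * v p + v p * dd (E i) v p)
      = dd (E i) (\<lambda>x. f x * (v x * v x)) p"
    using dd_mult[OF smooth_f smooth_on_mult[OF smooth_v smooth_v] p] dd_mult[OF smooth_v smooth_v p] by simp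
  also have "\<dots> = dd (E i) (\<lambda>x. 1) p"
    by (rule dd_cong[OF smooth_on_mult[OF smooth_f smooth_on_mult[OF smooth_v smooth_v]] p f_v])
  finally have *: "dd (E i) f p * (v p * v p) + f p * (dd (E i) v p * v p + v p * dd (E i) v p) = 0" by simp
  have "dd (E i) f p * v p ^ 3 = (dd (E i) f p * (v p * v p)) * v p" by (simp add: power3_eq_cube)
  also have "\<dots> = - (f p * (v p * v p)) * (2 * dd (E i) v p)" using * by algebra
  finally show ?thesis using v_pos[OF p] f_v[OF p] by (simp add: field_simps)
qed

lemma dd_dd_f:
  assumes p: "p \<in> M"
  shows "dd (E i) (dd (E j) f) p = - 2 * dd (E i) (dd (E j) v) p / v p ^ 3
     + 6 * dd (E i) v p * dd (E j) v p / v p ^ 4"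
proof -
  have v: "v p > 0" by (rule v_pos[OF p])
  have "((\<lambda>x. - 2 * dd (E j) v x / v x ^ 3) has_derivative
     (\<lambda>h. - 2 * frechet_derivative (dd (E j) v) (at p) h / v p ^ 3
        + 6 * frechet_derivative v (at p) h * dd (E j) v p / v p ^ 4)) (at p)"
    using v smooth_on_has_derivative[OF smooth_v p] smooth_on_has_derivative[OF smooth_on_dd[OF smooth_v smooth_E] p, of j]
    by (auto intro!: derivative_eq_intros simp: field_simps eval_nat_numeral)
  from dd_eqI[OF this, of "E i"]
  have "dd (E i) (\<lambda>x. - 2 * dd (E j) v x / v x ^ 3) p = - 2 * dd (E i) (dd (E j) v) p / v p ^ 3
     + 6 * dd (E i) v p * dd (E j) v p / v p ^ 4" by (simp add: dd_def)
  then show ?thesis using dd_cong[OF smooth_q p dd_f] by metis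
qed

end

subsection \<open>The Yamabe equation\<close>

text \<open>Levi-Civita coefficients of the frame y d/dx, y d/dy, d/dz: the derivative of
  \<open>E 1\<close> along \<open>E 1\<close> is \<open>E 2\<close>, that of \<open>E 2\<close>
  along \<open>E 1\<close> is \<open>- E 1\<close>. \<open>H2R_W\<close> is the same connection as a
  bilinear map.\<close>

definition H2R_om :: "3 \<Rightarrow> 3 \<Rightarrow> 3 \<Rightarrow> real" where
  "H2R_om i j k = (if i = 1 \<and> j = 1 \<and> k = 2 then 1 else if i = 1 \<and> j = 2 \<and> k = 1 then - 1 else 0)"

definition H2R_W :: "real \<times> real \<times> real \<Rightarrow> real \<times> real \<times> real \<Rightarrow> real \<times> real \<times> real" where
  "H2R_W = (\<lambda>(x1, x2, x3) (v1, v2, v3). (- x1 * v2, x1 * v1, 0))"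

text \<open>Levi-Civita coefficients of the frame e^(-z) d/dx, e^z d/dy, d/dz; \<open>Sol_W\<close>
  encodes the same connection on component vectors.\<close>

definition Sol_om :: "3 \<Rightarrow> 3 \<Rightarrow> 3 \<Rightarrow> real" where
  "Sol_om i j k = (if i = 1 \<and> j = 1 \<and> k = 3 then - 1 else if i = 1 \<and> j = 3 \<and> k = 1 then 1
     else if i = 2 \<and> j = 2 \<and> k = 3 then 1 else if i = 2 \<and> j = 3 \<and> k = 2 then - 1 else 0)"

definition Sol_W :: "real \<times> real \<times> real \<Rightarrow> real \<times> real \<times> real \<Rightarrow> real \<times> real \<times> real" where
  "Sol_W = (\<lambda>(x1, x2, x3) (v1, v2, v3). (x1 * v3, - x2 * v3, x2 * v2 - x1 * v1))"

text \<open>A square matrix whose rows are orthogonal of equal length has columns with the same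
  property.\<close>

lemma (in conformal_frame) columns:
  assumes "p \<in> M"
  shows "(\<Sum>m\<in>UNIV. (x \<bullet> A m p) * (y \<bullet> A m p)) = f p * (x \<bullet> y)"
  using inner_expand[OF assms, of x y] f_pos[OF assms] by (simp add: field_simps)

text \<open>Rewrites the scalar equation for f as one for w = f^(-1/2). \<open>L\<close> and
  \<open>N\<close> are the Laplacian and squared gradient of w, so \<open>4 * N / w ^ 6\<close> is
  the squared gradient of f; \<open>k\<close> is -s/2, that is 1 for the two negative geometries and
  0 for flat space.\<close>

lemma Yamabe_substitution:
  fixes w L N k :: real
  assumes w: "w > 0" and eq: "- 2 * L / w ^ 3 + 6 * N / w ^ 4 = 3 / 4 * (4 * N / w ^ 6) * w\<^sup>2 + k * (1 / w ^ 4 - 1 / w\<^sup>2)"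
  shows "L = k * (w - 1 / w) / 2 + 3 / 2 * N / w"
proof -
  have "- 2 * L * w + 6 * N = (- 2 * L / w ^ 3 + 6 * N / w ^ 4) * w ^ 4"
    using w by (simp add: field_simps eval_nat_numeral)
  also have "\<dots> = 3 * N + k * (1 - w\<^sup>2)"
    unfolding eq using w by (simp add: field_simps eval_nat_numeral)
  finally show ?thesis using w by (simp add: field_simps power2_eq_square)
qed

lemma (in conformal_frame) f_rsqrt: "p \<in> M \<Longrightarrow> f p = 1 / (v p)\<^sup>2"
  using f_v[of p] v_pos[of p] by (simp add: field_simps power2_eq_square)

text \<open>Sum of the curvature identities over the three pairs of frame directions. The covariant
  derivatives of each \<open>E i\<close> along itself add up to \<open>E 2\<close>, which the
  Laplacian subtracts; hence the first-order term.\<close>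

lemma H2R_Yamabe:
  assumes "conformal_frame M E H2R_om H2R_W A f" and p: "p \<in> M"
  defines "v \<equiv> rsqrt f"
  shows "dd (E 1) (dd (E 1) v) p + dd (E 2) (dd (E 2) v) p + dd (E 3) (dd (E 3) v) p - dd (E 2) v p
    = (v p - 1 / v p) / 2 + 3 / 2 * ((dd (E 1) v p)\<^sup>2 + (dd (E 2) v p)\<^sup>2 + (dd (E 3) v p)\<^sup>2) / v p"
proof -
  interpret conformal_frame M E H2R_om H2R_W A f by fact
  obtain a1 b1 c1 a2 b2 c2 a3 b3 c3 where A: "A 1 p = (a1, b1, c1)" "A 2 p = (a2, b2, c2)" "A 3 p = (a3, b3, c3)"
    by (metis prod_cases3)
  have "a1 * a1 + a2 * a2 + a3 * a3 = f p" "b1 * b1 + b2 * b2 + b3 * b3 = f p" "a1 * b1 + a2 * b2 + a3 * b3 = 0"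
    using columns[OF p, of "(1, 0, 0)" "(1, 0, 0)"] columns[OF p, of "(0, 1, 0)" "(0, 1, 0)"]
      columns[OF p, of "(1, 0, 0)" "(0, 1, 0)"] by (simp_all add: sum_3 A)
  \<comment> \<open>Only the H^2 factor is curved, so the target curvature involves just the minors
    of the columns a and b. By the Lagrange identity their squares sum to |a|^2 |b|^2 -
    (a.b)^2.\<close>
  then have "(a1 * b1 + a2 * b2 + a3 * b3)\<^sup>2 - (a1 * a1 + a2 * a2 + a3 * a3) * (b1 * b1 + b2 * b2 + b3 * b3) = - (f p)\<^sup>2"
    by (simp add: power2_eq_square)
  then have "R (A 1 p) (A 2 p) (A 2 p) \<bullet> A 1 p + R (A 1 p) (A 3 p) (A 3 p) \<bullet> A 1 p + R (A 2 p) (A 3 p) (A 3 p) \<bullet> A 2 p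
    = - (f p)\<^sup>2"
    unfolding A R_def unfolding H2R_W_def by (simp add: algebra_simps power2_eq_square)
  \<comment> \<open>Reading \<open>curvature_identity\<close> backwards replaces each target
    curvature by derivatives of f in the source.\<close>
  then have eq: "dd (E 1) (dd (E 1) f) p + dd (E 2) (dd (E 2) f) p + dd (E 3) (dd (E 3) f) p - dd (E 2) f p
    = 3 / 4 * ((dd (E 1) f p)\<^sup>2 + (dd (E 2) f p)\<^sup>2 + (dd (E 3) f p)\<^sup>2) / f p + (f p)\<^sup>2 - f p"
    unfolding curvature_identity[OF p, symmetric]
    using f_pos[OF p]
    by (simp add: sum_3 dd_G[OF p] G_def H2R_om_def)
       (simp add: power2_eq_square add_divide_distrib diff_divide_distrib algebra_simps)
  define w where "w = local.v p"
  have w: "w > 0" using v_pos[OF p] by (simp add: w_def)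
  show ?thesis
    using Yamabe_substitution[OF w, where k = 1 and N = "(dd (E 1) v p)\<^sup>2 + (dd (E 2) v p)\<^sup>2 + (dd (E 3) v p)\<^sup>2"
      and L = "dd (E 1) (dd (E 1) v) p + dd (E 2) (dd (E 2) v) p + dd (E 3) (dd (E 3) v) p - dd (E 2) v p"]
      eq w
    unfolding dd_f[OF p] dd_dd_f[OF p] f_rsqrt[OF p] v_def w_def[symmetric]
    by (simp add: power2_eq_square eval_nat_numeral add_divide_distrib diff_divide_distrib algebra_simps)
qed

text \<open>No first-order term appears: the covariant derivatives of \<open>E 1\<close>,
  \<open>E 2\<close>, \<open>E 3\<close> along themselves are \<open>- E 3\<close>,
  \<open>E 3\<close> and 0, and cancel.\<close>

lemma Sol_Yamabe:
  assumes "conformal_frame M E Sol_om Sol_W A f" and p: "p \<in> M"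
  defines "v \<equiv> rsqrt f"
  shows "dd (E 1) (dd (E 1) v) p + dd (E 2) (dd (E 2) v) p + dd (E 3) (dd (E 3) v) p
    = (v p - 1 / v p) / 2 + 3 / 2 * ((dd (E 1) v p)\<^sup>2 + (dd (E 2) v p)\<^sup>2 + (dd (E 3) v p)\<^sup>2) / v p"
proof -
  interpret conformal_frame M E Sol_om Sol_W A f by fact
  obtain a1 b1 c1 a2 b2 c2 a3 b3 c3 where A: "A 1 p = (a1, b1, c1)" "A 2 p = (a2, b2, c2)" "A 3 p = (a3, b3, c3)"
    by (metis prod_cases3)
  have "a1 * a1 + a2 * a2 + a3 * a3 = f p" "b1 * b1 + b2 * b2 + b3 * b3 = f p" "c1 * c1 + c2 * c2 + c3 * c3 = f p"
    "a1 * b1 + a2 * b2 + a3 * b3 = 0" "a1 * c1 + a2 * c2 + a3 * c3 = 0" "b1 * c1 + b2 * c2 + b3 * c3 = 0"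
    using columns[OF p, of "(1, 0, 0)" "(1, 0, 0)"] columns[OF p, of "(0, 1, 0)" "(0, 1, 0)"]
      columns[OF p, of "(0, 0, 1)" "(0, 0, 1)"]
      columns[OF p, of "(1, 0, 0)" "(0, 1, 0)"] columns[OF p, of "(1, 0, 0)" "(0, 0, 1)"]
      columns[OF p, of "(0, 1, 0)" "(0, 0, 1)"] by (simp_all add: sum_3 A)
  \<comment> \<open>The curvature of Sol is diagonal on the planes 12, 13, 23 with values 1, -1, -1;
    each of the three Gram determinants equals f^2.\<close>
  then have "((a1 * a1 + a2 * a2 + a3 * a3) * (b1 * b1 + b2 * b2 + b3 * b3) - (a1 * b1 + a2 * b2 + a3 * b3)\<^sup>2)
    - ((a1 * a1 + a2 * a2 + a3 * a3) * (c1 * c1 + c2 * c2 + c3 * c3) - (a1 * c1 + a2 * c2 + a3 * c3)\<^sup>2)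
    - ((b1 * b1 + b2 * b2 + b3 * b3) * (c1 * c1 + c2 * c2 + c3 * c3) - (b1 * c1 + b2 * c2 + b3 * c3)\<^sup>2) = - (f p)\<^sup>2"
    by (simp add: power2_eq_square)
  then have "R (A 1 p) (A 2 p) (A 2 p) \<bullet> A 1 p + R (A 1 p) (A 3 p) (A 3 p) \<bullet> A 1 p + R (A 2 p) (A 3 p) (A 3 p) \<bullet> A 2 p
    = - (f p)\<^sup>2"
    unfolding A R_def unfolding Sol_W_def by (simp add: algebra_simps power2_eq_square)
  then have eq: "dd (E 1) (dd (E 1) f) p + dd (E 2) (dd (E 2) f) p + dd (E 3) (dd (E 3) f) p
    = 3 / 4 * ((dd (E 1) f p)\<^sup>2 + (dd (E 2) f p)\<^sup>2 + (dd (E 3) f p)\<^sup>2) / f p + (f p)\<^sup>2 - f p"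
    unfolding curvature_identity[OF p, symmetric]
    using f_pos[OF p]
    by (simp add: sum_3 dd_G[OF p] G_def Sol_om_def)
       (simp add: power2_eq_square add_divide_distrib diff_divide_distrib algebra_simps)
  define w where "w = local.v p"
  have w: "w > 0" using v_pos[OF p] by (simp add: w_def)
  show ?thesis
    using Yamabe_substitution[OF w, where k = 1 and N = "(dd (E 1) v p)\<^sup>2 + (dd (E 2) v p)\<^sup>2 + (dd (E 3) v p)\<^sup>2"
      and L = "dd (E 1) (dd (E 1) v) p + dd (E 2) (dd (E 2) v) p + dd (E 3) (dd (E 3) v) p"]
      eq w
    unfolding dd_f[OF p] dd_dd_f[OF p] f_rsqrt[OF p] v_def w_def[symmetric]
    by (simp add: power2_eq_square eval_nat_numeral add_divide_distrib diff_divide_distrib algebra_simps)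
qed

subsection \<open>A minimum principle\<close>

text \<open>At a minimum the full differential vanishes, so the term coming from the derivative of
  the field drops out and E(E h) is an honest second derivative along a straight line.\<close>

lemma dd_local_min:
  fixes h :: "'a::euclidean_space \<Rightarrow> real"
  assumes h: "smooth_on U h" and E: "smooth_on U E" and p: "p \<in> U" and min: "\<And>x. x \<in> U \<Longrightarrow> h p \<le> h x"
  shows "dd E h p = 0" "dd E (dd E h) p \<ge> 0"
proof -
  have U: "open U" using h by (rule smooth_on_open)
  have ev: "eventually (\<lambda>y. h p \<le> h y) (at p)"
    using eventually_at_topological U p min by blast
  have z: "frechet_derivative h (at p) = (\<lambda>x. 0)"
    by (rule has_derivative_local_min[OF smooth_on_has_derivative[OF h p] ev])
  then show "dd E h p = 0" by (simp add: dd_def)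
  let ?e = "E p"
  let ?g = "dd (\<lambda>_. ?e) h"
  have g: "smooth_on U ?g" by (intro smooth_on_dd h smooth_on_const U)
  have eq: "dd E (dd E h) p = frechet_derivative ?g (at p) ?e"
    unfolding dd_frechet_derivative[OF h E p, of E] z by (simp add: dd_def)
  show "dd E (dd E h) p \<ge> 0"
  proof (rule ccontr)
    assume "\<not> dd E (dd E h) p \<ge> 0"
    then have neg: "frechet_derivative ?g (at p) ?e < 0" by (simp add: eq)
    have "((\<lambda>s. ?g (p + s *\<^sub>R ?e)) has_real_derivative frechet_derivative ?g (at (p + 0 *\<^sub>R ?e)) ?e) (at 0)"
      by (rule smooth_on_DERIV_line[OF g]) (simp add: p)
    then have "((\<lambda>s. ?g (p + s *\<^sub>R ?e)) has_real_derivative frechet_derivative ?g (at p) ?e) (at 0)" by simp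
    from has_real_derivative_neg_dec_right[OF this neg]
    obtain d where d: "d > 0" "\<And>s. 0 < s \<Longrightarrow> s < d \<Longrightarrow> ?g (p + s *\<^sub>R ?e) < ?g p" by auto
    have "continuous (at 0) (\<lambda>s. p + s *\<^sub>R ?e)" by (intro continuous_intros)
    then have "eventually (\<lambda>s. p + s *\<^sub>R ?e \<in> U) (nhds 0)"
      using U p topological_tendstoD[of "\<lambda>s. p + s *\<^sub>R ?e" p "nhds 0" U]
      by (simp add: continuous_at tendsto_nhds_iff)
    then obtain c where c: "c > 0" "\<And>s. \<bar>s\<bar> < c \<Longrightarrow> p + s *\<^sub>R ?e \<in> U"
      by (auto simp: eventually_nhds_metric dist_real_def)
    define t where "t = min c d / 2"
    have t: "0 < t" "t < c" "t < d" using c(1) d(1) by (auto simp: t_def)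
    have "((\<lambda>s. h (p + s *\<^sub>R ?e)) has_real_derivative ?g (p + s *\<^sub>R ?e)) (at s)" if "0 \<le> s" "s \<le> t" for s
      using smooth_on_DERIV_line[OF h c(2), of s] that t by (simp add: dd_def)
    from MVT2[OF t(1) this] obtain s where s: "0 < s" "s < t"
      "h (p + t *\<^sub>R ?e) - h (p + 0 *\<^sub>R ?e) = (t - 0) * ?g (p + s *\<^sub>R ?e)" by blast
    have "?g (p + s *\<^sub>R ?e) < 0" using d(2)[of s] s t z by (simp add: dd_def)
    then have "h (p + t *\<^sub>R ?e) < h p" using s(3) mult_pos_neg[OF t(1), of "?g (p + s *\<^sub>R ?e)"] by simp
    moreover have "h p \<le> h (p + t *\<^sub>R ?e)" using min c(2)[of t] t by simp
    ultimately show False by simp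
  qed
qed

lemma dd_ln:
  fixes F :: "'a::euclidean_space \<Rightarrow> real"
  assumes F: "smooth_on U F" and E: "smooth_on U E" and pos: "\<And>x. x \<in> U \<Longrightarrow> F x > 0" and p: "p \<in> U"
  shows "dd E (\<lambda>x. ln (F x)) p = dd E F p / F p"
    and "dd E (dd E (\<lambda>x. ln (F x))) p = dd E (dd E F) p / F p - (dd E F p / F p)\<^sup>2"
proof -
  have 1: "dd E (\<lambda>x. ln (F x)) p = dd E F p / F p" if "p \<in> U" for p
  proof -
    have "((\<lambda>x. ln (F x)) has_derivative (\<lambda>h. frechet_derivative F (at p) h / F p)) (at p)"
      using has_derivative_compose[OF smooth_on_has_derivative[OF F that],
          of ln "(*) (1 / F p)"] DERIV_ln_divide[OF pos[OF that]]
      by (simp add: has_field_derivative_def)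
    from dd_eqI[OF this, of E] show ?thesis by (simp add: dd_def)
  qed
  then show "dd E (\<lambda>x. ln (F x)) p = dd E F p / F p" using p by blast
  have ln: "smooth_on U (\<lambda>x. ln (F x))"
    by (rule smooth_on_compose[OF smooth_on_ln F]) (simp add: pos)
  have "dd E (dd E (\<lambda>x. ln (F x))) p = dd E (\<lambda>x. dd E F x / F x) p"
    by (rule dd_cong[OF smooth_on_dd[OF ln E] p 1])
  also have "((\<lambda>x. dd E F x / F x) has_derivative (\<lambda>h. frechet_derivative (dd E F) (at p) h / F p
      - dd E F p * frechet_derivative F (at p) h / (F p)\<^sup>2)) (at p)"
    using smooth_on_has_derivative[OF F p] smooth_on_has_derivative[OF smooth_on_dd[OF F E] p] pos[OF p]
    by (auto intro!: derivative_eq_intros simp: field_simps power2_eq_square)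
  from dd_eqI[OF this, of E]
  have "dd E (\<lambda>x. dd E F x / F x) p = dd E (dd E F) p / F p - (dd E F p / F p)\<^sup>2"
    by (simp add: dd_def power2_eq_square)
  finally show "dd E (dd E (\<lambda>x. ln (F x))) p = dd E (dd E F) p / F p - (dd E F p / F p)\<^sup>2" .
qed

text \<open>The function \<open>F\<close> stands in for the distance in the Omori-Yau maximum principle: the infimum of \<open>v\<close>
need not be attained, but that of \<open>v + e ln F\<close> is.\<close>
lemma minimum_principle:
  fixes M :: "'a::euclidean_space set" and E :: "'n::finite \<Rightarrow> 'a \<Rightarrow> 'a" and v F :: "'a \<Rightarrow> real"
  assumes E: "\<And>i. smooth_on M (E i)"
    and v: "smooth_on M v" and v_pos: "\<And>p. p \<in> M \<Longrightarrow> v p > 0"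
    and F: "smooth_on M F" and F1: "\<And>p. p \<in> M \<Longrightarrow> F p \<ge> 1"
    and proper: "\<And>R. compact {p \<in> M. F p \<le> R}"
    and dF: "\<And>p i. p \<in> M \<Longrightarrow> \<bar>dd (E i) F p\<bar> \<le> C * F p"
    and ddF: "\<And>p i. p \<in> M \<Longrightarrow> dd (E i) (dd (E i) F) p \<le> C * F p"
    and eq: "\<And>p. p \<in> M \<Longrightarrow> (\<Sum>i\<in>UNIV. dd (E i) (dd (E i) v) p + b i * dd (E i) v p)
        = (v p - 1 / v p) / 2 + 3 / 2 * (\<Sum>i\<in>UNIV. (dd (E i) v p)\<^sup>2) / v p"
    and q: "q \<in> M"
  shows "v q \<ge> 1"
proof -
  let ?psi = "\<lambda>x. ln (F x)"
  have F0: "F p > 0" if "p \<in> M" for p using F1[OF that] by simp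
  have psi: "smooth_on M ?psi"
    by (rule smooth_on_compose[OF smooth_on_ln F]) (simp add: F0)
  have M: "open M" using v by (rule smooth_on_open)
  \<comment> \<open>\<open>- e * K / 2\<close> will bound the left side of the equation from below
    at the minimum point, and \<open>L * e\<^sup>2\<close> will bound three times the squared
    gradient from above.\<close>
  define K where "K = 2 * (\<Sum>i\<in>(UNIV::'n set). C + \<bar>b i\<bar> * C)"
  define L where "L = (\<Sum>i\<in>(UNIV::'n set). 3 * C\<^sup>2)"
  have key: "(v q + e * ?psi q)\<^sup>2 + e * K * (v q + e * ?psi q) \<ge> 1 - L * e\<^sup>2" if e: "e > 0" for e
  proof -
    let ?h = "\<lambda>x. v x + e * ?psi x"
    have h: "smooth_on M ?h" by (intro smooth_on_add v smooth_on_mult psi smooth_on_const M)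
    \<comment> \<open>Outside \<open>?S\<close> the summand e ln F alone exceeds the value of
      \<open>?h\<close> at \<open>q\<close>, so a minimum over this compact set is global.\<close>
    define R where "R = exp (?h q / e)"
    let ?S = "{p \<in> M. F p \<le> R}"
    have qS: "q \<in> ?S"
    proof -
      have "?psi q \<le> ?h q / e" using e v_pos[OF q] by (simp add: field_simps)
      then have "F q \<le> R" unfolding R_def using F0[OF q] by (metis exp_le_cancel_iff exp_ln)
      then show ?thesis using q by simp
    qed
    have "continuous_on ?S ?h" by (rule continuous_on_subset[OF smooth_on_continuous[OF h]]) auto
    from continuous_attains_inf[OF proper _ this] qS
    obtain p where p: "p \<in> ?S" "\<And>x. x \<in> ?S \<Longrightarrow> ?h p \<le> ?h x" by blast
    have pM: "p \<in> M" using p by simp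
    have hp: "?h p \<le> ?h x" if "x \<in> M" for x
    proof (cases "F x \<le> R")
      case True
      then show ?thesis using p that by simp
    next
      case False
      then have "?h q / e < ?psi x" unfolding R_def using F0[OF that] by (metis exp_less_cancel_iff exp_ln not_le)
      then have "?h q < ?h x" using e v_pos[OF that] by (simp add: field_simps)
      then show ?thesis using p(2)[OF qS] by simp
    qed
    have sm_e: "smooth_on M (\<lambda>x. e * ?psi x)" by (intro smooth_on_mult psi smooth_on_const M)
    have dh: "dd (E i) ?h x = dd (E i) v x + e * dd (E i) ?psi x" if "x \<in> M" for x i
      using dd_add[OF v sm_e that] dd_mult[OF smooth_on_const[OF M] psi that] by simp
    have ddh: "dd (E i) (dd (E i) ?h) p = dd (E i) (dd (E i) v) p + e * dd (E i) (dd (E i) ?psi) p" for i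
    proof -
      have sp: "smooth_on M (dd (E i) ?psi)" by (intro smooth_on_dd psi E)
      have "dd (E i) (dd (E i) ?h) p = dd (E i) (\<lambda>x. dd (E i) v x + e * dd (E i) ?psi x) p"
        by (rule dd_cong[OF smooth_on_dd[OF h E] pM dh])
      also have "\<dots> = dd (E i) (dd (E i) v) p + dd (E i) (\<lambda>x. e * dd (E i) ?psi x) p"
        by (rule dd_add[OF smooth_on_dd[OF v E] smooth_on_mult[OF smooth_on_const[OF M] sp] pM])
      finally show ?thesis using dd_mult[OF smooth_on_const[OF M] sp pM] by simp
    qed
    have psi1: "\<bar>dd (E i) ?psi p\<bar> \<le> C" for i
      using dF[OF pM, of i] F0[OF pM] dd_ln(1)[OF F E[of i] F0 pM] by (simp add: pos_divide_le_eq)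
    have psi2: "dd (E i) (dd (E i) ?psi) p \<le> C" for i
    proof -
      have "dd (E i) (dd (E i) F) p / F p \<le> C" using ddF[OF pM, of i] F0[OF pM] by (simp add: field_simps)
      then show ?thesis using dd_ln(2)[OF F E[of i] F0 pM] by (smt (verit) zero_le_power2)
    qed
    have v1: "dd (E i) v p = - e * dd (E i) ?psi p" for i
      using dd_local_min(1)[OF h E pM hp] dh[OF pM, of i] by simp
    have v2: "dd (E i) (dd (E i) v) p \<ge> - e * C" for i
    proof -
      have "e * dd (E i) (dd (E i) ?psi) p \<le> e * C" using psi2[of i] e by simp
      then show ?thesis using dd_local_min(2)[OF h E pM hp, of i] ddh[of i] by simp
    qed
    have v1': "\<bar>dd (E i) v p\<bar> \<le> e * C" for i
      unfolding v1 using psi1[of i] e by (simp add: abs_mult)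
    have "(\<Sum>i\<in>UNIV. dd (E i) (dd (E i) v) p + b i * dd (E i) v p) \<ge> (\<Sum>i\<in>UNIV. - (e * (C + \<bar>b i\<bar> * C)))"
    proof (rule sum_mono)
      fix i
      have "\<bar>b i * dd (E i) v p\<bar> \<le> \<bar>b i\<bar> * (e * C)" unfolding abs_mult by (intro mult_left_mono v1') simp
      then show "- (e * (C + \<bar>b i\<bar> * C)) \<le> dd (E i) (dd (E i) v) p + b i * dd (E i) v p"
        using v2[of i] by (simp add: algebra_simps)
    qed
    also have "(\<Sum>i\<in>UNIV. - (e * (C + \<bar>b i\<bar> * C))) = - e * K / 2"
      by (simp add: K_def sum_negf flip: sum_distrib_left)
    finally have lower: "- e * K / 2 \<le> (v p - 1 / v p) / 2 + 3 / 2 * (\<Sum>i\<in>UNIV. (dd (E i) v p)\<^sup>2) / v p"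
      unfolding eq[OF pM] .
    have "3 * (\<Sum>i\<in>UNIV. (dd (E i) v p)\<^sup>2) \<le> L * e\<^sup>2"
    proof -
      have "(\<Sum>i\<in>UNIV. (dd (E i) v p)\<^sup>2) \<le> (\<Sum>i\<in>(UNIV::'n set). (e * C)\<^sup>2)"
        using v1' by (intro sum_mono) (metis abs_ge_zero power2_abs power_mono)
      then show ?thesis by (simp add: L_def power_mult_distrib algebra_simps)
    qed
    then have upper: "- e * K * v p \<le> (v p)\<^sup>2 - 1 + L * e\<^sup>2"
    proof -
      have "- e * K * v p = (- e * K / 2) * (2 * v p)" by simp
      also have "\<dots> \<le> ((v p - 1 / v p) / 2 + 3 / 2 * (\<Sum>i\<in>UNIV. (dd (E i) v p)\<^sup>2) / v p) * (2 * v p)"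
        using lower v_pos[OF pM] by (intro mult_right_mono) auto
      also have "\<dots> = (v p)\<^sup>2 - 1 + 3 * (\<Sum>i\<in>UNIV. (dd (E i) v p)\<^sup>2)"
        using v_pos[OF pM] by (simp add: field_simps power2_eq_square)
      finally show ?thesis
        using \<open>3 * (\<Sum>i\<in>UNIV. (dd (E i) v p)\<^sup>2) \<le> L * e\<^sup>2\<close> by simp
    qed
    \<comment> \<open>Since \<open>F\<close> is at least 1, e ln F is nonnegative, and the estimate
      at the unknown point \<open>p\<close> becomes one at \<open>q\<close>.\<close>
    have le: "v p \<le> ?h q" 
      using hp[OF q] e F1[OF pM] by (smt (verit) ln_ge_zero mult_nonneg_nonneg)
    have C: "C \<ge> 0" using psi1[of undefined] by simp
    have K: "K \<ge> 0" unfolding K_def using C by (intro mult_nonneg_nonneg sum_nonneg) simp_all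
    have "(v p)\<^sup>2 \<le> (?h q)\<^sup>2" using le v_pos[OF pM] by (intro power_mono) auto
    moreover have "e * K * v p \<le> e * K * ?h q" using le K e by (intro mult_left_mono) auto
    ultimately show ?thesis using upper by simp
  qed
  \<comment> \<open>With \<open>q\<close> fixed, e tends to 0 from the right and every error term
    disappears.\<close>
  have "((\<lambda>e. (v q + e * ?psi q)\<^sup>2 + e * K * (v q + e * ?psi q)) \<longlongrightarrow> (v q + 0 * ?psi q)\<^sup>2 + 0 * K * (v q + 0 * ?psi q)) (at_right 0)"
    by (intro tendsto_intros)
  moreover have "((\<lambda>e. 1 - L * e\<^sup>2) \<longlongrightarrow> 1 - L * 0\<^sup>2) (at_right 0)"
    by (intro tendsto_intros)
  moreover have "eventually (\<lambda>e. 1 - L * e\<^sup>2 \<le> (v q + e * ?psi q)\<^sup>2 + e * K * (v q + e * ?psi q)) (at_right 0)"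
    using key by (auto simp: eventually_at_right_less intro: eventually_at_rightI[of 0 1])
  ultimately have "1 - L * 0\<^sup>2 \<le> (v q + 0 * ?psi q)\<^sup>2 + 0 * K * (v q + 0 * ?psi q)"
    by (intro tendsto_le[OF trivial_limit_at_right_real])
  then have "1\<^sup>2 \<le> (v q)\<^sup>2" by simp
  then show ?thesis using v_pos[OF q] by (metis less_imp_le power2_le_imp_le)
qed

subsection \<open>The homogeneous frames of \<open>H\<^sup>2 \<times> \<real>\<close> and Sol\<close>

abbreviation (input) cx :: "real \<times> real \<times> real \<Rightarrow> real" where "cx p \<equiv> fst p"
abbreviation (input) cy :: "real \<times> real \<times> real \<Rightarrow> real" where "cy p \<equiv> fst (snd p)"
abbreviation (input) cz :: "real \<times> real \<times> real \<Rightarrow> real" where "cz p \<equiv> snd (snd p)"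

lemma smooth_coord:
  assumes "open U"
  shows "smooth_on U (\<lambda>p. cx p)" "smooth_on U (\<lambda>p. cy p)" "smooth_on U (\<lambda>p. cz p)"
  using assms
  by (auto intro!: smooth_on_fst_comp smooth_on_bounded_linear bounded_linear_fst bounded_linear_snd)

definition H2R_E :: "3 \<Rightarrow> real \<times> real \<times> real \<Rightarrow> real \<times> real \<times> real" where
  "H2R_E i p = (if i = 1 then (cy p, 0, 0) else if i = 2 then (0, cy p, 0) else (0, 0, 1))"

definition Sol_E :: "3 \<Rightarrow> real \<times> real \<times> real \<Rightarrow> real \<times> real \<times> real" where
  "Sol_E i p = (if i = 1 then (exp (- cz p), 0, 0) else if i = 2 then (0, exp (cz p), 0) else (0, 0, 1))"

lemma open_H2R: "open H2R"
proof -
  have "H2R = {p. 0 < cy p}" by (auto simp: H2R_def)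
  moreover have "open {p :: real \<times> real \<times> real. 0 < cy p}" by (intro open_Collect_less continuous_intros)
  ultimately show ?thesis by simp
qed

lemma H2R_iff: "p \<in> H2R \<longleftrightarrow> cy p > 0"
  by (auto simp: H2R_def)

lemma smooth_H2R_E: "smooth_on H2R (H2R_E i)"
proof -
  have "i = 1 \<or> i = 2 \<or> i = 3" by (rule exhaust_3)
  then show ?thesis unfolding H2R_E_def[abs_def]
    by (auto intro!: smooth_on_Pair smooth_coord smooth_on_const open_H2R)
qed

lemma H2R_bracket:
  assumes "p \<in> H2R"
  shows "dd (H2R_E i) (H2R_E j) p - dd (H2R_E j) (H2R_E i) p
      = (\<Sum>k\<in>UNIV. (H2R_om i j k - H2R_om j i k) *\<^sub>R H2R_E k p)"
proof -
  have 1: "dd E (H2R_E 1) p = (cy (E p), 0, 0)" "dd E (H2R_E 2) p = (0, cy (E p), 0)" "dd E (H2R_E 3) p = 0" for E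
    by (rule dd_eqI, auto simp: H2R_E_def[abs_def] zero_prod_def intro!: derivative_eq_intros)+
  show ?thesis
    using exhaust_3[of i] exhaust_3[of j]
    by (elim disjE) (simp_all add: 1 sum_3 H2R_om_def H2R_E_def zero_prod_def)
qed

lemma H2R_g_E: "p \<in> H2R \<Longrightarrow> H2R_g p (H2R_E i p) (H2R_E j p) = (if i = j then 1 else 0)"
  using exhaust_3[of i] exhaust_3[of j]
  by (elim disjE) (auto simp: H2R_g_def H2R_E_def H2R_iff power2_eq_square split: prod.splits)

lemma smooth_Sol_E: "smooth_on UNIV (Sol_E i)"
proof -
  have "i = 1 \<or> i = 2 \<or> i = 3" by (rule exhaust_3)
  then show ?thesis unfolding Sol_E_def[abs_def]
    by (auto intro!: smooth_on_Pair smooth_on_exp_compose smooth_on_minus smooth_coord smooth_on_const)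
qed

lemma Sol_bracket:
  "dd (Sol_E i) (Sol_E j) p - dd (Sol_E j) (Sol_E i) p = (\<Sum>k\<in>UNIV. (Sol_om i j k - Sol_om j i k) *\<^sub>R Sol_E k p)"
proof -
  have 1: "dd E (Sol_E 1) p = (- exp (- cz p) * cz (E p), 0, 0)" "dd E (Sol_E 2) p = (0, exp (cz p) * cz (E p), 0)"
    "dd E (Sol_E 3) p = 0" for E
    by (rule dd_eqI, auto simp: Sol_E_def[abs_def] zero_prod_def intro!: derivative_eq_intros)+
  show ?thesis
    using exhaust_3[of i] exhaust_3[of j]
    by (elim disjE) (simp_all add: 1 sum_3 Sol_om_def Sol_E_def zero_prod_def)
qed

lemma Sol_g_E: "Sol_g p (Sol_E i p) (Sol_E j p) = (if i = j then 1 else 0)"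
  using exhaust_3[of i] exhaust_3[of j]
  by (elim disjE) (auto simp: Sol_g_def Sol_E_def mult.assoc simp flip: exp_add split: prod.splits)

lemma bounded_bilinear_H2R_W: "bounded_bilinear H2R_W"
  unfolding bilinear_conv_bounded_bilinear[symmetric] bilinear_def H2R_W_def
  by (auto intro!: linearI simp: algebra_simps)

lemma bounded_bilinear_Sol_W: "bounded_bilinear Sol_W"
  unfolding bilinear_conv_bounded_bilinear[symmetric] bilinear_def Sol_W_def
  by (auto intro!: linearI simp: algebra_simps)

text \<open>The image of a frame vector must be expressed in the frame at the image point, hence the
  division of the first two components by the height of \<open>\<phi> p\<close>.\<close>

lemma H2R_conformal_frame:
  assumes \<phi>: "smooth_on H2R \<phi>" "\<And>p. p \<in> H2R \<Longrightarrow> \<phi> p \<in> H2R" and f: "\<And>p. p \<in> H2R \<Longrightarrow> f p > 0"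
    and conf: "\<And>p u v. p \<in> H2R \<Longrightarrow>
      H2R_g (\<phi> p) (frechet_derivative \<phi> (at p) u) (frechet_derivative \<phi> (at p) v) = f p * H2R_g p u v"
  shows "conformal_frame H2R H2R_E H2R_om H2R_W
     (\<lambda>i p. (cx (dd (H2R_E i) \<phi> p) / cy (\<phi> p), cy (dd (H2R_E i) \<phi> p) / cy (\<phi> p), cz (dd (H2R_E i) \<phi> p))) f"
    (is "conformal_frame _ ?E _ _ ?A _")
proof (rule conformal_frame.intro)
  have d: "smooth_on H2R (dd (?E i) \<phi>)" for i by (intro smooth_on_dd \<phi> smooth_H2R_E)
  have Y: "smooth_on H2R (\<lambda>x. cy (\<phi> x))" by (intro smooth_on_fst_comp \<phi>)
  have Y0: "cy (\<phi> p) > 0" if "p \<in> H2R" for p using \<phi>(2)[OF that] by (simp add: H2R_iff)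
  have dc: "smooth_on H2R (\<lambda>x. cx (dd (?E i) \<phi> x))" "smooth_on H2R (\<lambda>x. cy (dd (?E i) \<phi> x))"
    "smooth_on H2R (\<lambda>x. cz (dd (?E i) \<phi> x))" for i by (intro smooth_on_fst_comp d)+
  have dq: "smooth_on H2R (\<lambda>x. cx (dd (?E i) \<phi> x) / cy (\<phi> x))" "smooth_on H2R (\<lambda>x. cy (dd (?E i) \<phi> x) / cy (\<phi> x))" for i
    using smooth_on_divide[OF dc(1) Y Y0] smooth_on_divide[OF dc(2) Y Y0] by blast+
  fix i j k :: 3 and p x y z :: "real \<times> real \<times> real"
  show "open H2R" by (rule open_H2R)
  show "smooth_on H2R (?E i)" by (rule smooth_H2R_E)
  show "H2R_om i j k = - H2R_om i k j" by (simp add: H2R_om_def)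
  show "bounded_bilinear H2R_W" by (rule bounded_bilinear_H2R_W)
  show "H2R_W x y \<bullet> z = - (y \<bullet> H2R_W x z)" by (cases x; cases y; cases z) (simp add: H2R_W_def)
  show "smooth_on H2R (?A i)" by (intro smooth_on_Pair dq dc)
  show "CARD(3) = DIM(real \<times> real \<times> real)" by simp
  assume p: "p \<in> H2R"
  show "dd (?E i) (?E j) p - dd (?E j) (?E i) p = (\<Sum>k\<in>UNIV. (H2R_om i j k - H2R_om j i k) *\<^sub>R ?E k p)"
    by (rule H2R_bracket[OF p])
  show "f p > 0" by (rule f[OF p])
  have "?A i p \<bullet> ?A j p = H2R_g (\<phi> p) (dd (?E i) \<phi> p) (dd (?E j) \<phi> p)"
    by (simp add: H2R_g_def power2_eq_square add_divide_distrib split: prod.splits)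
  then show "?A i p \<bullet> ?A j p = (if i = j then f p else 0)"
    unfolding dd_def conf[OF p] H2R_g_E[OF p] by simp
  have dA: "dd (?E i) (?A j) p = (cx (dd (?E i) (dd (?E j) \<phi>) p) / cy (\<phi> p) - cx (dd (?E j) \<phi> p) * cy (dd (?E i) \<phi> p) / (cy (\<phi> p))\<^sup>2,
       cy (dd (?E i) (dd (?E j) \<phi>) p) / cy (\<phi> p) - cy (dd (?E j) \<phi> p) * cy (dd (?E i) \<phi> p) / (cy (\<phi> p))\<^sup>2,
       cz (dd (?E i) (dd (?E j) \<phi>) p))" for i j
    by (simp add: dd_Pair[OF dq(1) smooth_on_Pair[OF dq(2) dc(3)] p] dd_Pair[OF dq(2) dc(3) p]
        dd_divide[OF dc(1) Y p Y0[OF p]] dd_divide[OF dc(2) Y p Y0[OF p]]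
        dd_fst_comp[OF d p] dd_fst_comp[OF smooth_on_fst_comp(2)[OF d] p] dd_fst_comp[OF \<phi>(1) p]
        dd_fst_comp[OF smooth_on_fst_comp(2)[OF \<phi>(1)] p])
  have h: "dd (?E i) (dd (?E j) \<phi>) p = dd (?E j) (dd (?E i) \<phi>) p + (\<Sum>k\<in>UNIV. (H2R_om i j k - H2R_om j i k) *\<^sub>R dd (?E k) \<phi> p)"
    using dd_bracket[OF \<phi>(1) smooth_H2R_E p H2R_bracket[OF p], of i j] by (simp add: algebra_simps)
  \<comment> \<open>The quadratic terms from differentiating the denominators combine with
    \<open>H2R_W\<close> to an expression symmetric in \<open>i\<close> and \<open>j\<close>; only
    the bracket term in \<open>h\<close> is left.\<close>
  show "dd (?E i) (?A j) p + H2R_W (?A i p) (?A j p) - (dd (?E j) (?A i) p + H2R_W (?A j p) (?A i p))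
     = (\<Sum>k\<in>UNIV. (H2R_om i j k - H2R_om j i k) *\<^sub>R ?A k p)"
    unfolding dA h
    by (simp add: sum_3 H2R_W_def power2_eq_square add_divide_distrib diff_divide_distrib algebra_simps)
qed

text \<open>As for H^2 x R, with exponential weights: differentiating the weights gives terms that
  \<open>Sol_W\<close> makes symmetric in \<open>i\<close> and \<open>j\<close>.\<close>

lemma Sol_conformal_frame:
  assumes \<phi>: "smooth_on UNIV \<phi>" and f: "\<And>p. f p > 0"
    and conf: "\<And>p u v.
      Sol_g (\<phi> p) (frechet_derivative \<phi> (at p) u) (frechet_derivative \<phi> (at p) v) = f p * Sol_g p u v"
  shows "conformal_frame UNIV Sol_E Sol_om Sol_W
     (\<lambda>i p. (exp (cz (\<phi> p)) * cx (dd (Sol_E i) \<phi> p), exp (- cz (\<phi> p)) * cy (dd (Sol_E i) \<phi> p), cz (dd (Sol_E i) \<phi> p))) f"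
    (is "conformal_frame _ ?E _ _ ?A _")
proof (rule conformal_frame.intro)
  have d: "smooth_on UNIV (dd (?E i) \<phi>)" for i by (intro smooth_on_dd \<phi> smooth_Sol_E)
  have Z: "smooth_on UNIV (\<lambda>x. cz (\<phi> x))" by (intro smooth_on_fst_comp \<phi>)
  have Z': "smooth_on UNIV (\<lambda>x. - cz (\<phi> x))" by (intro smooth_on_minus Z)
  note e = smooth_on_exp_compose[OF Z] smooth_on_exp_compose[OF Z']
  have dc: "smooth_on UNIV (\<lambda>x. cx (dd (?E i) \<phi> x))" "smooth_on UNIV (\<lambda>x. cy (dd (?E i) \<phi> x))"
    "smooth_on UNIV (\<lambda>x. cz (dd (?E i) \<phi> x))" for i by (intro smooth_on_fst_comp d)+
  note dq = smooth_on_mult[OF e(1) dc(1)] smooth_on_mult[OF e(2) dc(2)]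
  fix i j k :: 3 and p x y z :: "real \<times> real \<times> real"
  show "open (UNIV :: (real \<times> real \<times> real) set)" by simp
  show "smooth_on UNIV (?E i)" by (rule smooth_Sol_E)
  show "Sol_om i j k = - Sol_om i k j" by (simp add: Sol_om_def)
  show "bounded_bilinear Sol_W" by (rule bounded_bilinear_Sol_W)
  show "Sol_W x y \<bullet> z = - (y \<bullet> Sol_W x z)" by (cases x; cases y; cases z) (simp add: Sol_W_def algebra_simps)
  show "smooth_on UNIV (?A i)" by (intro smooth_on_Pair dq dc)
  show "CARD(3) = DIM(real \<times> real \<times> real)" by simp
  have p: "p \<in> UNIV" by simp
  show "dd (?E i) (?E j) p - dd (?E j) (?E i) p = (\<Sum>k\<in>UNIV. (Sol_om i j k - Sol_om j i k) *\<^sub>R ?E k p)"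
    by (rule Sol_bracket)
  show "f p > 0" by (rule f)
  have ee: "exp (2 * t) = exp t * exp (t::real)" "exp (- (2 * t)) = exp (- t) * exp (- t)" for t
    by (simp_all flip: exp_add)
  have "?A i p \<bullet> ?A j p = Sol_g (\<phi> p) (dd (?E i) \<phi> p) (dd (?E j) \<phi> p)"
    by (simp add: Sol_g_def ee split: prod.splits)
  then show "?A i p \<bullet> ?A j p = (if i = j then f p else 0)"
    unfolding dd_def conf Sol_g_E by simp
  have dZ: "dd E (\<lambda>x. cz (\<phi> x)) p = cz (dd E \<phi> p)" "dd E (\<lambda>x. - cz (\<phi> x)) p = - cz (dd E \<phi> p)" for E
    using dd_mult[OF smooth_on_const[OF open_UNIV, of "-1"] Z p, of E]
    by (simp_all add: dd_fst_comp[OF smooth_on_fst_comp(2)[OF \<phi>(1)] p] dd_fst_comp[OF \<phi>(1) p])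
  have dA: "dd (?E i) (?A j) p = (exp (cz (\<phi> p)) * (cz (dd (?E i) \<phi> p) * cx (dd (?E j) \<phi> p) + cx (dd (?E i) (dd (?E j) \<phi>) p)),
       exp (- cz (\<phi> p)) * (- cz (dd (?E i) \<phi> p) * cy (dd (?E j) \<phi> p) + cy (dd (?E i) (dd (?E j) \<phi>) p)),
       cz (dd (?E i) (dd (?E j) \<phi>) p))" for i j
    by (simp add: dd_Pair[OF dq(1) smooth_on_Pair[OF dq(2) dc(3)] p] dd_Pair[OF dq(2) dc(3) p]
        dd_mult[OF e(1) dc(1) p] dd_mult[OF e(2) dc(2) p] dd_exp[OF Z p] dd_exp[OF Z' p] dZ
        dd_fst_comp[OF d p] dd_fst_comp[OF smooth_on_fst_comp(2)[OF d] p] algebra_simps)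
  have h: "dd (?E i) (dd (?E j) \<phi>) p = dd (?E j) (dd (?E i) \<phi>) p + (\<Sum>k\<in>UNIV. (Sol_om i j k - Sol_om j i k) *\<^sub>R dd (?E k) \<phi> p)"
    using dd_bracket[OF \<phi>(1) smooth_Sol_E p Sol_bracket, of i j] by (simp add: algebra_simps)
  show "dd (?E i) (?A j) p + Sol_W (?A i p) (?A j p) - (dd (?E j) (?A i) p + Sol_W (?A j p) (?A i p))
     = (\<Sum>k\<in>UNIV. (Sol_om i j k - Sol_om j i k) *\<^sub>R ?A k p)"
    unfolding dA h
    by (simp add: sum_3 Sol_W_def algebra_simps)
qed

subsection \<open>Conformal self-maps of \<open>H\<^sup>2 \<times> \<real>\<close> and Sol\<close>

lemma H2R_coord:
  "cx (H2R_E 1 p) = cy p" "cy (H2R_E 1 p) = 0" "cz (H2R_E 1 p) = 0"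
  "cx (H2R_E 2 p) = 0" "cy (H2R_E 2 p) = cy p" "cz (H2R_E 2 p) = 0"
  "cx (H2R_E 3 p) = 0" "cy (H2R_E 3 p) = 0" "cz (H2R_E 3 p) = 1"
  by (simp_all add: H2R_E_def)

lemma Sol_coord:
  "cx (Sol_E 1 p) = exp (- cz p)" "cy (Sol_E 1 p) = 0" "cz (Sol_E 1 p) = 0"
  "cx (Sol_E 2 p) = 0" "cy (Sol_E 2 p) = exp (cz p)" "cz (Sol_E 2 p) = 0"
  "cx (Sol_E 3 p) = 0" "cy (Sol_E 3 p) = 0" "cz (Sol_E 3 p) = 1"
  by (simp_all add: Sol_E_def)

lemma rsqrt_ge_1_iff: "f p > 0 \<Longrightarrow> rsqrt f p \<ge> 1 \<longleftrightarrow> f p \<le> (1::real)"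
  by (simp add: rsqrt_def one_le_inverse_iff)

lemma H2R_contracting:
  assumes "smooth_on H2R \<phi>" "\<And>p. p \<in> H2R \<Longrightarrow> \<phi> p \<in> H2R" and f: "\<And>p. p \<in> H2R \<Longrightarrow> f p > 0"
    and "\<And>p u v. p \<in> H2R \<Longrightarrow>
      H2R_g (\<phi> p) (frechet_derivative \<phi> (at p) u) (frechet_derivative \<phi> (at p) v) = f p * H2R_g p u v"
    and q: "q \<in> H2R"
  shows "f q \<le> 1"
proof -
  note cf = H2R_conformal_frame[OF assms(1-4)]
  let ?v = "rsqrt f"
  \<comment> \<open>The first summand is 2 cosh of the hyperbolic distance to (0, 1). Its
    derivatives of order one and two are controlled by itself, unlike those of the distance, which
    is not smooth at its centre.\<close>
  define F where "F p = ((cx p)\<^sup>2 + (cy p)\<^sup>2 + 1) / cy p + (cz p)\<^sup>2" for p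
  have sm: "smooth_on H2R F" unfolding F_def[abs_def] power2_eq_square
    by (intro smooth_on_add smooth_on_divide smooth_on_mult smooth_coord smooth_on_const open_H2R) (simp add: H2R_iff)
  have F2: "F p \<ge> 2" if "p \<in> H2R" for p
  proof -
    have "0 \<le> (cx p)\<^sup>2 + (cy p - 1)\<^sup>2" by simp
    then have "2 * cy p \<le> (cx p)\<^sup>2 + (cy p)\<^sup>2 + 1" by (simp add: power2_eq_square algebra_simps)
    then have "2 \<le> ((cx p)\<^sup>2 + (cy p)\<^sup>2 + 1) / cy p" using that by (simp add: H2R_iff pos_le_divide_eq)
    then show ?thesis by (simp add: F_def add_increasing2)
  qed
  have dF: "(F has_derivative (\<lambda>h. (2 * cx p * cx h + 2 * cy p * cy h) / cy p - ((cx p)\<^sup>2 + (cy p)\<^sup>2 + 1) * cy h / (cy p)\<^sup>2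
      + 2 * cz p * cz h)) (at p)" if "p \<in> H2R" for p
    unfolding F_def[abs_def] using that
    by (auto intro!: derivative_eq_intros simp: H2R_iff field_simps power2_eq_square)
  have d1: "dd (H2R_E 1) F p = 2 * cx p" "dd (H2R_E 2) F p = cy p - ((cx p)\<^sup>2 + 1) / cy p" "dd (H2R_E 3) F p = 2 * cz p"
    if "p \<in> H2R" for p
    unfolding dd_eqI[OF dF[OF that]] using that
    by (simp_all add: H2R_coord H2R_iff field_simps power2_eq_square)
  have d2: "dd (H2R_E 1) (dd (H2R_E 1) F) p = 2 * cy p" "dd (H2R_E 2) (dd (H2R_E 2) F) p = cy p + ((cx p)\<^sup>2 + 1) / cy p"
    "dd (H2R_E 3) (dd (H2R_E 3) F) p = 2" if p: "p \<in> H2R" for p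
  proof -
    have "dd (H2R_E 1) (\<lambda>p. 2 * cx p) p = 2 * cx (H2R_E 1 p)" "dd (H2R_E 3) (\<lambda>p. 2 * cz p) p = 2 * cz (H2R_E 3 p)"
      by (rule dd_eqI, auto intro!: derivative_eq_intros)+
    moreover have D: "((\<lambda>p. cy p - ((cx p)\<^sup>2 + 1) / cy p) has_derivative
        (\<lambda>h. cy h - 2 * cx p * cx h / cy p + ((cx p)\<^sup>2 + 1) * cy h / (cy p)\<^sup>2)) (at p)"
      using p by (auto intro!: derivative_eq_intros simp: H2R_iff field_simps power2_eq_square)
    have "dd (H2R_E 2) (\<lambda>p. cy p - ((cx p)\<^sup>2 + 1) / cy p) p = cy p + ((cx p)\<^sup>2 + 1) / cy p"
      using dd_eqI[OF D, of "H2R_E 2"] p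
      by (simp add: H2R_coord H2R_iff power2_eq_square)
    ultimately show "dd (H2R_E 1) (dd (H2R_E 1) F) p = 2 * cy p" "dd (H2R_E 2) (dd (H2R_E 2) F) p = cy p + ((cx p)\<^sup>2 + 1) / cy p"
      "dd (H2R_E 3) (dd (H2R_E 3) F) p = 2"
      using dd_cong[OF smooth_on_dd[OF sm smooth_H2R_E] p d1(1)] dd_cong[OF smooth_on_dd[OF sm smooth_H2R_E] p d1(2)]
        dd_cong[OF smooth_on_dd[OF sm smooth_H2R_E] p d1(3)]
      by (simp_all add: H2R_coord)
  qed
  have F_eq: "F p = (cx p)\<^sup>2 / cy p + cy p + 1 / cy p + (cz p)\<^sup>2" if "p \<in> H2R" for p
    using that by (simp add: F_def H2R_iff field_simps power2_eq_square)
  have nn: "(cx p)\<^sup>2 / cy p \<ge> 0" "cy p > 0" "1 / cy p > 0" "(cz p)\<^sup>2 \<ge> 0" if "p \<in> H2R" for p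
    using that by (simp_all add: H2R_iff)
  have one_le: "?v q \<ge> 1"
  \<comment> \<open>\<open>b\<close> carries the drift \<open>- E 2\<close> of the Laplacian; 2
    dominates all derivative bounds proved below.\<close>
  proof (rule minimum_principle[where M = H2R and E = H2R_E and F = F and C = 2 and b = "\<lambda>i. if i = 2 then - 1 else 0"])
    show "smooth_on H2R (H2R_E i)" for i by (rule smooth_H2R_E)
    show "smooth_on H2R ?v" by (rule conformal_frame.smooth_v[OF cf])
    show "?v p > 0" if "p \<in> H2R" for p by (rule conformal_frame.v_pos[OF cf that])
    show "smooth_on H2R F" by (rule sm)
    show "F p \<ge> 1" if "p \<in> H2R" for p using F2[OF that] by simp
    show "compact {p \<in> H2R. F p \<le> R}" for R
    proof -
      let ?K = "{-R..R} \<times> {0..R} \<times> {-(R + 1)..R + 1}"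
      \<comment> \<open>A closed description of the sublevel set, with the denominator cleared. The
        condition \<open>1 \<le> R * cy p\<close> excludes the boundary y = 0, where the half-space
        itself fails to be closed.\<close>
      let ?C = "{p. 1 \<le> R * cy p \<and> 0 \<le> cy p \<and> (cx p)\<^sup>2 + (cy p)\<^sup>2 + 1 + (cz p)\<^sup>2 * cy p \<le> R * cy p}"
      have "{p \<in> H2R. F p \<le> R} \<subseteq> ?K"
      proof
        fix w assume w: "w \<in> {p \<in> H2R. F p \<le> R}"
        obtain x y z where xyz: "w = (x, y, z)" by (metis prod_cases3)
        then have p: "(x, y, z) \<in> H2R" and FR: "F (x, y, z) \<le> R" using w by auto
        have y: "y > 0" using p by (simp add: H2R_iff)
        have "x\<^sup>2 / y + y + 1 / y + z\<^sup>2 \<le> R" "0 \<le> x\<^sup>2 / y" "0 < 1 / y" "0 \<le> z\<^sup>2"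
          using FR F_eq[OF p] y by simp_all
        then have *: "x\<^sup>2 / y \<le> R" "y \<le> R" "z\<^sup>2 \<le> R" using y by linarith+
        have "x\<^sup>2 \<le> R * y" using *(1) y by (simp add: field_simps)
        also have "\<dots> \<le> R * R" using * y by (intro mult_left_mono) auto
        finally have "\<bar>x\<bar> \<le> R" using * y by (metis abs_le_square_iff abs_of_nonneg less_imp_le order_trans power2_eq_square)
        moreover have "\<bar>z\<bar> \<le> R + 1"
        proof -
          have "0 \<le> (\<bar>z\<bar> - 1)\<^sup>2" by simp
          then have "2 * \<bar>z\<bar> \<le> z\<^sup>2 + 1" by (simp add: power2_eq_square algebra_simps)
          then show ?thesis using *(3) abs_ge_zero[of z] by linarith
        qed
        ultimately show "w \<in> ?K" using * y by (auto simp: xyz)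
      qed
      moreover have "{p \<in> H2R. F p \<le> R} = ?C"
      proof (intro set_eqI iffI)
        fix p assume "p \<in> {p \<in> H2R. F p \<le> R}"
        then have p: "p \<in> H2R" and FR: "F p \<le> R" by auto
        have "1 / cy p \<le> R" using FR F_eq[OF p] nn[OF p] by linarith
        then show "p \<in> ?C" using p FR by (simp add: F_def H2R_iff field_simps)
      next
        fix p assume p: "p \<in> ?C"
        have "cy p \<noteq> 0" using p by auto
        then have "cy p > 0" using p by simp
        then show "p \<in> {p \<in> H2R. F p \<le> R}" using p by (simp add: F_def H2R_iff field_simps)
      qed
      moreover have "closed ?C" by (intro closed_Collect_conj closed_Collect_le continuous_intros)
      moreover have "compact ?K" by (intro compact_Times compact_Icc)
      ultimately have "compact (?K \<inter> ?C)" "{p \<in> H2R. F p \<le> R} = ?K \<inter> ?C"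
        by (blast intro: compact_Int_closed)+
      then show ?thesis by simp
    qed
    show "\<bar>dd (H2R_E i) F p\<bar> \<le> 2 * F p" if p: "p \<in> H2R" for p i
    proof -
      have y: "cy p > 0" using p by (simp add: H2R_iff)
      have "\<bar>2 * cx p\<bar> \<le> F p"
      proof -
        have "0 \<le> (\<bar>cx p\<bar> - cy p)\<^sup>2" by simp
        then have "\<bar>2 * cx p\<bar> * cy p \<le> (cx p)\<^sup>2 + (cy p)\<^sup>2"
          by (simp add: power2_eq_square algebra_simps abs_mult)
        then have "\<bar>2 * cx p\<bar> \<le> (cx p)\<^sup>2 / cy p + cy p" using y by (simp add: field_simps power2_eq_square)
        then show ?thesis using nn[OF p] F_eq[OF p] by linarith
      qed
      moreover have "\<bar>cy p - ((cx p)\<^sup>2 + 1) / cy p\<bar> \<le> F p"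
        using nn[OF p] F_eq[OF p] unfolding add_divide_distrib by linarith
      moreover have "\<bar>2 * cz p\<bar> \<le> F p"
      proof -
        have "0 \<le> (\<bar>cz p\<bar> - 1)\<^sup>2" by simp
        then have "\<bar>2 * cz p\<bar> \<le> (cz p)\<^sup>2 + 1" by (simp add: power2_eq_square algebra_simps abs_mult)
        \<comment> \<open>The lower bound at height z = 0 isolates the hyperbolic summand, leaving
          room for both z^2 and the constant 1.\<close>
        moreover have "2 \<le> F (cx p, cy p, 0)" using F2[of "(cx p, cy p, 0)"] p by (simp add: H2R_iff)
        moreover have "F p = F (cx p, cy p, 0) + (cz p)\<^sup>2" by (simp add: F_def)
        ultimately show ?thesis by simp
      qed
      ultimately show ?thesis
        using exhaust_3[of i] d1[OF p] F2[OF p] by (elim disjE) simp_all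
    qed
    show "dd (H2R_E i) (dd (H2R_E i) F) p \<le> 2 * F p" if p: "p \<in> H2R" for p i
    proof -
      have "2 * cy p \<le> 2 * F p" "cy p + ((cx p)\<^sup>2 + 1) / cy p \<le> 2 * F p" "2 \<le> 2 * F p"
        using F2[OF p] nn[OF p] F_eq[OF p] unfolding add_divide_distrib by linarith+
      then show ?thesis using exhaust_3[of i] d2[OF p] by (elim disjE) simp_all
    qed
    show "(\<Sum>i\<in>UNIV. dd (H2R_E i) (dd (H2R_E i) ?v) p + (if i = 2 then - 1 else 0) * dd (H2R_E i) ?v p)
        = (?v p - 1 / ?v p) / 2 + 3 / 2 * (\<Sum>i\<in>UNIV. (dd (H2R_E i) ?v p)\<^sup>2) / ?v p" if "p \<in> H2R" for p
      using H2R_Yamabe[OF cf that] by (simp add: sum_3)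
  qed (rule q)
  then show ?thesis using rsqrt_ge_1_iff[of f q] f[OF q] by simp
qed

lemma Sol_contracting:
  assumes \<phi>: "smooth_on UNIV \<phi>" and f: "\<And>p. f p > 0"
    and conf: "\<And>p u v.
      Sol_g (\<phi> p) (frechet_derivative \<phi> (at p) u) (frechet_derivative \<phi> (at p) v) = f p * Sol_g p u v"
  shows "f q \<le> 1"
proof -
  note cf = Sol_conformal_frame[OF assms]
  let ?v = "rsqrt f"
  \<comment> \<open>Sum of squares of the nonconstant entries of the inverse of the group element,
    with Sol written as pairs of affine 2x2 matrices. Left-invariant fields act linearly on those
    entries, which keeps the derivatives of \<open>F\<close> within a multiple of
    \<open>F\<close>.\<close>
  define F where "F p = (exp (cz p))\<^sup>2 * ((cx p)\<^sup>2 + 1) + (exp (- cz p))\<^sup>2 * ((cy p)\<^sup>2 + 1)" for p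
  have ab: "exp z * exp (- z) = 1" for z :: real by (simp flip: exp_add)
  have sm: "smooth_on UNIV F" unfolding F_def[abs_def] power2_eq_square
    by (intro smooth_on_add smooth_on_mult smooth_on_exp_compose smooth_on_minus smooth_coord smooth_on_const open_UNIV)
  have parts: "0 \<le> (exp (cz p))\<^sup>2 * (cx p)\<^sup>2" "0 \<le> (exp (- cz p))\<^sup>2 * (cy p)\<^sup>2"
    "F p = (exp (cz p))\<^sup>2 * (cx p)\<^sup>2 + (exp (cz p))\<^sup>2 + (exp (- cz p))\<^sup>2 * (cy p)\<^sup>2 + (exp (- cz p))\<^sup>2" for p
    by (simp_all add: F_def algebra_simps)
  have F1: "F p \<ge> 2" for p
  proof -
    have "0 \<le> (exp (cz p) - exp (- cz p))\<^sup>2" by simp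
    then have "2 \<le> (exp (cz p))\<^sup>2 + (exp (- cz p))\<^sup>2" using ab[of "cz p"] by (simp add: power2_diff)
    then show ?thesis using parts[of p] by linarith
  qed
  have dF: "(F has_derivative (\<lambda>h. 2 * (exp (cz p))\<^sup>2 * cz h * ((cx p)\<^sup>2 + 1) + (exp (cz p))\<^sup>2 * (2 * cx p * cx h)
      - 2 * (exp (- cz p))\<^sup>2 * cz h * ((cy p)\<^sup>2 + 1) + (exp (- cz p))\<^sup>2 * (2 * cy p * cy h))) (at p)" for p
    unfolding F_def[abs_def]
    by (auto intro!: derivative_eq_intros simp: algebra_simps power2_eq_square)
  have d1: "dd (Sol_E 1) F p = 2 * cx p * exp (cz p)" "dd (Sol_E 2) F p = 2 * cy p * exp (- cz p)"
    "dd (Sol_E 3) F p = 2 * (exp (cz p))\<^sup>2 * ((cx p)\<^sup>2 + 1) - 2 * (exp (- cz p))\<^sup>2 * ((cy p)\<^sup>2 + 1)" for p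
    unfolding dd_eqI[OF dF]
    using ab[of "cz p"] by (simp_all add: Sol_coord power2_eq_square algebra_simps)
  have d2: "dd (Sol_E 1) (dd (Sol_E 1) F) p = 2" "dd (Sol_E 2) (dd (Sol_E 2) F) p = 2"
    "dd (Sol_E 3) (dd (Sol_E 3) F) p = 4 * F p" for p
  proof -
    have D: "((\<lambda>p. 2 * cx p * exp (cz p)) has_derivative (\<lambda>h. 2 * cx h * exp (cz p) + 2 * cx p * exp (cz p) * cz h)) (at p)"
      "((\<lambda>p. 2 * cy p * exp (- cz p)) has_derivative (\<lambda>h. 2 * cy h * exp (- cz p) - 2 * cy p * exp (- cz p) * cz h)) (at p)"
      "((\<lambda>p. 2 * (exp (cz p))\<^sup>2 * ((cx p)\<^sup>2 + 1) - 2 * (exp (- cz p))\<^sup>2 * ((cy p)\<^sup>2 + 1)) has_derivative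
       (\<lambda>h. 4 * (exp (cz p))\<^sup>2 * cz h * ((cx p)\<^sup>2 + 1) + 2 * (exp (cz p))\<^sup>2 * (2 * cx p * cx h)
        + 4 * (exp (- cz p))\<^sup>2 * cz h * ((cy p)\<^sup>2 + 1) - 2 * (exp (- cz p))\<^sup>2 * (2 * cy p * cy h))) (at p)"
      by (auto intro!: derivative_eq_intros simp: algebra_simps power2_eq_square)
    show "dd (Sol_E 1) (dd (Sol_E 1) F) p = 2" "dd (Sol_E 2) (dd (Sol_E 2) F) p = 2"
      "dd (Sol_E 3) (dd (Sol_E 3) F) p = 4 * F p"
      using dd_cong[OF smooth_on_dd[OF sm smooth_Sol_E] UNIV_I d1(1), of "Sol_E 1" p]
        dd_cong[OF smooth_on_dd[OF sm smooth_Sol_E] UNIV_I d1(2), of "Sol_E 2" p]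
        dd_cong[OF smooth_on_dd[OF sm smooth_Sol_E] UNIV_I d1(3), of "Sol_E 3" p]
        dd_eqI[OF D(1), of "Sol_E 1"] dd_eqI[OF D(2), of "Sol_E 2"] dd_eqI[OF D(3), of "Sol_E 3"] ab[of "cz p"]
      by (simp_all add: Sol_coord F_def mult.commute[of "exp (- cz p)"])
  qed
  have one_le: "?v q \<ge> 1"
  \<comment> \<open>The constant 4 is dictated by the third direction, where the second derivative
    is exactly \<open>4 * F p\<close>.\<close>
  proof (rule minimum_principle[where M = UNIV and E = Sol_E and F = F and C = 4 and b = "\<lambda>i. 0"])
    show "smooth_on UNIV (Sol_E i)" for i by (rule smooth_Sol_E)
    show "smooth_on UNIV ?v" by (rule conformal_frame.smooth_v[OF cf])
    show "?v p > 0" for p by (rule conformal_frame.v_pos[OF cf UNIV_I])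
    show "smooth_on UNIV F" by (rule sm)
    show "F p \<ge> 1" for p using F1[of p] by simp
    show "compact {p \<in> UNIV. F p \<le> R}" for R
    proof -
      let ?K = "{-R..R} \<times> {-R..R} \<times> {-(R + 1)..R + 1}"
      let ?C = "{p. F p \<le> R}"
      have "?C \<subseteq> ?K"
      proof
        fix w assume "w \<in> ?C"
        then have FR: "F w \<le> R" by simp
        obtain x y z where w: "w = (x, y, z)" by (metis prod_cases3)
        let ?a = "exp z" and ?b = "exp (- z)"
        have le: "?a\<^sup>2 * x\<^sup>2 \<le> R" "?a\<^sup>2 \<le> R" "?b\<^sup>2 * y\<^sup>2 \<le> R" "?b\<^sup>2 \<le> R"
          using FR parts[of w] zero_le_power2[of ?a] zero_le_power2[of ?b]
          unfolding w fst_conv snd_conv by linarith+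
        have R: "0 \<le> R" using le(2) zero_le_power2[of ?a] by linarith
        have t: "\<bar>t\<bar> \<le> R" if "t\<^sup>2 \<le> R * R" for t
          using that R by (metis abs_le_square_iff abs_of_nonneg power2_eq_square)
        \<comment> \<open>Inserting e^z e^(-z) = 1 writes x^2 as a product of two quantities already
          bounded by R.\<close>
        have "x\<^sup>2 = (x * (?a * ?b))\<^sup>2" unfolding ab by simp
        also have "\<dots> = ?a\<^sup>2 * x\<^sup>2 * ?b\<^sup>2" by (simp only: power_mult_distrib mult_ac)
        also have "\<dots> \<le> R * R" using le R by (intro mult_mono) auto
        finally have x: "\<bar>x\<bar> \<le> R" by (rule t)
        have "y\<^sup>2 = (y * (?a * ?b))\<^sup>2" unfolding ab by simp
        also have "\<dots> = ?b\<^sup>2 * y\<^sup>2 * ?a\<^sup>2" by (simp only: power_mult_distrib mult_ac)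
        also have "\<dots> \<le> R * R" using le R by (intro mult_mono) auto
        finally have y: "\<bar>y\<bar> \<le> R" by (rule t)
        \<comment> \<open>Avoids logarithms: 1 + s is at most e^s, which is at most half of e^(2s) +
          1.\<close>
        have u: "s \<le> R" if "(exp s)\<^sup>2 \<le> R" for s :: real
        proof -
          have "0 \<le> (exp s - 1)\<^sup>2" by simp
          then have "2 * exp s \<le> (exp s)\<^sup>2 + 1" by (simp add: power2_diff)
          then have "2 * exp s \<le> R + 1" using that by simp
          then show ?thesis using exp_ge_add_one_self[of s] R by linarith
        qed
        have "\<bar>z\<bar> \<le> R + 1" using u[of z] u[of "- z"] le by simp
        then show "w \<in> ?K" using x y by (auto simp: w)
      qed
      moreover have "closed ?C" unfolding F_def by (intro closed_Collect_le continuous_intros)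
      moreover have "compact ?K" by (intro compact_Times compact_Icc)
      ultimately have "compact (?K \<inter> ?C)" "?C = ?K \<inter> ?C"
        by (blast intro: compact_Int_closed)+
      then show ?thesis by simp
    qed
    have quad: "\<bar>2 * s * c\<bar> \<le> c\<^sup>2 * s\<^sup>2 + 1" for s c :: real
    proof -
      have "0 \<le> (\<bar>s * c\<bar> - 1)\<^sup>2" by simp
      then show ?thesis by (simp add: power2_diff abs_mult power_mult_distrib algebra_simps)
    qed
    show "\<bar>dd (Sol_E i) F p\<bar> \<le> 4 * F p" for p i
    proof -
      have "0 \<le> (exp (cz p))\<^sup>2" "0 \<le> (exp (- cz p))\<^sup>2" by simp_all
      then have "\<bar>2 * cx p * exp (cz p)\<bar> \<le> 4 * F p" "\<bar>2 * cy p * exp (- cz p)\<bar> \<le> 4 * F p"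
        "\<bar>2 * (exp (cz p))\<^sup>2 * ((cx p)\<^sup>2 + 1) - 2 * (exp (- cz p))\<^sup>2 * ((cy p)\<^sup>2 + 1)\<bar> \<le> 4 * F p"
        using quad[of "cx p" "exp (cz p)"] quad[of "cy p" "exp (- cz p)"] parts[of p] F1[of p]
        unfolding ring_distribs mult_1_right mult.assoc by linarith+
      then show ?thesis using exhaust_3[of i] d1[of p] by (elim disjE) simp_all
    qed
    show "dd (Sol_E i) (dd (Sol_E i) F) p \<le> 4 * F p" for p i
      using exhaust_3[of i] d2[of p] F1[of p] by (elim disjE) simp_all
    show "(\<Sum>i\<in>UNIV. dd (Sol_E i) (dd (Sol_E i) ?v) p + 0 * dd (Sol_E i) ?v p)
        = (?v p - 1 / ?v p) / 2 + 3 / 2 * (\<Sum>i\<in>UNIV. (dd (Sol_E i) ?v p)\<^sup>2) / ?v p" for p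
      using Sol_Yamabe[OF cf UNIV_I, of p] by (simp add: sum_3)
  qed simp
  then show ?thesis using rsqrt_ge_1_iff[of f q] f by simp
qed

section \<open>From contraction to isometry\<close>

lemma smooth_map_on_open:
  assumes "open M" "smooth_map_on M \<phi>"
  shows "smooth_on M \<phi>"
proof (rule smooth_on_local)
  fix p assume "p \<in> M"
  then obtain W F where W: "open W" "p \<in> W" "smooth_on W F" "\<forall>q\<in>W \<inter> M. F q = \<phi> q"
    using assms(2) unfolding smooth_map_on_def by blast
  have "smooth_on (W \<inter> M) F" by (rule smooth_on_subset[OF W(3)]) (use W(1) assms(1) in auto)
  then have "smooth_on (W \<inter> M) \<phi>" by (rule smooth_on_cong) (use W(4) in auto)
  then show "\<exists>W. p \<in> W \<and> smooth_on W \<phi>" using W(2) \<open>p \<in> M\<close> by blast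
qed (rule assms(1))

text \<open>\<open>contr\<close> concerns all conformal self-maps of \<open>M\<close>, so it applies
  to \<open>\<phi>\<close> and to its inverse, whose factor is \<open>1 / f\<close> at the preimage
  by the chain rule.\<close>

lemma isometry_of_contracting:
  assumes M: "open M" and T: "\<And>p. T p = UNIV"
    and contr: "\<And>\<psi> h p. smooth_on M \<psi> \<Longrightarrow> (\<And>p. p \<in> M \<Longrightarrow> \<psi> p \<in> M) \<Longrightarrow> (\<And>p. p \<in> M \<Longrightarrow> h p > 0) \<Longrightarrow>
       (\<And>p u v. p \<in> M \<Longrightarrow> g (\<psi> p) (frechet_derivative \<psi> (at p) u) (frechet_derivative \<psi> (at p) v) = h p * g p u v)
       \<Longrightarrow> p \<in> M \<Longrightarrow> h p \<le> (1::real)"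
    and conf: "conformal_diffeo M T g \<phi>"
  shows "isometry_of M T g \<phi>"
proof -
  let ?\<psi> = "inv_into M \<phi>"
  have D: "diffeo_on M \<phi>" using conf by (simp add: conformal_diffeo_def)
  then have bij: "bij_betw \<phi> M M" and s: "smooth_on M \<phi>" "smooth_on M ?\<psi>"
    using smooth_map_on_open[OF M] by (auto simp: diffeo_on_def)
  have md: "mdiff M \<theta> p = frechet_derivative \<theta> (at p)" if "p \<in> M" for p \<theta>
    by (simp add: mdiff_def at_within_open[OF that M])
  obtain f where f0: "\<forall>p\<in>M. f p > 0"
    "\<forall>p\<in>M. \<forall>u\<in>T p. \<forall>v\<in>T p. g (\<phi> p) (mdiff M \<phi> p u) (mdiff M \<phi> p v) = f p * g p u v"
    using conf unfolding conformal_diffeo_def by blast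
  have f: "\<And>p. p \<in> M \<Longrightarrow> f p > 0" and
    fc: "\<And>p u v. p \<in> M \<Longrightarrow> g (\<phi> p) (frechet_derivative \<phi> (at p) u) (frechet_derivative \<phi> (at p) v) = f p * g p u v"
    using f0 md by (simp_all add: T)
  have in1: "\<phi> p \<in> M" "?\<psi> p \<in> M" "\<phi> (?\<psi> p) = p" "?\<psi> (\<phi> p) = p" if "p \<in> M" for p
    using bij that by (auto simp: bij_betw_def f_inv_into_f inv_into_into)
  have chain: "frechet_derivative \<phi> (at (?\<psi> p)) (frechet_derivative ?\<psi> (at p) u) = u" if p: "p \<in> M" for p u
  proof -
    have "((\<lambda>x. \<phi> (?\<psi> x)) has_derivative (\<lambda>u. frechet_derivative \<phi> (at (?\<psi> p)) (frechet_derivative ?\<psi> (at p) u))) (at p)"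
      using has_derivative_compose[OF smooth_on_has_derivative[OF s(2) p] smooth_on_has_derivative[OF s(1) in1(2)[OF p]]] .
    moreover have "((\<lambda>x. \<phi> (?\<psi> x)) has_derivative (\<lambda>u. u)) (at p)"
      by (rule has_derivative_transform_within_open[OF has_derivative_ident M p]) (simp add: in1)
    ultimately have "(\<lambda>u. frechet_derivative \<phi> (at (?\<psi> p)) (frechet_derivative ?\<psi> (at p) u)) = (\<lambda>u. u)"
      by (rule has_derivative_unique)
    then show ?thesis by metis
  qed
  have le: "f p \<le> 1" if "p \<in> M" for p
    by (rule contr[OF s(1) in1(1) f fc that])
  have ge: "1 / f (?\<psi> p) \<le> 1" if "p \<in> M" for p
  proof (rule contr[where h = "\<lambda>p. 1 / f (?\<psi> p)", OF s(2) in1(2) _ _ that])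
    fix p u v assume p: "p \<in> M"
    show "0 < 1 / f (?\<psi> p)" using f[OF in1(2)[OF p]] by simp
    show "g (?\<psi> p) (frechet_derivative ?\<psi> (at p) u) (frechet_derivative ?\<psi> (at p) v) = 1 / f (?\<psi> p) * g p u v"
      using fc[OF in1(2)[OF p], of "frechet_derivative ?\<psi> (at p) u" "frechet_derivative ?\<psi> (at p) v"]
        f[OF in1(2)[OF p]] by (simp add: chain[OF p] in1[OF p] field_simps)
  qed
  have "f p = 1" if "p \<in> M" for p
    using le[OF that] ge[OF in1(1)[OF that]] f[OF that] in1(4)[OF that] by (simp add: field_simps)
  then show ?thesis using D fc md by (simp add: isometry_of_def)
qed

lemma H2R_isometry:
  assumes "conformal_diffeo H2R H2R_T H2R_g \<phi>"
  shows "isometry_of H2R H2R_T H2R_g \<phi>"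
proof (rule isometry_of_contracting[OF open_H2R _ _ assms])
  show "H2R_T p = UNIV" for p by (simp add: H2R_T_def)
qed (rule H2R_contracting)

lemma Sol_isometry:
  assumes "conformal_diffeo Sol Sol_T Sol_g \<phi>"
  shows "isometry_of Sol Sol_T Sol_g \<phi>"
proof (rule isometry_of_contracting[OF _ _ _ assms])
  show "Sol_T p = UNIV" for p by (simp add: Sol_T_def)
qed (auto simp: Sol_def intro: Sol_contracting)

subsection \<open>Conformal maps of punctured Euclidean space\<close>

text \<open>The constant frame \<open>e\<close> is kept arbitrary because the Hessian argument
  compares several rotated frames.\<close>

lemma flat_conformal_frame:
  fixes \<Psi> :: "real \<times> real \<times> real \<Rightarrow> real \<times> real \<times> real" and e :: "3 \<Rightarrow> real \<times> real \<times> real"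
  assumes \<Psi>: "smooth_on M \<Psi>" and f: "\<And>p. p \<in> M \<Longrightarrow> f p > 0"
    and conf: "\<And>p u v. p \<in> M \<Longrightarrow> frechet_derivative \<Psi> (at p) u \<bullet> frechet_derivative \<Psi> (at p) v = f p * (u \<bullet> v)"
    and e: "\<And>i j. e i \<bullet> e j = (if i = j then 1 else 0)"
  shows "conformal_frame M (\<lambda>i _. e i) (\<lambda>_ _ _. 0) (\<lambda>_ _. 0) (\<lambda>i. dd (\<lambda>_. e i) \<Psi>) f"
proof (rule conformal_frame.intro)
  have M: "open M" using \<Psi> by (rule smooth_on_open)
  fix i j k :: 3 and p x y z :: "real \<times> real \<times> real"
  show "open M" by (rule M)
  show "smooth_on M (\<lambda>_. e i)" by (rule smooth_on_const[OF M])
  show "bounded_bilinear (\<lambda>(_ :: real \<times> real \<times> real) (_ :: real \<times> real \<times> real). 0 :: real \<times> real \<times> real)"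
    by (rule bounded_bilinear.intro) (auto intro!: exI[of _ 0])
  show "smooth_on M (dd (\<lambda>_. e i) \<Psi>)" by (intro smooth_on_dd \<Psi> smooth_on_const M)
  show "CARD(3) = DIM(real \<times> real \<times> real)" by simp
  assume p: "p \<in> M"
  show "f p > 0" by (rule f[OF p])
  show "dd (\<lambda>_. e i) \<Psi> p \<bullet> dd (\<lambda>_. e j) \<Psi> p = (if i = j then f p else 0)"
    unfolding dd_def conf[OF p] e by simp
  show "dd (\<lambda>_. e i) (dd (\<lambda>_. e j) \<Psi>) p + 0 - (dd (\<lambda>_. e j) (dd (\<lambda>_. e i) \<Psi>) p + 0)
      = (\<Sum>k\<in>UNIV. (0 - 0) *\<^sub>R dd (\<lambda>_. e k) \<Psi> p)"
    using dd_commute[OF \<Psi> smooth_on_const[OF M] smooth_on_const[OF M] p, of "e i" "e j"]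
      linear_0[OF has_derivative_linear[OF smooth_on_has_derivative[OF \<Psi> p]]] by simp
qed simp_all

text \<open>The vanishing curvature component with indices k, i, j, i gives \<open>3 / 2\<close>
  times the product of first derivatives over f for the mixed derivative of f, which is exactly a
  zero mixed derivative of v. The auxiliary direction \<open>i\<close> is where dimension three
  enters.\<close>

lemma flat_second_derivative:
  assumes "conformal_frame M E (\<lambda>_ _ _. 0) (\<lambda>_ _. 0) A f" and p: "p \<in> M"
    and ijk: "i \<noteq> j" "j \<noteq> k" "i \<noteq> (k :: 3)"
  shows "dd (E k) (dd (E j) (rsqrt f)) p = 0"
proof -
  interpret conformal_frame M E "\<lambda>_ _ _. 0" "\<lambda>_ _. 0" A f by fact
  have "dd (E k) (dd (E j) f) p = 3 / 2 * dd (E j) f p * dd (E k) f p / f p"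
    using curvature_identity[OF p, of k i j i] ijk exhaust_3[of i] exhaust_3[of j] exhaust_3[of k] f_pos[OF p]
    unfolding R_def
    by (elim disjE) (simp_all add: sum_3 dd_G[OF p] G_def field_simps)
  then have "- 2 * dd (E k) (dd (E j) v) p / v p ^ 3 = 0"
    unfolding dd_f[OF p] dd_dd_f[OF p] f_rsqrt[OF p] using v_pos[OF p]
    by (simp add: field_simps eval_nat_numeral)
  then show ?thesis using v_pos[OF p] by simp
qed

lemma flat_Yamabe:
  fixes E :: "3 \<Rightarrow> _"
  assumes "conformal_frame M E (\<lambda>_ _ _. 0) (\<lambda>_ _. 0) A f" and p: "p \<in> M"
  defines "v \<equiv> rsqrt f"
  shows "dd (E 1) (dd (E 1) v) p + dd (E 2) (dd (E 2) v) p + dd (E 3) (dd (E 3) v) p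
    = 3 / 2 * ((dd (E 1) v p)\<^sup>2 + (dd (E 2) v p)\<^sup>2 + (dd (E 3) v p)\<^sup>2) / v p"
proof -
  interpret conformal_frame M E "\<lambda>_ _ _. 0" "\<lambda>_ _. 0" A f by fact
  have "R (A 1 p) (A 2 p) (A 2 p) \<bullet> A 1 p + R (A 1 p) (A 3 p) (A 3 p) \<bullet> A 1 p + R (A 2 p) (A 3 p) (A 3 p) \<bullet> A 2 p = 0"
    by (simp add: R_def)
  then have eq: "dd (E 1) (dd (E 1) f) p + dd (E 2) (dd (E 2) f) p + dd (E 3) (dd (E 3) f) p
    = 3 / 4 * ((dd (E 1) f p)\<^sup>2 + (dd (E 2) f p)\<^sup>2 + (dd (E 3) f p)\<^sup>2) / f p"
    unfolding curvature_identity[OF p, symmetric]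
    using f_pos[OF p]
    by (simp add: sum_3 dd_G[OF p] G_def)
       (simp add: power2_eq_square add_divide_distrib diff_divide_distrib algebra_simps)
  define w where "w = local.v p"
  have w: "w > 0" using v_pos[OF p] by (simp add: w_def)
  show ?thesis
    using Yamabe_substitution[OF w, where k = 0 and N = "(dd (E 1) v p)\<^sup>2 + (dd (E 2) v p)\<^sup>2 + (dd (E 3) v p)\<^sup>2"
      and L = "dd (E 1) (dd (E 1) v) p + dd (E 2) (dd (E 2) v) p + dd (E 3) (dd (E 3) v) p"]
      eq w
    unfolding dd_f[OF p] dd_dd_f[OF p] f_rsqrt[OF p] v_def w_def[symmetric]
    by (simp add: power2_eq_square eval_nat_numeral add_divide_distrib diff_divide_distrib algebra_simps)
qed

abbreviation (input) b1 :: "real \<times> real \<times> real" where "b1 \<equiv> (1, 0, 0)"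
abbreviation (input) b2 :: "real \<times> real \<times> real" where "b2 \<equiv> (0, 1, 0)"
abbreviation (input) b3 :: "real \<times> real \<times> real" where "b3 \<equiv> (0, 0, 1)"

lemma dd_combination:
  assumes "smooth_on M F" "p \<in> M"
  shows "dd (\<lambda>_. s *\<^sub>R a + t *\<^sub>R b) F p = s *\<^sub>R dd (\<lambda>_. a) F p + t *\<^sub>R dd (\<lambda>_. b) F p"
  using has_derivative_linear[OF smooth_on_has_derivative[OF assms]]
  by (simp add: dd_def linear_add linear_scale)

lemma constant_on_connected:
  fixes F :: "real \<times> real \<times> real \<Rightarrow> 'b::real_normed_vector"
  assumes F: "smooth_on M F" and M: "connected M"
    and z: "\<And>p. p \<in> M \<Longrightarrow> dd (\<lambda>_. b1) F p = 0" "\<And>p. p \<in> M \<Longrightarrow> dd (\<lambda>_. b2) F p = 0" "\<And>p. p \<in> M \<Longrightarrow> dd (\<lambda>_. b3) F p = 0"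
    and xy: "x \<in> M" "y \<in> M"
  shows "F x = F y"
proof (rule has_derivative_zero_unique_connected[OF smooth_on_open[OF F] M _ xy])
  fix p assume p: "p \<in> M"
  have "frechet_derivative F (at p) h = 0" for h
  proof -
    have L: "linear (frechet_derivative F (at p))"
      by (rule has_derivative_linear[OF smooth_on_has_derivative[OF F p]])
    have "h = cx h *\<^sub>R b1 + cy h *\<^sub>R b2 + cz h *\<^sub>R b3" by (cases h) simp
    then have "frechet_derivative F (at p) h = frechet_derivative F (at p) (cx h *\<^sub>R b1 + cy h *\<^sub>R b2 + cz h *\<^sub>R b3)" by simp
    also have "\<dots> = cx h *\<^sub>R dd (\<lambda>_. b1) F p + cy h *\<^sub>R dd (\<lambda>_. b2) F p + cz h *\<^sub>R dd (\<lambda>_. b3) F p"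
      unfolding dd_def by (simp only: linear_add[OF L] linear_scale[OF L])
    finally show ?thesis using z p by simp
  qed
  then have "frechet_derivative F (at p) = (\<lambda>h. 0)" by blast
  then show "(F has_derivative (\<lambda>x. 0)) (at p)"
    using smooth_on_has_derivative[OF F p] by simp
qed

text \<open>Mixed derivatives vanish in every orthonormal frame, and a symmetric form that is
  diagonal in all of them is a multiple of the identity. The 3-4-5 triangle supplies a rotation with
  rational entries that suffices.\<close>

lemma Liouville_Hessian:
  fixes \<Psi> :: "real \<times> real \<times> real \<Rightarrow> real \<times> real \<times> real"
  assumes \<Psi>: "smooth_on M \<Psi>" and f: "\<And>p. p \<in> M \<Longrightarrow> f p > 0"
    and conf: "\<And>p u v. p \<in> M \<Longrightarrow> frechet_derivative \<Psi> (at p) u \<bullet> frechet_derivative \<Psi> (at p) v = f p * (u \<bullet> v)"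
    and p: "p \<in> M"
  defines "v \<equiv> rsqrt f"
  shows "dd (\<lambda>_. b1) (dd (\<lambda>_. b2) v) p = 0" "dd (\<lambda>_. b1) (dd (\<lambda>_. b3) v) p = 0" "dd (\<lambda>_. b2) (dd (\<lambda>_. b3) v) p = 0"
    "dd (\<lambda>_. b1) (dd (\<lambda>_. b1) v) p = dd (\<lambda>_. b2) (dd (\<lambda>_. b2) v) p"
    "dd (\<lambda>_. b2) (dd (\<lambda>_. b2) v) p = dd (\<lambda>_. b3) (dd (\<lambda>_. b3) v) p"
    "dd (\<lambda>_. b1) (dd (\<lambda>_. b1) v) p + dd (\<lambda>_. b2) (dd (\<lambda>_. b2) v) p + dd (\<lambda>_. b3) (dd (\<lambda>_. b3) v) p
    = 3 / 2 * ((dd (\<lambda>_. b1) v p)\<^sup>2 + (dd (\<lambda>_. b2) v p)\<^sup>2 + (dd (\<lambda>_. b3) v p)\<^sup>2) / v p"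
proof -
  have M: "open M" using \<Psi> by (rule smooth_on_open)
  define fr where "fr a b c i = (if i = 1 then a else if i = 2 then b else c)" for a b c :: "real \<times> real \<times> real" and i :: 3
  have cf: "conformal_frame M (\<lambda>i _. fr a b c i) (\<lambda>_ _ _. 0) (\<lambda>_ _. 0) (\<lambda>i. dd (\<lambda>_. fr a b c i) \<Psi>) f"
    if "a \<bullet> a = 1" "b \<bullet> b = 1" "c \<bullet> c = 1" "a \<bullet> b = 0" "a \<bullet> c = 0" "b \<bullet> c = 0" for a b c
  proof (rule flat_conformal_frame[OF \<Psi> f conf])
    show "fr a b c i \<bullet> fr a b c j = (if i = j then 1 else 0)" for i j
      using exhaust_3[of i] exhaust_3[of j] that by (elim disjE) (simp_all add: fr_def inner_commute)
  qed
  have fr: "fr a b c 1 = a" "fr a b c 2 = b" "fr a b c 3 = c" for a b c by (simp_all add: fr_def)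
  have orth: "dd (\<lambda>_. a) (dd (\<lambda>_. b) v) p = 0"
    if "a \<bullet> a = 1" "b \<bullet> b = 1" "c \<bullet> c = 1" "a \<bullet> b = 0" "a \<bullet> c = 0" "b \<bullet> c = 0" for a b c
    using flat_second_derivative[OF cf[OF that] p, of 3 2 1] by (simp add: fr v_def)
  have std: "conformal_frame M (\<lambda>i _. fr b1 b2 b3 i) (\<lambda>_ _ _. 0) (\<lambda>_ _. 0) (\<lambda>i. dd (\<lambda>_. fr b1 b2 b3 i) \<Psi>) f"
    by (rule cf) simp_all
  have v: "smooth_on M v" unfolding v_def by (rule conformal_frame.smooth_v[OF std])
  have vb: "smooth_on M (dd (\<lambda>_. b) v)" for b by (intro smooth_on_dd v smooth_on_const M)
  have dd2: "dd (\<lambda>_. x) (dd (\<lambda>_. s *\<^sub>R a + t *\<^sub>R b) v) p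
     = s * dd (\<lambda>_. x) (dd (\<lambda>_. a) v) p + t * dd (\<lambda>_. x) (dd (\<lambda>_. b) v) p" for x s a t b
  proof -
    have "dd (\<lambda>_. x) (dd (\<lambda>_. s *\<^sub>R a + t *\<^sub>R b) v) p = dd (\<lambda>_. x) (\<lambda>q. s *\<^sub>R dd (\<lambda>_. a) v q + t *\<^sub>R dd (\<lambda>_. b) v q) p"
      by (rule dd_cong[OF vb p dd_combination[OF v]])
    also have "\<dots> = s * dd (\<lambda>_. x) (dd (\<lambda>_. a) v) p + t * dd (\<lambda>_. x) (dd (\<lambda>_. b) v) p"
      using dd_add[OF smooth_on_scaleR[OF smooth_on_const[OF M] vb] smooth_on_scaleR[OF smooth_on_const[OF M] vb] p]
        dd_scaleR[OF smooth_on_const[OF M] vb p] by simp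
    finally show ?thesis .
  qed
  have sym: "dd (\<lambda>_. x) (dd (\<lambda>_. y) v) p = dd (\<lambda>_. y) (dd (\<lambda>_. x) v) p" for x y
    unfolding dd_def by (rule second_derivative_commute[OF v p])
  \<comment> \<open>the Hessian also vanishes on the rotated orthogonal pair \<open>(3a + 4b)/5, (4a - 3b)/5\<close>\<close>
  have diag: "dd (\<lambda>_. a) (dd (\<lambda>_. a) v) p = dd (\<lambda>_. b) (dd (\<lambda>_. b) v) p"
    if "a \<bullet> a = 1" "b \<bullet> b = 1" "c \<bullet> c = 1" "a \<bullet> b = 0" "a \<bullet> c = 0" "b \<bullet> c = 0" for a b c
  proof -
    let ?x = "(3/5) *\<^sub>R a + (4/5) *\<^sub>R b" and ?y = "(4/5) *\<^sub>R a + (- 3/5) *\<^sub>R b"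
    have "dd (\<lambda>_. ?x) (dd (\<lambda>_. ?y) v) p = 0"
      by (rule orth[of _ _ c])
         (use that in \<open>simp_all add: inner_add_left inner_add_right inner_diff_left inner_diff_right inner_commute[of b a]\<close>)
    then have "(4/5) * ((3/5) * dd (\<lambda>_. a) (dd (\<lambda>_. a) v) p + (4/5) * dd (\<lambda>_. b) (dd (\<lambda>_. a) v) p)
      + (- 3/5) * ((3/5) * dd (\<lambda>_. a) (dd (\<lambda>_. b) v) p + (4/5) * dd (\<lambda>_. b) (dd (\<lambda>_. b) v) p) = 0"
      unfolding dd2 dd_combination[OF vb p] by simp
    moreover have "dd (\<lambda>_. a) (dd (\<lambda>_. b) v) p = 0" by (rule orth[OF that])
    ultimately show ?thesis using sym[of a b] by simp
  qed
  show "dd (\<lambda>_. b1) (dd (\<lambda>_. b2) v) p = 0" by (rule orth[of _ _ b3]) simp_all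
  show "dd (\<lambda>_. b1) (dd (\<lambda>_. b3) v) p = 0" by (rule orth[of _ _ b2]) simp_all
  show "dd (\<lambda>_. b2) (dd (\<lambda>_. b3) v) p = 0" by (rule orth[of _ _ b1]) simp_all
  show "dd (\<lambda>_. b1) (dd (\<lambda>_. b1) v) p = dd (\<lambda>_. b2) (dd (\<lambda>_. b2) v) p" by (rule diag[of _ _ b3]) simp_all
  show "dd (\<lambda>_. b2) (dd (\<lambda>_. b2) v) p = dd (\<lambda>_. b3) (dd (\<lambda>_. b3) v) p" by (rule diag[of _ _ b1]) simp_all
  show "dd (\<lambda>_. b1) (dd (\<lambda>_. b1) v) p + dd (\<lambda>_. b2) (dd (\<lambda>_. b2) v) p + dd (\<lambda>_. b3) (dd (\<lambda>_. b3) v) p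
    = 3 / 2 * ((dd (\<lambda>_. b1) v p)\<^sup>2 + (dd (\<lambda>_. b2) v p)\<^sup>2 + (dd (\<lambda>_. b3) v p)\<^sup>2) / v p"
    using flat_Yamabe[OF std p] by (simp add: fr v_def)
qed

abbreviation (input) punctured :: "(real \<times> real \<times> real) set" where "punctured \<equiv> - {0}"

lemma connected_punctured: "connected punctured"
  by (rule connected_punctured_universe) simp

lemma open_punctured: "open punctured"
  by (simp add: open_Compl)

lemma Liouville_dichotomy:
  fixes v :: "real \<times> real \<times> real \<Rightarrow> real"
  assumes v: "smooth_on punctured v" and v_pos: "\<And>p. p \<in> punctured \<Longrightarrow> v p > 0"
    and off: "\<And>p. p \<in> punctured \<Longrightarrow> dd (\<lambda>_. b1) (dd (\<lambda>_. b2) v) p = 0"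
      "\<And>p. p \<in> punctured \<Longrightarrow> dd (\<lambda>_. b1) (dd (\<lambda>_. b3) v) p = 0"
      "\<And>p. p \<in> punctured \<Longrightarrow> dd (\<lambda>_. b2) (dd (\<lambda>_. b3) v) p = 0"
    and diag: "\<And>p. p \<in> punctured \<Longrightarrow> dd (\<lambda>_. b1) (dd (\<lambda>_. b1) v) p = dd (\<lambda>_. b2) (dd (\<lambda>_. b2) v) p"
      "\<And>p. p \<in> punctured \<Longrightarrow> dd (\<lambda>_. b2) (dd (\<lambda>_. b2) v) p = dd (\<lambda>_. b3) (dd (\<lambda>_. b3) v) p"
    and Yamabe: "\<And>p. p \<in> punctured \<Longrightarrow>
       dd (\<lambda>_. b1) (dd (\<lambda>_. b1) v) p + dd (\<lambda>_. b2) (dd (\<lambda>_. b2) v) p + dd (\<lambda>_. b3) (dd (\<lambda>_. b3) v) p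
       = 3 / 2 * ((dd (\<lambda>_. b1) v p)\<^sup>2 + (dd (\<lambda>_. b2) v p)\<^sup>2 + (dd (\<lambda>_. b3) v p)\<^sup>2) / v p"
  shows "(\<exists>c>0. \<forall>p\<in>punctured. v p = c) \<or> (\<exists>c>0. \<forall>p\<in>punctured. v p = c * (p \<bullet> p))"
proof -
  let ?M = punctured
  let ?D = "\<lambda>a. dd (\<lambda>_. a)"
  note M = open_punctured
  have sD: "smooth_on ?M (?D a F)" if "smooth_on ?M F" for a and F :: "_ \<Rightarrow> real"
    by (intro smooth_on_dd that smooth_on_const M)
  have comm: "?D a (?D b F) p = ?D b (?D a F) p" if "smooth_on ?M F" "p \<in> ?M" for a b p and F :: "_ \<Rightarrow> real"
    unfolding dd_def by (rule second_derivative_commute[OF that])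
  have off': "?D b2 (?D b1 v) p = 0" "?D b3 (?D b1 v) p = 0" "?D b3 (?D b2 v) p = 0" if "p \<in> ?M" for p
    using off[OF that] comm[OF v that] by metis+
  define r where "r = ?D b1 (?D b1 v)"
  have sr: "smooth_on ?M r" unfolding r_def by (intro sD v)
  have r2: "r p = ?D b2 (?D b2 v) p" "r p = ?D b3 (?D b3 v) p" if "p \<in> ?M" for p
    using diag[OF that] by (simp_all add: r_def)
  \<comment> \<open>To differentiate the common diagonal entry \<open>r\<close> in direction
    \<open>b\<close>, write it with another axis \<open>a\<close> and commute: the derivative falls
    on a vanishing mixed derivative.\<close>
  have swap: "?D b r p = 0"
    if "\<And>q. q \<in> ?M \<Longrightarrow> r q = ?D a (?D a v) q" "\<And>q. q \<in> ?M \<Longrightarrow> ?D b (?D a v) q = 0" and p: "p \<in> ?M" for a b p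
  proof -
    have "?D b r p = ?D b (?D a (?D a v)) p" by (rule dd_cong[OF sr p that(1)])
    also have "\<dots> = ?D a (?D b (?D a v)) p" by (rule comm[OF sD[OF v] p])
    also have "\<dots> = ?D a (\<lambda>_. 0) p" by (rule dd_cong[OF sD[OF sD[OF v]] p that(2)])
    finally show ?thesis by simp
  qed
  obtain \<rho> where \<rho>: "\<And>p. p \<in> ?M \<Longrightarrow> r p = \<rho>"
  proof -
    have b1M: "b1 \<in> ?M" by (simp add: zero_prod_def)
    have "r p = r b1" if "p \<in> ?M" for p
    proof (rule constant_on_connected[OF sr connected_punctured _ _ _ that b1M])
      fix p assume p: "p \<in> ?M"
      show "?D b1 r p = 0" by (rule swap[OF r2(1) off(1) p])
      show "?D b2 r p = 0" by (rule swap[OF r2(2) off(3) p])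
      show "?D b3 r p = 0" by (rule swap[OF r2(1) off'(3) p])
    qed
    then show ?thesis by (rule that)
  qed
  have lin: "smooth_on ?M (\<lambda>p. \<rho> * (p \<bullet> b))" for b
    by (intro smooth_on_mult smooth_on_const M smooth_on_inner smooth_on_bounded_linear[OF bounded_linear_ident])
  have dlin: "?D a (\<lambda>p. \<rho> * (p \<bullet> b)) p = \<rho> * (a \<bullet> b)" for a b p
    by (rule dd_eqI) (auto intro!: derivative_eq_intros)
  have grad: "\<exists>c. \<forall>p\<in>?M. ?D b v p = \<rho> * (p \<bullet> b) + c"
    if z: "\<And>p. p \<in> ?M \<Longrightarrow> ?D b1 (?D b v) p = \<rho> * (b1 \<bullet> b)" "\<And>p. p \<in> ?M \<Longrightarrow> ?D b2 (?D b v) p = \<rho> * (b2 \<bullet> b)"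
      "\<And>p. p \<in> ?M \<Longrightarrow> ?D b3 (?D b v) p = \<rho> * (b3 \<bullet> b)" for b
  proof -
    let ?F = "\<lambda>p. ?D b v p - \<rho> * (p \<bullet> b)"
    have F: "smooth_on ?M ?F" by (intro smooth_on_diff sD v lin)
    have dF: "?D a ?F p = ?D a (?D b v) p - \<rho> * (a \<bullet> b)" if "p \<in> ?M" for a p
    proof -
      have "?D a (\<lambda>p. ?F p + \<rho> * (p \<bullet> b)) p = ?D a ?F p + \<rho> * (a \<bullet> b)"
        using dd_add[OF F lin[of b] that, of "\<lambda>_. a"] by (simp add: dlin)
      then show ?thesis by simp
    qed
    have b1M: "b1 \<in> ?M" by (simp add: zero_prod_def)
    have "?F p = ?F b1" if "p \<in> ?M" for p
      by (rule constant_on_connected[OF F connected_punctured _ _ _ that b1M]) (simp_all only: dF z diff_self)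
    then show ?thesis by (intro exI[of _ "?F b1"]) (simp add: algebra_simps)
  qed
  have rr: "?D b1 (?D b1 v) p = \<rho>" "?D b2 (?D b2 v) p = \<rho>" "?D b3 (?D b3 v) p = \<rho>" if "p \<in> ?M" for p
    using r2[OF that] \<rho>[OF that] by (simp_all add: r_def)
  obtain c1 where c1: "\<forall>p\<in>?M. ?D b1 v p = \<rho> * (p \<bullet> b1) + c1" using grad[of b1] rr off off' by auto
  obtain c2 where c2: "\<forall>p\<in>?M. ?D b2 v p = \<rho> * (p \<bullet> b2) + c2" using grad[of b2] rr off off' by auto
  obtain c3 where c3: "\<forall>p\<in>?M. ?D b3 v p = \<rho> * (p \<bullet> b3) + c3" using grad[of b3] rr off off' by auto
  let ?c = "(c1, c2, c3)"
  have main: "2 * \<rho> * v p = (\<rho> *\<^sub>R p + ?c) \<bullet> (\<rho> *\<^sub>R p + ?c)" if p: "p \<in> ?M" for p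
  proof -
    have "3 * \<rho> = 3 / 2 * ((\<rho> *\<^sub>R p + ?c) \<bullet> (\<rho> *\<^sub>R p + ?c)) / v p"
      using Yamabe[OF p] rr[OF p] c1 c2 c3 p
      by (cases p) (simp add: power2_eq_square add.assoc)
    then show ?thesis using v_pos[OF p] by (simp add: field_simps)
  qed
  have b1M: "b1 \<in> ?M" by (simp add: zero_prod_def)
  show ?thesis
  proof (cases "\<rho> = 0")
    case True
    then have "?c \<bullet> ?c = 0" using main[OF b1M] by simp
    then have "?c = 0" by (simp only: inner_eq_zero_iff)
    then have c: "c1 = 0" "c2 = 0" "c3 = 0" by (simp_all add: zero_prod_def)
    have "v p = v b1" if "p \<in> ?M" for p
      by (rule constant_on_connected[OF v connected_punctured _ _ _ that b1M]) (use c1 c2 c3 c True in auto)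
    then show ?thesis using v_pos[OF b1M] by blast
  next
    case False
    have "?c = 0"
    proof (rule ccontr)
      assume "?c \<noteq> 0"
      \<comment> \<open>The zero of the gradient \<rho> p + c; off the origin it would force v = 0
        there.\<close>
      then have q: "- (1 / \<rho>) *\<^sub>R ?c \<in> ?M" using False by (simp add: zero_prod_def)
      have "\<rho> *\<^sub>R (- (1 / \<rho>) *\<^sub>R ?c) + ?c = 0" using False by (simp add: zero_prod_def)
      then have "2 * \<rho> * v (- (1 / \<rho>) *\<^sub>R ?c) = 0" using main[OF q] by (simp only: inner_zero_left)
      then show False using v_pos[OF q] False by simp
    qed
    then have "2 * \<rho> * v p = \<rho> * \<rho> * (p \<bullet> p)" if "p \<in> ?M" for p using main[OF that] by (simp add: mult.assoc)
    then have eq: "v p = \<rho> / 2 * (p \<bullet> p)" if "p \<in> ?M" for p using that False by (simp add: field_simps)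
    have "\<rho> > 0" using eq[OF b1M] v_pos[OF b1M] by simp
    then show ?thesis using eq by (intro disjI2 exI[of _ "\<rho> / 2"]) simp
  qed
qed

text \<open>A constant factor makes all second derivatives vanish, so the map is affine, L p + b
  with L a multiple of an orthogonal map. The affine extension has a zero; as the map omits 0 on the
  punctured space, that zero is the origin and b = 0.\<close>

lemma homothety_norm:
  fixes \<Psi> :: "real \<times> real \<times> real \<Rightarrow> real \<times> real \<times> real"
  assumes \<Psi>: "smooth_on punctured \<Psi>" and nz: "\<And>p. p \<in> punctured \<Longrightarrow> \<Psi> p \<noteq> 0" and k: "k > 0"
    and conf: "\<And>p u v. p \<in> punctured \<Longrightarrow> frechet_derivative \<Psi> (at p) u \<bullet> frechet_derivative \<Psi> (at p) v = k * (u \<bullet> v)"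
    and x: "x \<in> punctured"
  shows "\<Psi> x \<bullet> \<Psi> x = k * (x \<bullet> x)"
proof -
  let ?M = punctured
  note M = open_punctured
  define e where "e i = (if i = 1 then b1 else if i = 2 then b2 else b3)" for i :: 3
  have e: "e i \<bullet> e j = (if i = j then 1 else 0)" for i j
    using exhaust_3[of i] exhaust_3[of j] by (elim disjE) (simp_all add: e_def)
  have cf: "conformal_frame ?M (\<lambda>i _. e i) (\<lambda>_ _ _. 0) (\<lambda>_ _. 0) (\<lambda>i. dd (\<lambda>_. e i) \<Psi>) (\<lambda>_. k)"
    by (rule flat_conformal_frame[OF \<Psi> _ _ e]) (use k conf in auto)
  interpret conformal_frame ?M "\<lambda>i _. e i" "\<lambda>_ _ _. 0" "\<lambda>_ _. 0" "\<lambda>i. dd (\<lambda>_. e i) \<Psi>" "\<lambda>_. k" by (rule cf)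
  have z: "dd (\<lambda>_. e i) (dd (\<lambda>_. e j) \<Psi>) p = 0" if p: "p \<in> ?M" for i j p
  proof -
    have "nab i (dd (\<lambda>_. e j) \<Psi>) p \<bullet> dd (\<lambda>_. e m) \<Psi> p = 0" for m
      unfolding nab_A_inner[OF p] G_def by simp
    then have "nab i (dd (\<lambda>_. e j) \<Psi>) p \<bullet> nab i (dd (\<lambda>_. e j) \<Psi>) p = 0"
      by (subst inner_expand[OF p]) simp
    then show ?thesis by (simp add: nab_def)
  qed
  have b1M: "b1 \<in> ?M" by (simp add: zero_prod_def)
  define L where "L j = dd (\<lambda>_. e j) \<Psi> b1" for j
  have L: "dd (\<lambda>_. e j) \<Psi> p = L j" if "p \<in> ?M" for p j
    unfolding L_def
    by (rule constant_on_connected[OF smooth_A connected_punctured _ _ _ that b1M])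
       (use z[of _ 1] z[of _ 2] z[of _ 3] in \<open>simp_all add: e_def\<close>)
  let ?L = "\<lambda>p. cx p *\<^sub>R L 1 + cy p *\<^sub>R L 2 + cz p *\<^sub>R L 3"
  have sL: "smooth_on ?M (\<lambda>p. - ?L p)"
    by (intro smooth_on_minus smooth_on_add smooth_on_scaleR smooth_coord smooth_on_const M)
  have "((\<lambda>p. - ?L p) has_derivative (\<lambda>h. - ?L h)) (at p)" for p
    by (auto intro!: derivative_eq_intros)
  then have dL: "dd E (\<lambda>p. - ?L p) p = - ?L (E p)" for E p by (rule dd_eqI)
  define b where "b = \<Psi> b1 - ?L b1"
  have \<Psi>_eq: "\<Psi> p = ?L p + b" if p: "p \<in> ?M" for p
  proof -
    have "\<Psi> p + - ?L p = \<Psi> b1 + - ?L b1"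
    proof (rule constant_on_connected[OF smooth_on_add[OF \<Psi> sL] connected_punctured _ _ _ p b1M])
      fix p assume p: "p \<in> ?M"
      show "dd (\<lambda>_. b1) (\<lambda>p. \<Psi> p + - ?L p) p = 0" "dd (\<lambda>_. b2) (\<lambda>p. \<Psi> p + - ?L p) p = 0"
        "dd (\<lambda>_. b3) (\<lambda>p. \<Psi> p + - ?L p) p = 0"
        unfolding dd_add[OF \<Psi> sL p] dL using L[OF p, of 1] L[OF p, of 2] L[OF p, of 3] by (simp_all add: e_def)
    qed
    then show ?thesis by (simp add: b_def algebra_simps)
  qed
  have LL: "L i \<bullet> L j = (if i = j then k else 0)" for i j
    using local.conf[OF b1M, of i j] by (simp add: L_def)
  have norm: "?L p \<bullet> ?L p = k * (p \<bullet> p)" for p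
    by (cases p) (simp add: inner_add_left inner_add_right LL algebra_simps)
  have "b = 0"
  proof (rule ccontr)
    assume b: "b \<noteq> 0"
    \<comment> \<open>This is the preimage of -b under L: the columns of L are orthogonal of squared
      length k, so its inverse is the transpose over k.\<close>
    define q where "q = - (1 / k) *\<^sub>R (b \<bullet> L 1, b \<bullet> L 2, b \<bullet> L 3)"
    have "?L q \<bullet> y = - (b \<bullet> y)" for y
    proof -
      have "b \<bullet> y = ((b \<bullet> L 1) * (y \<bullet> L 1) + (b \<bullet> L 2) * (y \<bullet> L 2) + (b \<bullet> L 3) * (y \<bullet> L 3)) / k"
        using inner_expand[OF b1M, of b y] by (simp add: L_def sum_3)
      moreover have "?L q \<bullet> y = - (1 / k) * ((b \<bullet> L 1) * (y \<bullet> L 1) + (b \<bullet> L 2) * (y \<bullet> L 2) + (b \<bullet> L 3) * (y \<bullet> L 3))"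
        by (simp add: q_def inner_add_left inner_commute[of _ y] algebra_simps)
      ultimately show ?thesis by simp
    qed
    then have "(?L q + b) \<bullet> y = 0" for y by (simp add: inner_add_left)
    then have 0: "?L q + b = 0" by (metis inner_eq_zero_iff)
    have "q \<in> ?M"
    proof -
      have "q \<noteq> 0" using 0 b by (auto simp: zero_prod_def)
      then show ?thesis by simp
    qed
    then show False using \<Psi>_eq[of q] nz[of q] 0 by simp
  qed
  then show ?thesis using \<Psi>_eq[OF x] norm[of x] by simp
qed

definition inversion :: "real \<times> real \<times> real \<Rightarrow> real \<times> real \<times> real" where
  "inversion x = inverse (x \<bullet> x) *\<^sub>R x"

lemma smooth_inversion: "smooth_on punctured inversion"
  unfolding inversion_def[abs_def]
  by (intro smooth_on_scaleR smooth_on_inverse_compose smooth_on_inner smooth_on_bounded_linear[OF bounded_linear_ident] open_punctured)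
     simp

lemma inversion_punctured: "x \<in> punctured \<Longrightarrow> inversion x \<in> punctured"
  by (simp add: inversion_def)

lemma inner_inversion: "inversion x \<bullet> inversion x = inverse (x \<bullet> x)"
  by (cases "x = 0") (simp_all add: inversion_def)

text \<open>True at the origin too, because \<open>inverse 0 = 0\<close> makes
  \<open>inversion\<close> fix it.\<close>

lemma inversion_inversion: "inversion (inversion x) = x"
  unfolding inversion_def[of "inversion x"] inner_inversion by (cases "x = 0") (simp_all add: inversion_def)

text \<open>The differential is |x|^(-2) times the reflection in the plane orthogonal to x.\<close>

lemma frechet_derivative_inversion:
  assumes "x \<in> punctured"
  shows "frechet_derivative inversion (at x) u \<bullet> frechet_derivative inversion (at x) w = (u \<bullet> w) / (x \<bullet> x)\<^sup>2"
proof -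
  have x: "x \<bullet> x > 0" using assms by simp
  have "(inversion has_derivative (\<lambda>h. (1 / (x \<bullet> x)) *\<^sub>R h - (2 * (x \<bullet> h) / (x \<bullet> x)\<^sup>2) *\<^sub>R x)) (at x)"
    unfolding inversion_def[abs_def] using x
    by (auto intro!: derivative_eq_intros simp: inner_commute power2_eq_square divide_simps scaleR_left_distrib)
  then have D: "frechet_derivative inversion (at x) = (\<lambda>h. (1 / (x \<bullet> x)) *\<^sub>R h - (2 * (x \<bullet> h) / (x \<bullet> x)\<^sup>2) *\<^sub>R x)"
    by (rule frechet_derivative_at[symmetric])
  define s where "s = x \<bullet> x"
  have s: "s > 0" using x by (simp add: s_def)
  have "((1 / s) *\<^sub>R u - (2 * (x \<bullet> u) / s\<^sup>2) *\<^sub>R x) \<bullet> ((1 / s) *\<^sub>R w - (2 * (x \<bullet> w) / s\<^sup>2) *\<^sub>R x)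
    = (1 / s) * (1 / s) * (u \<bullet> w) - (1 / s) * (2 * (x \<bullet> w) / s\<^sup>2) * (x \<bullet> u)
      - (2 * (x \<bullet> u) / s\<^sup>2) * (1 / s) * (x \<bullet> w) + (2 * (x \<bullet> u) / s\<^sup>2) * (2 * (x \<bullet> w) / s\<^sup>2) * (x \<bullet> x)"
    by (simp only: inner_diff_left inner_diff_right inner_scaleR_left inner_scaleR_right inner_commute[of u x])
       (simp add: algebra_simps)
  also have "\<dots> = (u \<bullet> w) / s\<^sup>2"
    unfolding s_def[symmetric] using s by (simp add: divide_simps power2_eq_square)
  finally show ?thesis unfolding D s_def .
qed

text \<open>The conclusion says that the map preserves |dx|^2/|x|^2, the cylinder metric carried
  over to punctured space.\<close>

lemma punctured_conformal_norm:
  fixes \<Psi> :: "real \<times> real \<times> real \<Rightarrow> real \<times> real \<times> real"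
  assumes \<Psi>: "smooth_on punctured \<Psi>" and nz: "\<And>p. p \<in> punctured \<Longrightarrow> \<Psi> p \<noteq> 0"
    and f: "\<And>p. p \<in> punctured \<Longrightarrow> f p > 0"
    and conf: "\<And>p u v. p \<in> punctured \<Longrightarrow> frechet_derivative \<Psi> (at p) u \<bullet> frechet_derivative \<Psi> (at p) v = f p * (u \<bullet> v)"
    and x: "x \<in> punctured"
  shows "\<Psi> x \<bullet> \<Psi> x = f x * (x \<bullet> x)"
proof -
  let ?M = punctured
  let ?v = "rsqrt f"
  have v2: "f p = 1 / (?v p)\<^sup>2" if "p \<in> ?M" for p
    using f[OF that] by (simp add: rsqrt_def power_inverse divide_inverse)
  have v: "smooth_on ?M ?v"
  proof -
    define e where "e i = (if i = 1 then b1 else if i = 2 then b2 else b3)" for i :: 3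
    have e: "e i \<bullet> e j = (if i = j then 1 else 0)" for i j
      using exhaust_3[of i] exhaust_3[of j] by (elim disjE) (simp_all add: e_def)
    show ?thesis by (rule conformal_frame.smooth_v[OF flat_conformal_frame[OF \<Psi> f conf e]])
  qed
  have v_pos: "?v p > 0" if "p \<in> ?M" for p using f[OF that] by (simp add: rsqrt_def)
  have "(\<exists>c>0. \<forall>p\<in>?M. ?v p = c) \<or> (\<exists>c>0. \<forall>p\<in>?M. ?v p = c * (p \<bullet> p))"
    by (rule Liouville_dichotomy[OF v v_pos Liouville_Hessian[OF \<Psi> f conf]])
  then consider (const) c where "c > 0" "\<forall>p\<in>?M. ?v p = c" | (quad) c where "c > 0" "\<forall>p\<in>?M. ?v p = c * (p \<bullet> p)"
    by blast
  then show ?thesis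
  proof cases
    case const
    then have k: "f p = 1 / c\<^sup>2" if "p \<in> ?M" for p using v2[OF that] that by simp
    show ?thesis unfolding k[OF x]
      by (rule homothety_norm[OF \<Psi> nz _ _ x]) (use const(1) conf k in auto)
  next
    case quad
    then have k: "f p = 1 / (c * (p \<bullet> p))\<^sup>2" if "p \<in> ?M" for p using v2[OF that] that by simp
    \<comment> \<open>Precomposition with the inversion multiplies the factor by |p|^(-4), which
      cancels the |p|^4 of f at the inverted point and reduces to a constant factor.\<close>
    let ?\<Phi> = "\<lambda>x. \<Psi> (inversion x)"
    have D: "frechet_derivative ?\<Phi> (at p) u \<bullet> frechet_derivative ?\<Phi> (at p) w = 1 / c\<^sup>2 * (u \<bullet> w)" if p: "p \<in> ?M" for p u w
    proof -
      have "(?\<Phi> has_derivative (\<lambda>h. frechet_derivative \<Psi> (at (inversion p)) (frechet_derivative inversion (at p) h))) (at p)"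
        by (rule has_derivative_compose[OF smooth_on_has_derivative[OF smooth_inversion p]
              smooth_on_has_derivative[OF \<Psi> inversion_punctured[OF p]]])
      from frechet_derivative_at[OF this, symmetric]
      have "frechet_derivative ?\<Phi> (at p) u \<bullet> frechet_derivative ?\<Phi> (at p) w
        = f (inversion p) * ((u \<bullet> w) / (p \<bullet> p)\<^sup>2)"
        by (simp only: conf[OF inversion_punctured[OF p]] frechet_derivative_inversion[OF p])
      also have "\<dots> = 1 / c\<^sup>2 * (u \<bullet> w)"
        unfolding k[OF inversion_punctured[OF p]] inner_inversion using p by (simp add: field_simps)
      finally show ?thesis .
    qed
    let ?y = "inversion x"
    have "?\<Phi> ?y \<bullet> ?\<Phi> ?y = 1 / c\<^sup>2 * (?y \<bullet> ?y)"
      by (rule homothety_norm[OF smooth_on_compose[OF \<Psi> smooth_inversion inversion_punctured] _ _ D inversion_punctured[OF x]])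
         (use nz inversion_punctured quad(1) in auto)
    then show ?thesis unfolding inversion_inversion inner_inversion k[OF x]
      using x by (simp add: field_simps power2_eq_square)
  qed
qed

subsection \<open>The cylinder \<open>S\<^sup>2 \<times> \<real>\<close>\<close>

text \<open>Inverse of the conformal diffeomorphism \<open>(q, t) \<mapsto> e\<^sup>t q\<close> from the cylinder onto punctured space.\<close>
definition cyl :: "real \<times> real \<times> real \<Rightarrow> (real \<times> real \<times> real) \<times> real" where
  "cyl x = (inverse (sqrt (x \<bullet> x)) *\<^sub>R x, ln (x \<bullet> x) / 2)"

lemma smooth_cyl: "smooth_on punctured cyl"
proof -
  have s: "smooth_on punctured (\<lambda>x. x \<bullet> x)"
    by (intro smooth_on_inner smooth_on_bounded_linear[OF bounded_linear_ident] open_punctured)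
  have "smooth_on punctured (\<lambda>x. inverse (sqrt (x \<bullet> x)))"
    by (rule smooth_on_compose[OF smooth_on_inverse_sqrt s]) simp
  moreover have "smooth_on punctured (\<lambda>x. ln (x \<bullet> x))"
    by (rule smooth_on_compose[OF smooth_on_ln s]) simp
  ultimately show ?thesis
    unfolding cyl_def[abs_def] divide_inverse
    by (intro smooth_on_Pair smooth_on_scaleR smooth_on_mult smooth_on_const open_punctured
        smooth_on_bounded_linear[OF bounded_linear_ident])
qed

lemma cyl_S2R: "x \<in> punctured \<Longrightarrow> cyl x \<in> S2R"
  by (simp add: S2R_def cyl_def flip: norm_eq_sqrt_inner)

lemma cyl_exp: "p \<in> S2R \<Longrightarrow> cyl (exp (snd p) *\<^sub>R fst p) = p" "p \<in> S2R \<Longrightarrow> exp (snd p) *\<^sub>R fst p \<in> punctured"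
proof -
  assume "p \<in> S2R"
  then have "fst p \<bullet> fst p = 1" by (auto simp: S2R_def norm_eq_1)
  moreover from this have "fst p \<noteq> 0" by (metis inner_zero_left zero_neq_one)
  ultimately show "cyl (exp (snd p) *\<^sub>R fst p) = p" "exp (snd p) *\<^sub>R fst p \<in> punctured"
    by (simp_all add: cyl_def real_sqrt_mult ln_mult prod_eqI)
qed

text \<open>The sphere component is h with its radial part removed, over |x|; the line component
  restores the radial part, over |x| as well.\<close>

lemma frechet_derivative_cyl:
  assumes "x \<in> punctured"
  shows "frechet_derivative cyl (at x) u \<bullet> frechet_derivative cyl (at x) w = (u \<bullet> w) / (x \<bullet> x)" (is ?inner)
    and "frechet_derivative cyl (at x) u \<in> S2R_T (cyl x)" (is ?tangent)
proof -
  define r where "r = sqrt (x \<bullet> x)"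
  have xx: "x \<bullet> x > 0" using assms by simp
  have r: "r > 0" "x \<bullet> x = r * r" using xx by (simp_all add: r_def)
  have "(cyl has_derivative (\<lambda>h. ((1 / r) *\<^sub>R h - ((x \<bullet> h) / r ^ 3) *\<^sub>R x, (x \<bullet> h) / (r * r)))) (at x)"
    unfolding cyl_def[abs_def] using r xx
    by (auto intro!: derivative_eq_intros simp: r_def[symmetric] inner_commute power2_eq_square power3_eq_cube divide_simps)
  then have D: "frechet_derivative cyl (at x) = (\<lambda>h. ((1 / r) *\<^sub>R h - ((x \<bullet> h) / r ^ 3) *\<^sub>R x, (x \<bullet> h) / (r * r)))"
    by (rule frechet_derivative_at[symmetric])
  have "((1 / r) *\<^sub>R u - ((x \<bullet> u) / r ^ 3) *\<^sub>R x) \<bullet> ((1 / r) *\<^sub>R w - ((x \<bullet> w) / r ^ 3) *\<^sub>R x)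
    = (1 / r) * (1 / r) * (u \<bullet> w) - (1 / r) * ((x \<bullet> w) / r ^ 3) * (x \<bullet> u)
      - ((x \<bullet> u) / r ^ 3) * (1 / r) * (x \<bullet> w) + ((x \<bullet> u) / r ^ 3) * ((x \<bullet> w) / r ^ 3) * (x \<bullet> x)"
    by (simp only: inner_diff_left inner_diff_right inner_scaleR_left inner_scaleR_right inner_commute[of u x])
       (simp add: algebra_simps)
  also have "\<dots> = (u \<bullet> w) / (r * r) - (x \<bullet> u) * (x \<bullet> w) / (r * r) / (r * r)"
    unfolding r(2) using r by (simp add: divide_simps power3_eq_cube)
  finally show ?inner unfolding D r(2) by (simp add: inner_prod_def)
  have "((1 / r) *\<^sub>R u - ((x \<bullet> u) / r ^ 3) *\<^sub>R x) \<bullet> x = 0"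
    using r by (simp add: inner_diff_left inner_commute[of u x] field_simps eval_nat_numeral)
  then show ?tangent
    unfolding D S2R_T_def cyl_def by simp
qed

text \<open>Derivatives within the cylinder are undetermined in the normal direction, so it must be
  checked that the chosen one is a derivative; its values are later taken on tangent vectors
  only.\<close>

lemma S2R_has_derivative_mdiff:
  assumes "smooth_map_on S2R \<phi>" and p: "p \<in> S2R"
  shows "(\<phi> has_derivative mdiff S2R \<phi> p) (at p within S2R)"
proof -
  obtain W F where W: "open W" "p \<in> W" "smooth_on W F" "\<forall>q\<in>W \<inter> S2R. F q = \<phi> q"
    using assms unfolding smooth_map_on_def by blast
  have "(F has_derivative frechet_derivative F (at p)) (at p within S2R)"
    by (rule has_derivative_at_withinI[OF smooth_on_has_derivative[OF W(3,2)]])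
  moreover have "\<forall>\<^sub>F q in at p within S2R. F q = \<phi> q"
    using W unfolding eventually_at_topological by blast
  ultimately have "(\<phi> has_derivative frechet_derivative F (at p)) (at p within S2R)"
    by (rule has_derivative_transform_eventually) (use W(2,4) p in auto)
  then show ?thesis
    unfolding mdiff_def frechet_derivative_works[symmetric] differentiable_def by blast
qed

text \<open>A tangent vector of the sphere and the unit normal q are orthogonal, so placing the line
  coordinate along q is isometric.\<close>

lemma inner_add_normal:
  fixes X Y :: "'a::real_inner \<times> real"
  assumes "fst X \<bullet> q = 0" "q \<bullet> fst Y = 0" "q \<bullet> q = 1"
  shows "(fst X + snd X *\<^sub>R q) \<bullet> (fst Y + snd Y *\<^sub>R q) = X \<bullet> Y"
  using assms by (cases X; cases Y) (simp add: inner_add_left inner_add_right)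

text \<open>Conjugation by \<open>cyl\<close> moves the problem to punctured space, where
  \<open>punctured_conformal_norm\<close> makes the conjugated map preserve the transported
  metric.\<close>

lemma S2R_isometry:
  assumes "conformal_diffeo S2R S2R_T S2R_g \<phi>"
  shows "isometry_of S2R S2R_T S2R_g \<phi>"
proof -
  let ?M = punctured
  have D: "diffeo_on S2R \<phi>" using assms by (simp add: conformal_diffeo_def)
  then have sm: "smooth_map_on S2R \<phi>" and bij: "bij_betw \<phi> S2R S2R" by (simp_all add: diffeo_on_def)
  obtain f where f: "\<forall>p\<in>S2R. f p > (0::real)"
    "\<forall>p\<in>S2R. \<forall>u\<in>S2R_T p. \<forall>v\<in>S2R_T p. S2R_g (\<phi> p) (mdiff S2R \<phi> p u) (mdiff S2R \<phi> p v) = f p * S2R_g p u v"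
    using assms unfolding conformal_diffeo_def by blast
  have \<phi>: "\<phi> (cyl x) \<in> S2R" if "x \<in> ?M" for x using bij cyl_S2R[OF that] by (auto simp: bij_betw_def)
  have unit: "fst (\<phi> (cyl x)) \<bullet> fst (\<phi> (cyl x)) = 1" if "x \<in> ?M" for x
    using \<phi>[OF that] by (auto simp: S2R_def norm_eq_1)
  define \<Psi> where "\<Psi> x = exp (snd (\<phi> (cyl x))) *\<^sub>R fst (\<phi> (cyl x))" for x
  have smooth: "smooth_on ?M \<Psi>"
  proof (rule smooth_on_local[OF _ open_punctured])
    fix x assume x: "x \<in> ?M"
    obtain W F where W: "open W" "cyl x \<in> W" "smooth_on W F" "\<forall>q\<in>W \<inter> S2R. F q = \<phi> q"
      using sm cyl_S2R[OF x] unfolding smooth_map_on_def by blast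
    \<comment> \<open>A smooth extension of \<open>\<phi>\<close> exists only near each point, so
      smoothness is checked on the preimage of its domain.\<close>
    let ?V = "?M \<inter> cyl -` W"
    have V: "open ?V"
      using continuous_open_preimage[OF smooth_on_continuous[OF smooth_cyl] open_punctured W(1)] .
    have c: "smooth_on ?V (\<lambda>x. F (cyl x))"
      by (rule smooth_on_compose[OF W(3) smooth_on_subset[OF smooth_cyl V]]) auto
    have "smooth_on ?V (\<lambda>x. exp (snd (F (cyl x))) *\<^sub>R fst (F (cyl x)))"
      by (intro smooth_on_scaleR smooth_on_exp_compose smooth_on_fst_comp c)
    then have "smooth_on ?V \<Psi>"
      by (rule smooth_on_cong) (use W(4) cyl_S2R in \<open>auto simp: \<Psi>_def\<close>)
    moreover have "x \<in> ?V" using x W(2) by simp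
    ultimately show "\<exists>W. x \<in> W \<and> smooth_on W \<Psi>" by (intro exI[of _ ?V] conjI)
  qed
  let ?d = "\<lambda>x h. mdiff S2R \<phi> (cyl x) (frechet_derivative cyl (at x) h)"
  have dc: "((\<lambda>x. \<phi> (cyl x)) has_derivative ?d x) (at x)" if x: "x \<in> ?M" for x
  proof -
    have "(\<phi> has_derivative mdiff S2R \<phi> (cyl x)) (at (cyl x) within cyl ` ?M)"
      by (rule has_derivative_subset[OF S2R_has_derivative_mdiff[OF sm cyl_S2R[OF x]]])
         (intro image_subsetI cyl_S2R)
    from has_derivative_in_compose[OF has_derivative_at_withinI[OF smooth_on_has_derivative[OF smooth_cyl x]] this]
    show ?thesis by (simp add: at_within_open[OF x open_punctured])
  qed
  \<comment> \<open>Differentiating |q|^2 = 1 shows that the image of the differential stays tangent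
    to the sphere.\<close>
  have tang: "fst (?d x h) \<bullet> fst (\<phi> (cyl x)) = 0" if x: "x \<in> ?M" for x h
  proof -
    have "((\<lambda>x. fst (\<phi> (cyl x)) \<bullet> fst (\<phi> (cyl x))) has_derivative
        (\<lambda>h. fst (\<phi> (cyl x)) \<bullet> fst (?d x h) + fst (?d x h) \<bullet> fst (\<phi> (cyl x)))) (at x)"
      by (intro has_derivative_inner has_derivative_fst dc x)
    moreover have "((\<lambda>x. fst (\<phi> (cyl x)) \<bullet> fst (\<phi> (cyl x))) has_derivative (\<lambda>h. 0)) (at x)"
      by (rule has_derivative_transform_within_open[OF has_derivative_const open_punctured x, of 1])
         (simp add: unit)
    ultimately have "(\<lambda>h. fst (\<phi> (cyl x)) \<bullet> fst (?d x h) + fst (?d x h) \<bullet> fst (\<phi> (cyl x))) = (\<lambda>h. 0)"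
      by (rule has_derivative_unique)
    then have "fst (\<phi> (cyl x)) \<bullet> fst (?d x h) + fst (?d x h) \<bullet> fst (\<phi> (cyl x)) = 0" by (rule fun_cong)
    then show ?thesis by (simp add: inner_commute)
  qed
  \<comment> \<open>Three scalings: 1/|x|^2 from \<open>cyl\<close>, f from \<open>\<phi>\<close>,
    and e^(2t) from mapping back. The last equals |\<Psi> x|^2, so the norm identity cancels
    everything but f.\<close>
  let ?k = "\<lambda>x. (exp (snd (\<phi> (cyl x))))\<^sup>2 * f (cyl x) / (x \<bullet> x)"
  have conf: "frechet_derivative \<Psi> (at x) u \<bullet> frechet_derivative \<Psi> (at x) w = ?k x * (u \<bullet> w)" if x: "x \<in> ?M" for x u w
  proof -
    let ?a = "exp (snd (\<phi> (cyl x)))" and ?q = "fst (\<phi> (cyl x))"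
    have "(\<Psi> has_derivative (\<lambda>h. ?a *\<^sub>R (fst (?d x h) + snd (?d x h) *\<^sub>R ?q))) (at x)"
      unfolding \<Psi>_def
      by (auto intro!: derivative_eq_intros dc[OF x] simp: scaleR_add_right mult.commute)
    from frechet_derivative_at[OF this, symmetric]
    have "frechet_derivative \<Psi> (at x) u \<bullet> frechet_derivative \<Psi> (at x) w
      = ?a\<^sup>2 * ((fst (?d x u) + snd (?d x u) *\<^sub>R ?q) \<bullet> (fst (?d x w) + snd (?d x w) *\<^sub>R ?q))"
      by (simp add: power2_eq_square)
    also have "(fst (?d x u) + snd (?d x u) *\<^sub>R ?q) \<bullet> (fst (?d x w) + snd (?d x w) *\<^sub>R ?q) = ?d x u \<bullet> ?d x w"
      by (rule inner_add_normal) (use tang[OF x] unit[OF x] in \<open>simp_all add: inner_commute\<close>)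
    also have "?d x u \<bullet> ?d x w = f (cyl x) * ((u \<bullet> w) / (x \<bullet> x))"
      using f(2) cyl_S2R[OF x] frechet_derivative_cyl[OF x] unfolding S2R_g_def by simp
    finally show ?thesis by simp
  qed
  have one: "f (cyl x) = 1" if x: "x \<in> ?M" for x
  proof -
    have "\<Psi> x \<bullet> \<Psi> x = ?k x * (x \<bullet> x)"
    proof (rule punctured_conformal_norm[OF smooth _ _ conf x])
      show "\<Psi> p \<noteq> 0" if "p \<in> ?M" for p using unit[OF that] by (auto simp: \<Psi>_def)
      show "?k p > 0" if "p \<in> ?M" for p using f(1) cyl_S2R[OF that] that by simp
    qed
    moreover have "\<Psi> x \<bullet> \<Psi> x = (exp (snd (\<phi> (cyl x))))\<^sup>2" using unit[OF x] by (simp add: \<Psi>_def power2_eq_square)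
    ultimately show ?thesis using x by simp
  qed
  have "f p = 1" if "p \<in> S2R" for p using one[OF cyl_exp(2)[OF that]] cyl_exp(1)[OF that] by simp
  then show ?thesis using D f(2) by (simp add: isometry_of_def)
qed

theorem theorem7p1:
  shows "(\<forall>\<phi>. conformal_diffeo H2R H2R_T H2R_g \<phi> \<longrightarrow> isometry_of H2R H2R_T H2R_g \<phi>)
       \<and> (\<forall>\<phi>. conformal_diffeo S2R S2R_T S2R_g \<phi> \<longrightarrow> isometry_of S2R S2R_T S2R_g \<phi>)
       \<and> (\<forall>\<phi>. conformal_diffeo Sol Sol_T Sol_g \<phi> \<longrightarrow> isometry_of Sol Sol_T Sol_g \<phi>)"
  using H2R_isometry S2R_isometry Sol_isometry by blast

end
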